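(* Consider the CP-SGD algorithm (defined in the context) run on the problem $\min_{x\in\mathbb{R}^d} f(x)=\frac1n\sum_{i=1}^n f_i(x)$ over a network of $n$ agents, where the stochastic gradients are not assumed unbiased. Suppose: (1) the undirected communication graph is connected; (2) each $f_i:\mathbb{R}^d\to\mathbb{R}$ is $L_f$-smooth for some $L_f>0$, i.e. $\|\nabla f_i(x)-\nabla f_i(y)\|\le L_f\|x-y\|$ for all $x,y\in\mathbb{R}^d$; (3) the random variables $\{\xi_{i,k}\}$ (over all agents $i$ and iterations $k$) are mutually independent; (4) there is $\sigma>0$ with $\mathbb{E}_{\xi_{i,k}}\|g_i(x,\xi_{i,k})-\nabla f_i(x)\|^2\le\sigma^2$ for all $i$, $k$, $x\in\mathbb{R}^d$; (5) $f^*:=\inf_x f(x)>-\infty$; (6) (Polyak--Łojasiewicz) there is $\nu>0$ with $\frac12\|\nabla f(x)\|^2\ge\nu(f(x)-f^* )$ for all $x\in\mathbb{R}^d$; (7) there are constants $\varphi\in(0,1]$, $r>0$ such that the (possibly random) compressor $C:\mathbb{R}^d\to\mathbb{R}^d$ satisfies $\mathbb{E}_C\big[\|C(x)/r-x\|^2\big]\le(1-\varphi)\|x\|^2$ for all $x\in\mathbb{R}^d$. Let $\gamma_k=\beta_1\omega_k$, $\omega_k=\omega>\check\beta_3$, $\eta_k=\eta=\beta_2/\omega$ for all $k$, and $\alpha_x\in(0,\frac1r)$, where $\beta_1>c_0$, $\beta_2>0$. Then, with $\bar x_k=\frac1n\sum_{i=1}^nx_{i,k}$, for all integers $k\ge0$,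 $$\mathbb{E}\Big[\sum_{i=1}^n\|x_{i,k+1}-\bar x_{k+1}\|^2+n\big(f(\bar x_{k+1})-f^*\big)\Big]\le(1-\eta\bar\beta)^{k+1}\frac{V_0}{\check c_1}+\frac{\check c_3\,n\sigma^2}{\bar\beta\,\check c_1},$$ where $\bar\beta,\check\beta_3,c_0,\check c_1,\check c_3,V_0$ are the positive quantities given in the context, and $0<\eta\bar\beta\le\frac23$.
   Context: Network. $\mathcal{G}=(\mathcal{V},\mathcal{E})$ is an undirected graph on $\mathcal{V}=\{1,\dots,n\}$ with symmetric weight matrix $W=[w_{ij}]$, $w_{ij}>0$ if $(i,j)\in\mathcal{E}$ and $w_{ij}=0$ otherwise; $D=\mathrm{diag}(d_1,\dots,d_n)$, $d_i=\sum_j w_{ij}$; Laplacian $L=D-W=[L_{ij}]$. $\bar\lambda_L$ is the spectral radius of $L$ and $\underline\lambda_L$ its smallest positive eigenvalue. $\|\cdot\|$ is the Euclidean norm and $\|x\|_A^2=x^\top Ax$. Algorithm (CP-SGD). Agent $i$ has access only to stochastic gradients $g_i(x,\xi_{i,k})$ of $f_i$. Positive parameters $\{\eta_k\},\{\gamma_k\},\{\omega_k\},\alpha_x$ are given. Initialization: $x_{i,0}\in\mathbb{R}^d$ arbitrary, $x_{i,0}^c=\mathbf{0}_d$, $v_{i,0}=\mathbf{0}_d$. For $k=0,1,\dots$ and every $i$: $$\hat x_{i,k}=x_{i,k}^c+C(x_{i,k}-x_{i,k}^c),\qquad x_{i,k+1}^c=(1-\alpha_x)x_{i,k}^c+\alpha_x\hat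 x_{i,k},$$ $$x_{i,k+1}=x_{i,k}-\eta_k\Big(\gamma_k\sum_{j=1}^nL_{ij}\hat x_{j,k}+\omega_kv_{i,k}+g_i(x_{i,k},\xi_{i,k})\Big),\qquad v_{i,k+1}=v_{i,k}+\eta_k\omega_k\sum_{j=1}^nL_{ij}\hat x_{j,k}.$$ $\mathbb{E}_{\xi_{i,k}}$ is expectation over $\xi_{i,k}$ with $x$ fixed, $\mathbb{E}_C$ is expectation over the internal randomness of the compressor with $x$ fixed (this randomness is drawn afresh at each use), and $\mathbb{E}$ is total expectation. Initial Lyapunov value. Let $K_n=I_n-\frac1n\mathbf 1_n\mathbf 1_n^\top$, $\mathbf K=K_n\otimes I_d$. Let $0<\lambda_2\le\dots\le\lambda_n$ be the nonzero eigenvalues of $L$, $\rho=\frac{1}{\sqrt n}\mathbf 1_n$, and $R\in\mathbb{R}^{n\times(n-1)}$ with $[\rho\ R]$ orthogonal and $L=R\Lambda_1R^\top$, $\Lambda_1=\mathrm{diag}(\lambda_2,\dots,\lambda_n)$; set $P=\lambda_n^{-1}\rho\rho^\top+R\Lambda_1^{-1}R^\top$, $\mathbf P=P\otimes I_d$. With stacked vectors $\mathbf x_0,\mathbf v_0,\mathbf x_0^c\in\mathbb{R}^{nd}$ of $x_{i,0},v_{i,0},x_{i,0}^c$ (so $\mathbf v_0=\mathbf x_0^c=\mathbf 0$) and $\mathbf g_0^b\in\mathbb{R}^{nd}$ the stacked vector of $\nabla f_i(\bar x_0)$, $$V_0=\tfrac12\|\mathbf x_0\|_{\mathbf K}^2+\tfrac{1+\beta_1}{2}\big\|\mathbf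 v_0+\tfrac1\omega\mathbf g_0^b\big\|_{\mathbf P}^2+\mathbf x_0^\top\mathbf K\mathbf P\big(\mathbf v_0+\tfrac1\omega\mathbf g_0^b\big)+n(f(\bar x_0)-f^* )+\|\mathbf x_0-\mathbf x_0^c\|^2 .$$ Constants. Fix any $\beta_5>0$. With $\gamma=\beta_1\omega$, $r_0=2r^2(1-\varphi)+2(1-r)^2$, $\varphi_2=\alpha_xr\varphi$, set - $c_0=\max\{\frac{9+\beta_5}{2\underline\lambda_L},1\}$; - $\tilde\epsilon_1=\frac{\gamma}{2}\underline\lambda_L-\big(\frac{9\omega+4}{4}+\frac54L_f^2\big)$, $\ \check\epsilon_1=\tilde\epsilon_1-\frac54L_f^2$; - $\tilde\epsilon_2=(12+\frac{16}{\varphi_2})L_f^2+(4+\frac{8}{\varphi_2})\gamma^2\bar\lambda_L^2+1+2\omega^2+3\gamma^2\bar\lambda_L^2$, $\ \check\epsilon_2=\tilde\epsilon_2+L_f^2$; - $\epsilon_4=\frac{3\omega-1}{4}-3\underline\lambda_L^{-1}$; - $\epsilon_5=\omega^2\bar\lambda_L+\underline\lambda_L^{-1}+(4+\frac{8}{\varphi_2})\omega^2\underline\lambda_L$; - $\check\epsilon_6=\frac18-\big(\frac{1+\beta_1}{\omega^2\underline\lambda_L}+\frac{1}{2\omega^2\underline\lambda_L^2}\big)L_f^2$; - $\check\epsilon_7=\big(\frac{1+\beta_1}{2\omega^2\underline\lambda_L}+\frac{1}{2\omega^2\underline\lambda_L^2}+\frac34\big)L_f^2+\frac{L_f}{2}$;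 - $\epsilon_{10}=\frac{\varphi_2}{2}+\frac{\varphi_2^2}{2}$; - $\epsilon_{11}=\frac12(\gamma+2\omega)\bar\lambda_Lr_0+2\omega r_0$; - $\epsilon_{12}=\frac{(8+7\varphi_2)\gamma^2\bar\lambda_L^2r_0}{\varphi_2}+(1+2\omega^2)r_0$; - $\check\beta_4=\min\big\{\frac{\check\epsilon_1}{\check\epsilon_2},\frac{\epsilon_4}{\epsilon_5},\frac{\check\epsilon_6}{\check\epsilon_7},\frac{\sqrt{\epsilon_{11}^2+4\epsilon_{10}\epsilon_{12}}-\epsilon_{11}}{2\epsilon_{12}}\big\}$; - $\beta_6=\big(\frac{16(1+\beta_1)}{\underline\lambda_L}+\frac{8}{\underline\lambda_L^2}\big)L_f^2$; - $\check\beta_3=\max\big\{\frac{4+10L_f^2}{\beta_5},\frac{12\underline\lambda_L^{-1}+1}{3},\sqrt{\beta_6},\frac{\beta_2}{\check\beta_4},4\beta_2L_f\big\}$; - $\check c_1=\frac{\gamma\underline\lambda_L-\omega}{2\gamma\underline\lambda_L}$, $\ \check c_3=3+13\eta+\frac{16\eta}{\varphi_2}$; - $\beta_8=\max\{\frac12+\beta_1,\frac{\gamma\underline\lambda_L+\omega}{2\gamma\underline\lambda_L}\}$; - $\beta_9=\eta\min\{\tilde\epsilon_1-\tilde\epsilon_2\eta,\ \epsilon_4-\epsilon_5\eta,\ \frac\nu2,\ \frac{\epsilon_{10}}{\eta}-\epsilon_{11}-\epsilon_{12}\eta\}$; - $\bar\beta=\frac{\beta_9}{\eta\beta_8}$.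 Since $\check\beta_4$ depends on $\omega$, so does $\check\beta_3$; the requirement $\omega>\check\beta_3$ is read as a condition on $\omega$ with $\check\beta_3$ evaluated at that $\omega$.
   Formalization: V_0 is shown nonnegative rather than positive, since V_0 = 0 occurs when all x_{i,0} = 0 and 0 minimizes every f_i; for φ = r = 1 the last entry of β̌_4, which reads 0/0, is omitted from the minimum. *)

theory Defs
  imports "HOL-Probability.Probability"
begin

section \<open>Weighted graphs and their Laplacian\<close>

definition weighted_graph :: "('n::finite \<times> 'n) set \<Rightarrow> real^'n^'n \<Rightarrow> bool" where
  "weighted_graph E W \<longleftrightarrow> sym E \<and> transpose W = W \<and>
     (\<forall>i j. ((i, j) \<in> E \<longrightarrow> 0 < W$i$j) \<and> ((i, j) \<notin> E \<longrightarrow> W$i$j = 0))"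

definition connected_graph :: "('n \<times> 'n) set \<Rightarrow> bool" where
  "connected_graph E \<longleftrightarrow> (\<forall>i j. (i, j) \<in> E\<^sup>*)"

definition diag_matrix :: "real^'n \<Rightarrow> real^'n^'n" where
  "diag_matrix d = (\<chi> i j. if i = j then d$i else 0)"

definition laplacian :: "real^'n^'n \<Rightarrow> real^'n^'n" where
  "laplacian W = diag_matrix (\<chi> i. \<Sum>j\<in>UNIV. W$i$j) - W"

definition eigenvalues :: "'a::field^'n^'n \<Rightarrow> 'a set" where
  "eigenvalues A = {z. \<exists>v. v \<noteq> 0 \<and> A *v v = z *s v}"

definition spectral_radius :: "real^'n^'n \<Rightarrow> real" where
  "spectral_radius A = Max (cmod ` eigenvalues (\<chi> i j. complex_of_real (A$i$j)))"

definition min_pos_eigenvalue :: "real^'n^'n \<Rightarrow> real" where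
  "min_pos_eigenvalue A = Min {z \<in> eigenvalues A. 0 < z}"

definition outer_product :: "real^'n \<Rightarrow> real^'n^'n" where
  "outer_product u = (\<chi> i j. u$i * u$j)"

definition rho_vec :: "real^'n" where
  "rho_vec = (\<chi> i. 1 / sqrt (real CARD('n)))"

text \<open>The \<open>n \<times> n\<close> matrix \<open>[\<rho> R]\<close>. Its columns are indexed by \<open>'m option\<close>, the column
  \<open>\<rho>\<close> being the one with index \<open>None\<close>.\<close>

definition rho_R :: "real^'m^'n \<Rightarrow> real^('m option)^'n" where
  "rho_R R = (\<chi> i c. case c of None \<Rightarrow> rho_vec$i | Some j \<Rightarrow> R$i$j)"

text \<open>Here \<open>'m\<close> indexes the \<open>n - 1\<close> nonzero eigenvalues, with multiplicity. As types are
  nonempty, the cardinality condition forces \<open>n \<ge> 2\<close>, which is needed for \<open>L\<close> to have a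
  positive eigenvalue at all. The library's \<open>orthogonal_matrix\<close> requires equal index types
  for rows and columns, so orthogonality of \<open>[\<rho> R]\<close> is written out.\<close>

definition laplacian_decomposition ::
    "real^'n^'n \<Rightarrow> real^'m^'n \<Rightarrow> real^'m \<Rightarrow> bool" where
  "laplacian_decomposition L R lam \<longleftrightarrow>
     CARD('n) = CARD('m) + 1 \<and>
     transpose (rho_R R) ** rho_R R = mat 1 \<and>
     rho_R R ** transpose (rho_R R) = mat 1 \<and>
     (\<forall>j. 0 < lam$j) \<and>
     L = R ** diag_matrix lam ** transpose R"

definition P_matrix :: "real^'m^'n \<Rightarrow> real^'m \<Rightarrow> real^'n^'n" where
  "P_matrix R lam = (1 / Max (range (($) lam))) *\<^sub>R outer_product rho_vec
     + R ** diag_matrix (\<chi> j. 1 / lam$j) ** transpose R"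

definition K_matrix :: "real^'n^'n" where
  "K_matrix = mat 1 - (1 / real CARD('n)) *\<^sub>R outer_product (\<chi> i. 1)"

section \<open>Objective functions\<close>

definition gradient :: "('a::real_inner \<Rightarrow> real) \<Rightarrow> 'a \<Rightarrow> 'a" where
  "gradient f x = (THE D. GDERIV f x :> D)"

definition L_smooth :: "real \<Rightarrow> ('a::real_inner \<Rightarrow> real) \<Rightarrow> bool" where
  "L_smooth Lf f \<longleftrightarrow> (\<forall>x. f differentiable (at x)) \<and>
     (\<forall>x y. norm (gradient f x - gradient f y) \<le> Lf * norm (x - y))"

definition avg_fun :: "('n::finite \<Rightarrow> 'a \<Rightarrow> real) \<Rightarrow> 'a \<Rightarrow> real" where
  "avg_fun f x = (1 / real CARD('n)) * (\<Sum>i\<in>UNIV. f i x)"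

definition inf_value :: "('a \<Rightarrow> real) \<Rightarrow> real" where
  "inf_value f = (INF x. f x)"

text \<open>A stacked vector in \<open>\<real>\<^sup>n\<^sup>d\<close> is an element of \<open>real^'d^'n\<close>, component \<open>i\<close> being the block
  of agent \<open>i\<close>. The inner product and norm of this type are the Euclidean ones of \<open>\<real>\<^sup>n\<^sup>d\<close>, and
  for an \<open>n \<times> n\<close> matrix \<open>A\<close> the matrix product \<open>A ** X\<close> is \<open>(A \<otimes> I\<^sub>d) X\<close>.\<close>

definition mean :: "real^'d^'n \<Rightarrow> real^'d" where
  "mean X = (1 / real CARD('n)) *\<^sub>R (\<Sum>i\<in>UNIV. X$i)"

definition sq_norm_wrt :: "real^'n^'n \<Rightarrow> real^'d^'n \<Rightarrow> real" where
  "sq_norm_wrt A X = X \<bullet> (A ** X)"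

definition grad_at_mean :: "('n::finite \<Rightarrow> real^'d \<Rightarrow> real) \<Rightarrow> real^'d^'n \<Rightarrow> real^'d^'n" where
  "grad_at_mean f X = (\<chi> i. gradient (f i) (mean X))"

definition lyapunov ::
    "real^'n^'n \<Rightarrow> real \<Rightarrow> real \<Rightarrow> ('n::finite \<Rightarrow> real^'d \<Rightarrow> real)
      \<Rightarrow> real^'d^'n \<Rightarrow> real^'d^'n \<Rightarrow> real^'d^'n \<Rightarrow> real" where
  "lyapunov P b1 om f X V Xc =
     (let Y = V + (1 / om) *\<^sub>R grad_at_mean f X in
        1/2 * sq_norm_wrt K_matrix X
      + (1 + b1) / 2 * sq_norm_wrt P Y
      + X \<bullet> ((K_matrix ** P) ** Y)
      + real CARD('n) * (avg_fun f (mean X) - inf_value (avg_fun f))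
      + (norm (X - Xc))\<^sup>2)"

section \<open>The algorithm\<close>

text \<open>A random compressor is a function \<open>C\<close> whose first argument is a random seed, and \<open>g i x s\<close> is
  the stochastic gradient of agent \<open>i\<close> at \<open>x\<close> for the sample \<open>s\<close>. The state consists of
  the stacked vectors \<open>(x, x\<^sup>c, v)\<close>. Each agent uses the compressor once per iteration: the same
  compressed vector enters its own update and is sent to its neighbours.\<close>

definition cpsgd_step ::
    "real^'n^'n \<Rightarrow> ('r \<Rightarrow> real^'d \<Rightarrow> real^'d) \<Rightarrow> ('n::finite \<Rightarrow> real^'d \<Rightarrow> 's \<Rightarrow> real^'d)
      \<Rightarrow> real \<Rightarrow> real \<Rightarrow> real \<Rightarrow> real \<Rightarrow> ('n \<Rightarrow> 's) \<Rightarrow> ('n \<Rightarrow> 'r)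
      \<Rightarrow> (real^'d^'n) \<times> (real^'d^'n) \<times> (real^'d^'n)
      \<Rightarrow> (real^'d^'n) \<times> (real^'d^'n) \<times> (real^'d^'n)" where
  "cpsgd_step L C g ax et gam om s z = (\<lambda>(X, Xc, V).
     let Xh = (\<chi> i. Xc$i + C (z i) (X$i - Xc$i)) in
       ((\<chi> i. X$i - et *\<^sub>R (gam *\<^sub>R (\<Sum>j\<in>UNIV. L$i$j *\<^sub>R Xh$j) + om *\<^sub>R V$i + g i (X$i) (s i))),
        (\<chi> i. (1 - ax) *\<^sub>R Xc$i + ax *\<^sub>R Xh$i),
        (\<chi> i. V$i + (et * om) *\<^sub>R (\<Sum>j\<in>UNIV. L$i$j *\<^sub>R Xh$j))))"

primrec cpsgd ::
    "real^'n^'n \<Rightarrow> ('r \<Rightarrow> real^'d \<Rightarrow> real^'d) \<Rightarrow> ('n::finite \<Rightarrow> real^'d \<Rightarrow> 's \<Rightarrow> real^'d)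
      \<Rightarrow> real \<Rightarrow> (nat \<Rightarrow> real) \<Rightarrow> (nat \<Rightarrow> real) \<Rightarrow> (nat \<Rightarrow> real) \<Rightarrow> real^'d^'n
      \<Rightarrow> ('n \<Rightarrow> nat \<Rightarrow> 'w \<Rightarrow> 's) \<Rightarrow> ('n \<Rightarrow> nat \<Rightarrow> 'w \<Rightarrow> 'r) \<Rightarrow> 'w \<Rightarrow> nat
      \<Rightarrow> (real^'d^'n) \<times> (real^'d^'n) \<times> (real^'d^'n)" where
  "cpsgd L C g ax et gam om x0 \<xi> \<zeta> w 0 = (x0, 0, 0)"
| "cpsgd L C g ax et gam om x0 \<xi> \<zeta> w (Suc k) =
     cpsgd_step L C g ax (et k) (gam k) (om k) (\<lambda>i. \<xi> i k w) (\<lambda>i. \<zeta> i k w)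
       (cpsgd L C g ax et gam om x0 \<xi> \<zeta> w k)"

text \<open>The events generated by a random variable, as in the library's \<open>indep_vars\<close>. That notion
  requires all variables to have the same value type, whereas samples and compressor seeds
  may have different ones.\<close>

definition events_of :: "'w measure \<Rightarrow> 'a measure \<Rightarrow> ('w \<Rightarrow> 'a) \<Rightarrow> 'w set set" where
  "events_of M N X = {X -` A \<inter> space M | A. A \<in> sets N}"

text \<open>Fresh compressor randomness: the seeds \<open>\<zeta> i k\<close> all have law \<open>Q\<close>, and all samples
  (index \<open>Inl (i, k)\<close>) and seeds (index \<open>Inr (i, k)\<close>) are mutually independent.\<close>

definition fresh_seeds ::
    "'w measure \<Rightarrow> ('n \<Rightarrow> 's measure) \<Rightarrow> 'r measure
      \<Rightarrow> ('n \<Rightarrow> nat \<Rightarrow> 'w \<Rightarrow> 's) \<Rightarrow> ('n \<Rightarrow> nat \<Rightarrow> 'w \<Rightarrow> 'r) \<Rightarrow> bool" where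
  "fresh_seeds M S Q \<xi> \<zeta> \<longleftrightarrow>
     (\<forall>i k. \<zeta> i k \<in> M \<rightarrow>\<^sub>M Q \<and> distr M Q (\<zeta> i k) = Q) \<and>
     prob_space.indep_sets M
       (case_sum (\<lambda>(i, k). events_of M (S i) (\<xi> i k)) (\<lambda>(i, k). events_of M Q (\<zeta> i k))) UNIV"

section \<open>Constants\<close>

record cp_params =
  lam_min :: real
  lam_max :: real
  Lip :: real
  pl_nu :: real
  cmp_phi :: real
  cmp_r :: real
  alpha_x :: real
  beta1 :: real
  beta2 :: real
  beta5 :: real
  omega :: real

definition gamma where "gamma p = beta1 p * omega p"

definition eta where "eta p = beta2 p / omega p"

definition r0 where
  "r0 p = 2 * (cmp_r p)\<^sup>2 * (1 - cmp_phi p) + 2 * (1 - cmp_r p)\<^sup>2"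

definition phi2 where "phi2 p = alpha_x p * cmp_r p * cmp_phi p"

definition c0 where "c0 p = max ((9 + beta5 p) / (2 * lam_min p)) 1"

definition eps1_tilde where
  "eps1_tilde p = gamma p / 2 * lam_min p - ((9 * omega p + 4) / 4 + 5/4 * (Lip p)\<^sup>2)"

definition eps1_check where
  "eps1_check p = eps1_tilde p - 5/4 * (Lip p)\<^sup>2"

definition eps2_tilde where
  "eps2_tilde p = (12 + 16 / phi2 p) * (Lip p)\<^sup>2
     + (4 + 8 / phi2 p) * (gamma p)\<^sup>2 * (lam_max p)\<^sup>2
     + 1 + 2 * (omega p)\<^sup>2 + 3 * (gamma p)\<^sup>2 * (lam_max p)\<^sup>2"

definition eps2_check where "eps2_check p = eps2_tilde p + (Lip p)\<^sup>2"

definition eps4 where "eps4 p = (3 * omega p - 1) / 4 - 3 * (1 / lam_min p)"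

definition eps5 where
  "eps5 p = (omega p)\<^sup>2 * lam_max p + 1 / lam_min p
     + (4 + 8 / phi2 p) * (omega p)\<^sup>2 * lam_min p"

definition eps6_check where
  "eps6_check p = 1/8 - ((1 + beta1 p) / ((omega p)\<^sup>2 * lam_min p)
     + 1 / (2 * (omega p)\<^sup>2 * (lam_min p)\<^sup>2)) * (Lip p)\<^sup>2"

definition eps7_check where
  "eps7_check p = ((1 + beta1 p) / (2 * (omega p)\<^sup>2 * lam_min p)
     + 1 / (2 * (omega p)\<^sup>2 * (lam_min p)\<^sup>2) + 3/4) * (Lip p)\<^sup>2 + Lip p / 2"

definition eps10 where "eps10 p = phi2 p / 2 + (phi2 p)\<^sup>2 / 2"

definition eps11 where
  "eps11 p = 1/2 * (gamma p + 2 * omega p) * lam_max p * r0 p + 2 * omega p * r0 p"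

definition eps12 where
  "eps12 p = (8 + 7 * phi2 p) * (gamma p)\<^sup>2 * (lam_max p)\<^sup>2 * r0 p / phi2 p
     + (1 + 2 * (omega p)\<^sup>2) * r0 p"

text \<open>The last entry of the minimum is the positive root \<open>t\<close> of \<open>\<epsilon>\<^sub>1\<^sub>0 - \<epsilon>\<^sub>1\<^sub>1 t - \<epsilon>\<^sub>1\<^sub>2 t\<^sup>2\<close>, below
  which this polynomial is positive. If \<open>\<phi> = r = 1\<close> then \<open>r\<^sub>0 = \<epsilon>\<^sub>1\<^sub>1 = \<epsilon>\<^sub>1\<^sub>2 = 0\<close>, and the entry reads \<open>0/0\<close>;
  it is then taken to be \<open>+\<infinity>\<close>, i.e. omitted, rather than \<open>0\<close> as HOL division would give.\<close>

definition beta4_check where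
  "beta4_check p =
     Min ({eps1_check p / eps2_check p, eps4 p / eps5 p, eps6_check p / eps7_check p}
       \<union> (if eps12 p = 0 then {}
          else {(sqrt ((eps11 p)\<^sup>2 + 4 * eps10 p * eps12 p) - eps11 p) / (2 * eps12 p)}))"

definition beta6 where
  "beta6 p = (16 * (1 + beta1 p) / lam_min p + 8 / (lam_min p)\<^sup>2) * (Lip p)\<^sup>2"

definition beta3_check where
  "beta3_check p = Max {(4 + 10 * (Lip p)\<^sup>2) / beta5 p, (12 * (1 / lam_min p) + 1) / 3,
     sqrt (beta6 p), beta2 p / beta4_check p, 4 * beta2 p * Lip p}"

definition c1_check where
  "c1_check p = (gamma p * lam_min p - omega p) / (2 * gamma p * lam_min p)"

definition c3_check where "c3_check p = 3 + 13 * eta p + 16 * eta p / phi2 p"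

definition beta8 where
  "beta8 p = max (1/2 + beta1 p) ((gamma p * lam_min p + omega p) / (2 * gamma p * lam_min p))"

definition beta9 where
  "beta9 p = eta p * Min {eps1_tilde p - eps2_tilde p * eta p, eps4 p - eps5 p * eta p,
     pl_nu p / 2, eps10 p / eta p - eps11 p - eps12 p * eta p}"

definition beta_bar where "beta_bar p = beta9 p / (eta p * beta8 p)"

end

theory Submission
  imports Defs
begin

text \<open>
  Write \<open>x = K X\<close> for the consensus error, \<open>z = K (V + g\<^sup>b / \<omega>)\<close> for the dual error, where \<open>g\<^sup>b\<close> stacks the
  gradients of the \<open>f\<^sub>i\<close> at the mean of \<open>X\<close>, \<open>u = X - X\<^sup>c\<close> for the compression error, and \<open>P\<close> for the
  pseudo-inverse of the Laplacian. The proof shows that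
  \<open>\<Phi> = |x|\<^sup>2 / 2 + \<kappa> / 2 (z \<cdot> P z) + c (x \<cdot> P z) + n (f(mean X) - f\<^sup>*) + |u|\<^sup>2\<close>
  decreases in expectation by the factor \<open>1 - \<eta> \<tau>\<close>, with \<open>\<tau>\<close> the rate \<open>beta_bar\<close>, up to a multiple of \<open>n \<sigma>\<^sup>2\<close>.

  Why \<open>\<Phi>\<close> decreases: the Laplacian term \<open>\<gamma> L X\<close> contracts \<open>x\<close>, the product \<open>x \<cdot> P z\<close> transfers this
  contraction to \<open>z\<close> (it contributes \<open>- c \<omega> z \<cdot> P z\<close>), the descent lemma gives a negative multiple of the
  squared mean gradient, which the Polyak-Lojasiewicz inequality turns into a decrease of the gap, and a
  compression step shrinks \<open>|u|\<^sup>2\<close> by the factor \<open>1 - \<phi>\<^sub>2\<close>. Everything else is a product of two of these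
  quantities and is split by Young's inequality. With \<open>\<kappa> = j + c \<beta>\<^sub>1\<close> the inner products \<open>x \<cdot> z\<close> coming from
  the three quadratic parts cancel up to \<open>- (1 - j) \<omega> x \<cdot> z\<close>.

  The delicate product comes from the drift of \<open>g\<^sup>b\<close>: it is \<open>(\<kappa> / \<omega>) z \<cdot> P \<Delta>\<close> with \<open>|\<Delta>|\<close> at most \<open>\<eta> L\<^sub>f |q|\<close>,
  \<open>q\<close> being the averaged stochastic gradient, and it has to be absorbed by \<open>- c \<omega> z \<cdot> P z\<close> and a multiple of
  \<open>- |q|\<^sup>2\<close>. The choice \<open>c = j = 1\<close>, for which \<open>\<Phi>\<close> is \<open>lyapunov\<close> without the component of its dual term in
  the direction of the constant vectors, makes \<open>\<kappa> = 1 + \<beta>\<^sub>1\<close> and allows this only if \<open>\<beta>\<^sub>1\<close> is not large; it is used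
  for \<open>\<beta>\<^sub>1 \<le> 6\<close> (\<open>drift_small_beta\<close>). For \<open>\<beta>\<^sub>1 > 6\<close> the choice \<open>c = 6 / \<beta>\<^sub>1\<close>, \<open>j = 0\<close> keeps \<open>\<kappa> = 6\<close>, and the
  relative decrease \<open>c \<omega> / \<kappa>\<close> of the dual part is still large enough because the claimed rate has the
  factor \<open>1 / (1/2 + \<beta>\<^sub>1)\<close> (\<open>drift_large_beta\<close>).

  Replacing \<open>lyapunov\<close> by \<open>\<Phi>\<close> costs nothing in the constants. With \<open>t = (1 - c / (\<beta>\<^sub>1 \<lambda>)) / 2\<close>, where \<open>\<lambda>\<close> is the
  smallest positive eigenvalue, \<open>\<Phi>\<close> is at least \<open>t\<close> times the quantity to be estimated (\<open>energy_lower\<close>),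
  while initially \<open>\<Phi>\<close> is at most \<open>(t / c\<^sub>1) V\<^sub>0\<close> (\<open>energy_initial\<close>), so that \<open>t\<close> cancels.

  Randomness enters one step only through three squared errors: of the compression, of the compressed
  estimates and of the stochastic gradients. Since all products are split before taking
  expectations, bounds on their second moments given the past suffice, and these follow from Fubini's theorem because
  the current samples and seeds are independent of the current state.
\<close>

section \<open>Inequalities of Young type\<close>

lemma inner_Young:
  fixes x y :: "'a::real_inner"
  assumes "0 < t"
  shows "x \<bullet> y \<le> t * (norm x)\<^sup>2 + (norm y)\<^sup>2 / (4 * t)"
proof -
  have "0 \<le> (norm ((2 * t) *\<^sub>R x - y))\<^sup>2 / (4 * t)" using assms by simp
  also have "(norm ((2 * t) *\<^sub>R x - y))\<^sup>2 = 4 * t\<^sup>2 * (norm x)\<^sup>2 - 4 * t * (x \<bullet> y) + (norm y)\<^sup>2"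
    unfolding power2_norm_eq_inner
    by (simp add: inner_diff_left inner_diff_right inner_commute power2_eq_square algebra_simps)
  finally show ?thesis using assms by (simp add: field_simps power2_eq_square)
qed

lemma inner_Young_minus:
  fixes x y :: "'a::real_inner"
  assumes "0 < t"
  shows "- (x \<bullet> y) \<le> t * (norm x)\<^sup>2 + (norm y)\<^sup>2 / (4 * t)"
  using inner_Young[OF assms, of "- x" y] by simp

lemma norm_sum_sq_le:
  fixes a b :: "'a::real_inner"
  assumes "0 < s"
  shows "(norm (a + b))\<^sup>2 \<le> (1 + s) * (norm a)\<^sup>2 + (1 + 1 / s) * (norm b)\<^sup>2"
proof -
  have "2 * (a \<bullet> b) \<le> s * (norm a)\<^sup>2 + (norm b)\<^sup>2 / s"
    using inner_Young[of "s/2" a b] assms by simp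
  moreover have "(norm (a + b))\<^sup>2 = (norm a)\<^sup>2 + 2 * (a \<bullet> b) + (norm b)\<^sup>2"
    by (simp add: power2_norm_eq_inner inner_add_left inner_add_right inner_commute)
  ultimately show ?thesis by (simp add: algebra_simps)
qed

text \<open>The convexity of the squared norm, with the weights \<open>p, q, r, s\<close> left free: the four parts of the
  primal increment have very different room to be absorbed.\<close>

lemma norm_sum4_sq_le:
  fixes a b c d :: "'a::real_inner"
  assumes "0 < p" "0 < q" "0 < r" "0 < s" "p + q + r + s = 1"
  shows "(norm (a + b + c + d))\<^sup>2 \<le>
    (norm a)\<^sup>2 / p + (norm b)\<^sup>2 / q + (norm c)\<^sup>2 / r + (norm d)\<^sup>2 / s"
proof -
  have two: "(norm (x + y))\<^sup>2 / (m + n) \<le> (norm x)\<^sup>2 / m + (norm y)\<^sup>2 / n" if "0 < m" "0 < n"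
    for m n :: real and x y :: 'a
  proof -
    have "(norm (x + y))\<^sup>2 \<le> (1 + n/m) * (norm x)\<^sup>2 + (1 + 1/(n/m)) * (norm y)\<^sup>2"
      using that by (intro norm_sum_sq_le) simp
    also have "\<dots> = (m + n) * ((norm x)\<^sup>2 / m + (norm y)\<^sup>2 / n)"
      using that by (simp add: field_simps)
    finally show ?thesis using that by (simp add: field_simps)
  qed
  have "(norm (a + b + c + d))\<^sup>2 / (p + q + r + s) \<le> (norm (a + b + c))\<^sup>2 / (p + q + r) + (norm d)\<^sup>2 / s"
    using assms by (intro two) simp_all
  also have "(norm (a + b + c))\<^sup>2 / (p + q + r) \<le> (norm (a + b))\<^sup>2 / (p + q) + (norm c)\<^sup>2 / r"
    using assms by (intro two) simp_all
  also have "(norm (a + b))\<^sup>2 / (p + q) \<le> (norm a)\<^sup>2 / p + (norm b)\<^sup>2 / q"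
    using assms by (intro two) simp_all
  finally show ?thesis using assms by simp
qed

text \<open>Here \<open>q\<close> is the direction that is used and \<open>q - b\<close> the true gradient, so that the first term is the
  first-order decrease of the objective. The second term reserves the part of the true gradient that the
  Polyak-Lojasiewicz inequality needs. Expanding around \<open>q\<close> rather than around the gradient leaves nearly all of
  the decrease in the form \<open>- |q|\<^sup>2\<close>, in which the drift of the gradients is measured.\<close>

lemma descent_with_gradient_error:
  fixes q b :: "'a::real_inner"
  assumes s: "0 < s" and p: "p \<le> 1"
  shows "- ((q - b) \<bullet> q) + p / 2 * (norm (q - b))\<^sup>2 \<le>
    - (1 - p / 2 - (1 - p) * s) * (norm q)\<^sup>2 + ((1 - p) / (4 * s) + p / 2) * (norm b)\<^sup>2"
proof -
  have "q \<bullet> b \<le> s * (norm q)\<^sup>2 + (norm b)\<^sup>2 / (4 * s)" by (rule inner_Young[OF s])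
  then have "(1 - p) * (q \<bullet> b) \<le> (1 - p) * (s * (norm q)\<^sup>2 + (norm b)\<^sup>2 / (4 * s))"
    using p by (intro mult_left_mono) simp_all
  moreover have e2: "(norm (q - b))\<^sup>2 = (norm q)\<^sup>2 - 2 * (q \<bullet> b) + (norm b)\<^sup>2"
    unfolding power2_norm_eq_inner by (simp add: inner_diff_left inner_diff_right inner_commute)
  moreover have e3: "(q - b) \<bullet> q = (norm q)\<^sup>2 - q \<bullet> b"
    unfolding power2_norm_eq_inner by (simp add: inner_diff_left inner_commute[of b q])
  ultimately show ?thesis
    unfolding e2 e3 by (simp add: left_diff_distrib distrib_left add_divide_distrib diff_divide_distrib distrib_right right_diff_distrib)
qed

section \<open>Laplacian operators and the quadratic potential\<close>

text \<open>The algebra of the projection \<open>K\<close> onto the disagreement space, the Laplacian \<open>L\<close> and its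
  pseudo-inverse \<open>P\<close>, with \<open>lo\<close> and \<open>hi\<close> bounding the nonzero spectrum of \<open>L\<close>.\<close>

locale laplacian_operators =
  fixes K L P :: "'a::real_inner \<Rightarrow> 'a" and lo hi :: real
  assumes linear_K: "linear K" and linear_L: "linear L" and linear_P: "linear P"
    and adjoint_K: "K x \<bullet> y = x \<bullet> K y"
    and adjoint_L: "L x \<bullet> y = x \<bullet> L y"
    and adjoint_P: "P x \<bullet> y = x \<bullet> P y"
    and K_K: "K (K x) = K x"
    and K_L: "K (L x) = L x" and L_K: "L (K x) = L x"
    and K_P: "K (P x) = P x"
    and P_L: "P (L x) = K x" and L_P: "L (P x) = K x"
    and lo_pos: "0 < lo" and lo_le_hi: "lo \<le> hi"
    and L_lower: "lo * (norm (K x))\<^sup>2 \<le> x \<bullet> L x"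
    and L_upper: "(norm (L x))\<^sup>2 \<le> hi\<^sup>2 * (norm (K x))\<^sup>2"
    and L_form_upper: "x \<bullet> L x \<le> hi * (norm (K x))\<^sup>2"
    and P_lower: "(norm (K x))\<^sup>2 \<le> hi * (x \<bullet> P x)"
    and P_upper: "lo * (norm (P x))\<^sup>2 \<le> x \<bullet> P x"
begin

definition potential :: "real \<Rightarrow> real \<Rightarrow> 'a \<Rightarrow> 'a \<Rightarrow> real" where
  "potential c \<kappa> x z = 1/2 * (x \<bullet> x) + \<kappa> / 2 * (z \<bullet> P z) + c * (x \<bullet> P z)"

text \<open>The exact change of the potential, sorted by powers of \<open>\<eta>\<close> and with the terms in the gradient drift \<open>d\<close>
  last. The relation \<open>\<kappa> = j + c \<beta>\<close> leaves from \<open>x \<cdot> z\<close> only the multiple \<open>1 - j\<close>, from \<open>z \<cdot> e\<close> only the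
  multiple \<open>j\<close>, and makes the coefficient of the quadratic form of \<open>x + e\<close> in the Laplacian negative once
  \<open>j \<le> c \<beta>\<close>.\<close>

lemma potential_step:
  assumes K: "K x = x" "K z = z" "K e = e" "K h = h" "K d = d"
    and om: "\<omega> \<noteq> 0"
    and a: "a = (\<beta> * \<omega>) *\<^sub>R L (x + e) + \<omega> *\<^sub>R z + h"
    and \<kappa>: "\<kappa> = j + c * \<beta>"
  shows "potential c \<kappa> (x - \<eta> *\<^sub>R a) (z + (\<eta> * \<omega>) *\<^sub>R L (x + e) + (1 / \<omega>) *\<^sub>R d) =
    potential c \<kappa> x z
    + \<eta> * (- (\<beta> * \<omega>) * (x \<bullet> L x) - (\<beta> * \<omega>) * (x \<bullet> L e) - (1 - j) * \<omega> * (x \<bullet> z) + j * \<omega> * (z \<bullet> e)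
        - x \<bullet> h + c * \<omega> * (x \<bullet> x) + c * \<omega> * (x \<bullet> e) - c * \<omega> * (z \<bullet> P z) - c * (h \<bullet> P z))
    + \<eta>\<^sup>2 * (1/2 * (a \<bullet> a) + \<omega>\<^sup>2 * (j - c * \<beta>) / 2 * ((x + e) \<bullet> L (x + e))
        - c * \<omega>\<^sup>2 * (z \<bullet> (x + e)) - c * \<omega> * (h \<bullet> (x + e)))
    + (\<kappa> / \<omega> - c * \<eta>) * (z \<bullet> P d) + j * \<eta> * ((x + e) \<bullet> d) + c / \<omega> * (x \<bullet> P d)
    + \<kappa> / (2 * \<omega>\<^sup>2) * (d \<bullet> P d) - c * \<eta> / \<omega> * (h \<bullet> P d)"
proof -
  define y where "y = x + e"
  define w where "w = L y"
  have Ky: "K y = y" by (simp add: y_def linear_add[OF linear_K] K)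
  define zp where "zp = z + (\<eta> * \<omega>) *\<^sub>R w + (1 / \<omega>) *\<^sub>R d"
  have Pzp: "P zp = P z + (\<eta> * \<omega>) *\<^sub>R y + (1 / \<omega>) *\<^sub>R P d"
    by (simp add: zp_def w_def linear_add[OF linear_P] linear_scale[OF linear_P] P_L Ky)
  have wP: "w \<bullet> P u = y \<bullet> u" if "K u = u" for u
    by (metis L_P adjoint_L that w_def)
  have comm: "P z \<bullet> d = z \<bullet> P d" "d \<bullet> P z = z \<bullet> P d" "P z \<bullet> w = z \<bullet> y" "P d \<bullet> w = y \<bullet> d"
    using wP[OF K(2)] wP[OF K(5)] adjoint_P[of z d] by (simp_all add: inner_commute)
  have a': "a = (\<beta> * \<omega>) *\<^sub>R w + \<omega> *\<^sub>R z + h" by (simp add: a w_def y_def)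
  have xw: "x \<bullet> w = x \<bullet> L x + x \<bullet> L e"
    by (simp add: w_def y_def linear_add[OF linear_L] inner_add_right)
  define r where "r = 1 / \<omega>"
  have wr: "\<omega> * r = 1" "r * \<omega> = 1" "\<And>t. \<omega> * (r * t) = t" "\<And>t. r * (\<omega> * t) = t"
    using om by (simp_all add: r_def)
  have exp1: "zp \<bullet> P zp = z \<bullet> P z + 2 * \<eta> * \<omega> * (z \<bullet> y) + 2 * r * (z \<bullet> P d)
      + (\<eta> * \<omega>)\<^sup>2 * (y \<bullet> w) + 2 * \<eta> * (y \<bullet> d) + r\<^sup>2 * (d \<bullet> P d)"
    unfolding Pzp r_def[symmetric] unfolding zp_def r_def[symmetric]
    using wP[OF K(2)] wP[OF K(5)] comm
    by (simp add: inner_add_left inner_add_right inner_commute[of d y] inner_commute[of w y] power2_eq_square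
        algebra_simps inner_commute[of y z] wr)
  have exp2: "x \<bullet> P zp = x \<bullet> P z + \<eta> * \<omega> * (x \<bullet> y) + r * (x \<bullet> P d)"
    unfolding Pzp r_def by (simp add: inner_add_right)
  have exp3: "a \<bullet> P zp = \<beta> * \<omega> * (z \<bullet> y) + \<omega> * (z \<bullet> P z) + h \<bullet> P z
      + \<eta> * \<omega> * (\<beta> * \<omega> * (y \<bullet> w) + \<omega> * (z \<bullet> y) + h \<bullet> y)
      + \<beta> * (y \<bullet> d) + z \<bullet> P d + r * (h \<bullet> P d)"
    unfolding Pzp a' r_def[symmetric] using wP[OF K(2)] wP[OF K(5)]
    by (simp add: inner_add_left inner_add_right inner_commute[of w y] inner_commute[of y z] algebra_simps wr)
  have xa: "x \<bullet> a = \<beta> * \<omega> * (x \<bullet> L x + x \<bullet> L e) + \<omega> * (x \<bullet> z) + x \<bullet> h"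
    unfolding a' by (simp add: inner_add_right xw)
  have pot: "potential c \<kappa> (x - \<eta> *\<^sub>R a) zp = 1/2 * (x \<bullet> x - 2 * \<eta> * (x \<bullet> a) + \<eta>\<^sup>2 * (a \<bullet> a))
      + \<kappa> / 2 * (zp \<bullet> P zp) + c * (x \<bullet> P zp - \<eta> * (a \<bullet> P zp))"
    unfolding potential_def
    by (simp add: inner_diff_left inner_diff_right inner_commute[of a x] power2_eq_square algebra_simps)
  have yx: "x \<bullet> y = x \<bullet> x + x \<bullet> e" "z \<bullet> y = x \<bullet> z + z \<bullet> e"
    by (simp_all add: y_def inner_add_right inner_commute)
  have div: "t / \<omega> = t * r" "t / (2 * \<omega>\<^sup>2) = t * r\<^sup>2 / 2" for t
    by (simp_all add: r_def power2_eq_square)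
  show ?thesis
    unfolding y_def[symmetric] w_def[symmetric]
    unfolding zp_def[symmetric]
    unfolding pot exp1 exp2 exp3 xa
    unfolding yx div potential_def \<kappa>
    by (simp add: algebra_simps power2_eq_square wr add_divide_distrib diff_divide_distrib)
qed

lemma L_nonneg: "0 \<le> x \<bullet> L x"
  by (rule order_trans[OF _ L_lower]) (use lo_pos in simp)

lemma P_nonneg: "0 \<le> x \<bullet> P x"
  by (rule order_trans[OF _ P_upper]) (use lo_pos in simp)

lemma L_Young_minus:
  assumes "0 < t"
  shows "- (x \<bullet> L y) \<le> t * (x \<bullet> L x) + (y \<bullet> L y) / (4 * t)"
proof -
  have "0 \<le> ((2 * t) *\<^sub>R x + y) \<bullet> L ((2 * t) *\<^sub>R x + y) / (4 * t)"
    using L_nonneg assms by simp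
  also have "((2 * t) *\<^sub>R x + y) \<bullet> L ((2 * t) *\<^sub>R x + y) = 4 * t\<^sup>2 * (x \<bullet> L x) + 4 * t * (x \<bullet> L y) + y \<bullet> L y"
    using adjoint_L[of x y]
    by (simp add: linear_add[OF linear_L] linear_scale[OF linear_L] inner_add_left inner_add_right
        inner_commute[of y] power2_eq_square algebra_simps)
  finally show ?thesis using assms by (simp add: field_simps power2_eq_square)
qed

lemma norm_K_le: "norm (K x) \<le> norm x"
proof -
  have "(norm (K x))\<^sup>2 = x \<bullet> K x" by (simp add: power2_norm_eq_inner adjoint_K K_K)
  also have "\<dots> \<le> norm x * norm (K x)" by (rule norm_cauchy_schwarz)
  finally show ?thesis by (cases "norm (K x) = 0") (auto simp: power2_eq_square)
qed

lemma norm_K_complement: "(norm (K x))\<^sup>2 + (norm (x - K x))\<^sup>2 = (norm x)\<^sup>2"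
  unfolding power2_norm_eq_inner
  using adjoint_K[of x "K x"] by (simp add: K_K inner_diff_left inner_diff_right inner_commute[of x "K x"])

lemma norm_P_le: "lo * norm (P x) \<le> norm x"
proof -
  have "lo * (norm (P x))\<^sup>2 \<le> x \<bullet> P x" by (rule P_upper)
  also have "\<dots> \<le> norm x * norm (P x)" by (rule norm_cauchy_schwarz)
  finally show ?thesis by (cases "norm (P x) = 0") (auto simp: power2_eq_square)
qed

lemma P_K: "P (K x) = P x"
  by (metis K_P L_P P_L)

text \<open>Young's inequality balanced so that, multiplied by \<open>c\<close>, the dual part is exactly what \<open>\<kappa> \<ge> c b\<close> provides.\<close>

lemma inner_P_lower:
  assumes "0 < b"
  shows "- (1 / (2 * b * lo)) * (norm x)\<^sup>2 - b / 2 * (z \<bullet> P z) \<le> x \<bullet> P z"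
proof -
  have "- (x \<bullet> P z) \<le> (1 / (2 * b * lo)) * (norm x)\<^sup>2 + (norm (P z))\<^sup>2 / (4 * (1 / (2 * b * lo)))"
    using assms lo_pos by (intro inner_Young_minus) simp
  also have "(norm (P z))\<^sup>2 / (4 * (1 / (2 * b * lo))) = b / 2 * (lo * (norm (P z))\<^sup>2)"
    using assms lo_pos by simp
  also have "\<dots> \<le> b / 2 * (z \<bullet> P z)" using P_upper assms by (intro mult_left_mono) simp_all
  finally show ?thesis by simp
qed

lemma potential_lower:
  assumes b: "0 < b" and c: "0 \<le> c" "c * b \<le> k"
  shows "1/2 * (1 - c / (b * lo)) * (norm x)\<^sup>2 \<le> potential c k x z"
proof -
  have "c * (- (1 / (2 * b * lo)) * (norm x)\<^sup>2 - b / 2 * (z \<bullet> P z)) \<le> c * (x \<bullet> P z)"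
    by (rule mult_left_mono[OF inner_P_lower[OF b] c(1)])
  moreover have "c * b * (z \<bullet> P z) \<le> k * (z \<bullet> P z)" by (rule mult_right_mono[OF c(2) P_nonneg])
  ultimately show ?thesis
    unfolding potential_def power2_norm_eq_inner by (simp add: algebra_simps diff_divide_distrib)
qed

text \<open>Passing from the coefficients \<open>1\<close> and \<open>1 + b\<close> to \<open>c\<close> and \<open>k\<close> can increase the potential, because the mixed
  term may be negative, but only by a multiple of \<open>|x|\<^sup>2\<close>. The factors on both sides are those of the
  lower bounds of the two potentials, so the increase is compensated exactly.\<close>

lemma potential_compare:
  assumes b: "0 < b" "1 < b * lo" and c: "0 \<le> c" "c \<le> 1" and k: "k + b * (1 - c) \<le> 1 + b"
  shows "(b * lo - 1) * potential c k x z \<le> (b * lo - c) * potential 1 (1 + b) x z"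
proof -
  define \<Phi> where "\<Phi> = potential 1 (1 + b) x z"
  define X where "X = (norm x)\<^sup>2"
  have "(1 - c) * (- (1 / (2 * b * lo)) * X - b / 2 * (z \<bullet> P z)) \<le> (1 - c) * (x \<bullet> P z)"
    unfolding X_def using c by (intro mult_left_mono inner_P_lower[OF b(1)]) simp
  moreover have "(k + b * (1 - c)) * (z \<bullet> P z) \<le> (1 + b) * (z \<bullet> P z)" by (rule mult_right_mono[OF k P_nonneg])
  ultimately have 1: "potential c k x z \<le> \<Phi> + (1 - c) * (X / (2 * b * lo))"
    unfolding potential_def \<Phi>_def by (simp add: algebra_simps add_divide_distrib diff_divide_distrib)
  have "1/2 * (1 - 1 / (b * lo)) * X \<le> \<Phi>"
    unfolding \<Phi>_def X_def using b by (intro potential_lower) simp_all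
  then have "(1 - c) * (1/2 * (1 - 1 / (b * lo)) * X) \<le> (1 - c) * \<Phi>"
    using c by (intro mult_left_mono) simp_all
  moreover have "(1 - c) * (1/2 * (1 - 1 / (b * lo)) * X) = (b * lo - 1) * ((1 - c) * (X / (2 * b * lo)))"
    using b lo_pos by (simp add: field_simps)
  ultimately have 2: "(b * lo - 1) * ((1 - c) * (X / (2 * b * lo))) \<le> (1 - c) * \<Phi>" by (simp only:)
  have "(b * lo - 1) * potential c k x z \<le> (b * lo - 1) * (\<Phi> + (1 - c) * (X / (2 * b * lo)))"
    using 1 b by (intro mult_left_mono) simp_all
  also have "\<dots> \<le> (b * lo - 1) * \<Phi> + (1 - c) * \<Phi>" using 2 by (simp add: distrib_left)
  also have "\<dots> = (b * lo - c) * \<Phi>" by (simp add: algebra_simps)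
  finally show ?thesis by (simp add: \<Phi>_def)
qed

end

section \<open>Consequences of the step-size conditions\<close>

text \<open>The combinations \<open>\<epsilon>\<^sub>1 - \<epsilon>\<^sub>2 \<eta>\<close> (with tildes) and \<open>\<epsilon>\<^sub>4 - \<epsilon>\<^sub>5 \<eta>\<close> of the constants, which bound the rate.\<close>

definition primal_margin :: "real \<Rightarrow> real \<Rightarrow> real \<Rightarrow> real \<Rightarrow> real \<Rightarrow> real \<Rightarrow> real \<Rightarrow> real" where
  "primal_margin lo hi Lf \<phi>2 \<beta> \<omega> \<eta> = \<beta> * \<omega> / 2 * lo - ((9 * \<omega> + 4) / 4 + 5/4 * Lf\<^sup>2)
      - \<eta> * ((12 + 16 / \<phi>2) * Lf\<^sup>2 + (4 + 8 / \<phi>2) * (\<beta> * \<omega>)\<^sup>2 * hi\<^sup>2 + 1 + 2 * \<omega>\<^sup>2 + 3 * (\<beta> * \<omega>)\<^sup>2 * hi\<^sup>2)"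

definition dual_margin :: "real \<Rightarrow> real \<Rightarrow> real \<Rightarrow> real \<Rightarrow> real \<Rightarrow> real" where
  "dual_margin lo hi \<phi>2 \<omega> \<eta> = (3 * \<omega> - 1) / 4 - 3 * (1 / lo)
      - \<eta> * (\<omega>\<^sup>2 * hi + 1 / lo + (4 + 8 / \<phi>2) * \<omega>\<^sup>2 * lo)"

text \<open>What the choice of the parameters provides for the analysis of one step, in terms of a rate \<open>\<tau>\<close>.\<close>

locale admissible_parameters =
  fixes lo hi Lf \<phi>2 \<beta> \<omega> \<eta> \<tau> :: real
  assumes lo_pos: "0 < lo" and lo_le_hi: "lo \<le> hi" and Lf_pos: "0 < Lf"
    and phi2_pos: "0 < \<phi>2" and phi2_less_1: "\<phi>2 < 1" and eta_pos: "0 < \<eta>"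
    and beta_gt_1: "1 < \<beta>" and beta_lo: "9/2 < \<beta> * lo"
    and omega_lo: "4 + lo / 3 < \<omega> * lo"
    and smooth_le: "16 * (1 + \<beta>) * Lf\<^sup>2 \<le> \<omega>\<^sup>2 * lo"
    and margin_ge: "5/4 * Lf\<^sup>2 \<le> primal_margin lo hi Lf \<phi>2 \<beta> \<omega> \<eta>"
    and rate_nonneg: "0 \<le> \<tau>"
    and rate_x: "(1/2 + \<beta>) * \<tau> \<le> primal_margin lo hi Lf \<phi>2 \<beta> \<omega> \<eta>"
    and rate_z: "(1/2 + \<beta>) * \<tau> \<le> dual_margin lo hi \<phi>2 \<omega> \<eta>"
begin

abbreviation margin :: real where
  "margin \<equiv> primal_margin lo hi Lf \<phi>2 \<beta> \<omega> \<eta>"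

text \<open>The squared primal increment enters a step with the coefficient \<open>3/2 + 2/\<phi>2\<close> (\<open>1/2\<close> from the potential,
  \<open>1 + 2/\<phi>2\<close> from the compression error), which is \<open>(T - \<eta>) / (4 \<eta>)\<close>. So \<open>T\<close> plays the role of a step size, and
  the bounds below make it small relative to all other scales.\<close>

definition T :: real where "T = (7 + 8 / \<phi>2) * \<eta>"

text \<open>Coefficients, in the decrease of one step, of the squared error of the compressed estimates and
  of the squared error of the stochastic gradients.\<close>

definition comp_coef :: real where
  "comp_coef = \<beta> * \<omega> * hi / 2 + \<omega> * hi + 2 * \<omega> + \<eta> * ((7 + 8 / \<phi>2) * (\<beta> * \<omega>)\<^sup>2 * hi\<^sup>2 + 1 + 2 * \<omega>\<^sup>2)"

definition noise_coef :: real where "noise_coef = 3 + 13 * \<eta> + 16 * \<eta> / \<phi>2"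

lemma hi_pos: "0 < hi" using lo_pos lo_le_hi by simp

lemma omega_gt: "1/3 < \<omega>"
proof -
  have "lo * (1/3) < lo * \<omega>" using omega_lo by (simp add: mult.commute)
  then show ?thesis using lo_pos mult_less_cancel_left_pos by blast
qed

lemma omega_pos: "0 < \<omega>" using omega_gt by simp
lemma beta_pos: "0 < \<beta>" using beta_gt_1 by simp

lemma comp_coef_nonneg: "0 \<le> comp_coef" unfolding comp_coef_def
  using beta_pos omega_pos hi_pos eta_pos phi2_pos by (intro add_nonneg_nonneg mult_nonneg_nonneg) simp_all

lemma noise_coef_nonneg: "0 \<le> noise_coef" unfolding noise_coef_def using eta_pos phi2_pos by simp

lemma inv_phi2: "1 < 1 / \<phi>2" using phi2_pos phi2_less_1 by simp

lemma T_pos: "0 < T" using phi2_pos eta_pos by (simp add: T_def add_pos_pos)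

lemma eta_le_T: "15 * \<eta> \<le> T"
proof -
  have "\<eta> * 1 \<le> \<eta> * (1 / \<phi>2)" using inv_phi2 eta_pos by (intro mult_left_mono) simp_all
  moreover have "T = 7 * \<eta> + 8 * (\<eta> * (1 / \<phi>2))" by (simp add: T_def algebra_simps)
  ultimately show ?thesis by linarith
qed

text \<open>The contraction of \<open>x\<close> by the Laplacian, split into what is available and what the other terms of a step use.\<close>

lemma gamma_lo_eq: "\<beta> * \<omega> / 2 * lo = margin + 9/4 * \<omega> + 1 + 5/4 * Lf\<^sup>2
   + \<eta> * (12 + 16 / \<phi>2) * Lf\<^sup>2 + T * (\<beta> * \<omega>)\<^sup>2 * hi\<^sup>2 + \<eta> + 2 * \<omega>\<^sup>2 * \<eta>"
  unfolding primal_margin_def T_def by (simp add: algebra_simps add_divide_distrib)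

lemma eta_Lf_nonneg: "0 \<le> \<eta> * (12 + 16 / \<phi>2) * Lf\<^sup>2"
  using eta_pos phi2_pos by simp

lemma gamma_lo_ge:
  shows "T * (\<beta> * \<omega>)\<^sup>2 * hi\<^sup>2 + 9/4 * \<omega> + 1 + 5/2 * Lf\<^sup>2 \<le> \<beta> * \<omega> / 2 * lo"
proof -
  have "0 \<le> 2 * \<omega>\<^sup>2 * \<eta>" using eta_pos by simp
  then show ?thesis using gamma_lo_eq margin_ge eta_Lf_nonneg eta_pos by linarith
qed

lemma T_hi2: "T * (\<beta> * \<omega>) * hi\<^sup>2 \<le> lo / 2"
proof -
  have "(\<beta> * \<omega>) * (T * (\<beta> * \<omega>) * hi\<^sup>2) \<le> (\<beta> * \<omega>) * (lo / 2)"
  proof -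
    have "T * (\<beta> * \<omega>)\<^sup>2 * hi\<^sup>2 \<le> \<beta> * \<omega> / 2 * lo"
      using gamma_lo_ge omega_pos zero_le_power2[of Lf] by linarith
    then show ?thesis by (simp add: power2_eq_square algebra_simps)
  qed
  then show ?thesis using beta_pos omega_pos by (subst (asm) mult_le_cancel_left_pos) simp_all
qed

lemma T_hi: "T * (\<beta> * \<omega>) * hi \<le> 1/2"
proof -
  have "hi * (T * (\<beta> * \<omega>) * hi) \<le> hi * (1/2)"
    using T_hi2 lo_le_hi by (simp add: power2_eq_square algebra_simps)
  then show ?thesis using hi_pos by (subst (asm) mult_le_cancel_left_pos) simp_all
qed

lemma T_lo: "T * (\<beta> * \<omega>) * lo \<le> 1/2"
proof -
  have "T * (\<beta> * \<omega>) * lo \<le> T * (\<beta> * \<omega>) * hi"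
    using lo_le_hi T_pos beta_pos omega_pos by (intro mult_left_mono) simp_all
  then show ?thesis using T_hi by simp
qed

lemma omega_lo_4: "4 \<le> \<omega> * lo" using omega_lo lo_pos by simp

lemma T_beta: "T * \<beta> \<le> 1/8"
proof -
  have "(T * \<beta>) * 4 \<le> (T * \<beta>) * (\<omega> * lo)"
    using T_pos beta_pos omega_lo_4 by (intro mult_left_mono) simp_all
  then show ?thesis using T_lo by (simp add: algebra_simps)
qed

lemma T_le: "T \<le> 1/8"
proof -
  have "T * 1 \<le> T * \<beta>" using T_pos beta_gt_1 by (intro mult_left_mono) simp_all
  then show ?thesis using T_beta by simp
qed

lemma eta_le: "\<eta> \<le> 1/120" using eta_le_T T_le by simp

lemma eta_gamma_hi: "\<eta> * (\<beta> * \<omega>) * hi \<le> 1/30"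
proof -
  have "(15 * \<eta>) * ((\<beta> * \<omega>) * hi) \<le> T * ((\<beta> * \<omega>) * hi)"
    using eta_le_T beta_pos omega_pos hi_pos by (intro mult_right_mono) simp_all
  then show ?thesis using T_hi by (simp add: algebra_simps)
qed

lemma eta_omega_hi: "\<eta> * \<omega> * hi \<le> 1/30"
proof -
  have "(\<eta> * \<omega> * hi) * 1 \<le> (\<eta> * \<omega> * hi) * \<beta>"
    using beta_gt_1 omega_pos hi_pos eta_pos by (intro mult_left_mono) simp_all
  then show ?thesis using eta_gamma_hi by (simp add: algebra_simps)
qed

lemma eta_omega: "\<eta> * \<omega> \<le> 1/135"
proof -
  have "9/2 \<le> \<beta> * hi" using beta_lo mult_left_mono[OF lo_le_hi, of \<beta>] beta_pos by linarith
  then have "(\<eta> * \<omega>) * (9/2) \<le> (\<eta> * \<omega>) * (\<beta> * hi)"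
    using omega_pos eta_pos by (intro mult_left_mono) simp_all
  then show ?thesis using eta_gamma_hi by (simp add: algebra_simps)
qed

lemma eta_Lf: "\<eta> * Lf \<le> 1/180"
proof -
  \<comment> \<open>\<open>6 Lf \<le> 2 + 5 Lf\<^sup>2\<close>, and the right-hand side is at most \<open>\<beta> \<omega> lo\<close> by \<open>gamma_lo_ge\<close>.\<close>
  have "0 \<le> (5 * Lf - 3)\<^sup>2" by simp
  then have "30 * Lf \<le> 25 * Lf\<^sup>2 + 9" by (simp add: power2_eq_square algebra_simps)
  moreover have "0 \<le> T * (\<beta> * \<omega>)\<^sup>2 * hi\<^sup>2" using T_pos by simp
  ultimately have "6 * Lf \<le> \<beta> * \<omega> * lo" using gamma_lo_ge omega_pos by simp
  also have "\<dots> \<le> \<beta> * \<omega> * hi" using lo_le_hi beta_pos omega_pos by (intro mult_left_mono) simp_all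
  finally have "\<eta> * (6 * Lf) \<le> \<eta> * (\<beta> * \<omega> * hi)" using eta_pos by (intro mult_left_mono) simp_all
  then show ?thesis using eta_gamma_hi by (simp add: algebra_simps)
qed

lemma eta_omega2_hi: "(\<eta> * \<omega>)\<^sup>2 * hi \<le> 1/3600"
proof -
  have "(\<eta> * \<omega>) * (\<eta> * \<omega> * hi) \<le> (1/135) * (1/30)"
    using eta_omega eta_omega_hi eta_pos omega_pos hi_pos by (intro mult_mono) simp_all
  then show ?thesis by (simp add: power2_eq_square algebra_simps)
qed

lemma eta2_omega: "\<eta>\<^sup>2 * \<omega> \<le> 1/16200"
proof -
  have "\<eta> * (\<eta> * \<omega>) \<le> (1/120) * (1/135)"
    using eta_omega eta_le eta_pos omega_pos by (intro mult_mono) simp_all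
  then show ?thesis by (simp add: power2_eq_square algebra_simps)
qed

lemma inv_lo_le: "1 / lo \<le> \<omega> / 4"
  using omega_lo_4 lo_pos by (simp add: field_simps)

lemma Lf_lo: "Lf\<^sup>2 / (\<omega>\<^sup>2 * lo) \<le> 1 / (16 * (1 + \<beta>))"
  using smooth_le omega_pos lo_pos beta_pos by (simp add: field_simps)

lemma Lf_lo2: "Lf\<^sup>2 / (\<omega>\<^sup>2 * lo\<^sup>2) \<le> \<omega> / (64 * (1 + \<beta>))"
proof -
  have "Lf\<^sup>2 / (\<omega>\<^sup>2 * lo) * (1 / lo) \<le> 1 / (16 * (1 + \<beta>)) * (\<omega> / 4)"
    using Lf_lo inv_lo_le lo_pos beta_pos by (intro mult_mono) simp_all
  then show ?thesis by (simp add: power2_eq_square algebra_simps)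
qed

lemma rate_omega: "(1/2 + \<beta>) * \<tau> \<le> 3/4 * (\<omega> - 1/3)"
proof -
  have aux: "r \<le> u" if "r \<le> u - v - w" "0 \<le> v" "0 \<le> w" for r u v w :: real
    using that by linarith
  have "0 \<le> \<eta> * (\<omega>\<^sup>2 * hi + 1 / lo + (4 + 8 / \<phi>2) * \<omega>\<^sup>2 * lo)"
    using eta_pos hi_pos lo_pos phi2_pos by (intro mult_nonneg_nonneg add_nonneg_nonneg) simp_all
  moreover have "0 \<le> 3 * (1 / lo)" using lo_pos by simp
  ultimately have "(1/2 + \<beta>) * \<tau> \<le> (3 * \<omega> - 1) / 4"
    using aux[OF rate_z[unfolded dual_margin_def]] by blast
  then show ?thesis by (simp add: field_simps)
qed

text \<open>The total weight of \<open>z \<cdot> P z\<close> for \<open>\<beta> \<le> 6\<close>: splitting of products, second-order term, required decrease and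
  gradient drift. The required decrease itself contains a negative second-order term; as \<open>lo \<ge> 2 \<beta> hi w\<close>, it grows like
  \<open>w\<^sup>2\<close> in \<open>w = T \<omega> hi\<close> and beats the linear term \<open>3/4 w\<close> up to a constant. What remains is affine in \<open>1/\<omega>\<close>, hence
  needs to be checked only in the limits \<open>1/\<omega> = 0\<close> and \<open>1/\<omega> = 3\<close>.\<close>

lemma z_budget_small_beta:
  assumes "\<beta> \<le> 6"
  shows "(1/4 + 3/64 + 1/60) * \<omega> + 3/4 * (T * \<omega>\<^sup>2 * hi) + \<tau> * ((1 + \<beta> + 1/9) / 2) + (1 + \<beta>) / (64 * (27/50)) \<le> \<omega>"
proof -
  define \<theta> where "\<theta> = (10/9 + \<beta>) / (1 + 2 * \<beta>)"
  define w where "w = T * \<omega> * hi"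
  have chi: "1/2 \<le> \<theta>" "\<theta> \<le> 19/27" using beta_gt_1 by (simp_all add: \<theta>_def field_simps)
  have chib: "7/10 \<le> \<theta> * \<beta>"
  proof -
    have "0 \<le> (\<beta> - 1) * (27 * \<beta> + 19)" using beta_gt_1 by (intro mult_nonneg_nonneg) simp_all
    then have "19/27 * (1 + 2 * \<beta>) \<le> (10/9 + \<beta>) * \<beta>" by (simp add: algebra_simps)
    then have "19/27 \<le> \<theta> * \<beta>" using beta_gt_1 by (simp add: \<theta>_def field_simps)
    then show ?thesis by simp
  qed
  have w0: "0 \<le> w" using T_pos omega_pos hi_pos by (simp add: w_def)
  have w_lo: "2 * \<beta> * hi * w \<le> lo" using T_hi2 by (simp add: w_def power2_eq_square algebra_simps)
  have tau: "\<tau> * ((1 + \<beta> + 1/9) / 2) \<le> \<theta> * (3/4 * (\<omega> - 1/3) - 8/5 * \<beta> * \<omega> * w\<^sup>2)"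
  proof -
    have "4/5 * T \<le> \<eta> * (4 + 8 / \<phi>2)"
    proof -
      have "\<eta> * 1 \<le> \<eta> * (1 / \<phi>2)" using inv_phi2 eta_pos by (intro mult_left_mono) simp_all
      then show ?thesis by (simp add: T_def algebra_simps)
    qed
    then have "(4/5 * T) * (\<omega>\<^sup>2 * (2 * \<beta> * hi * w)) \<le> (\<eta> * (4 + 8 / \<phi>2)) * (\<omega>\<^sup>2 * lo)"
    proof (rule mult_mono)
      show "\<omega>\<^sup>2 * (2 * \<beta> * hi * w) \<le> \<omega>\<^sup>2 * lo" using w_lo by (intro mult_left_mono) simp_all
    qed (use T_pos w0 hi_pos beta_pos eta_pos phi2_pos in simp_all)
    then have 1: "8/5 * \<beta> * \<omega> * w\<^sup>2 \<le> \<eta> * ((4 + 8 / \<phi>2) * \<omega>\<^sup>2 * lo)"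
      by (simp add: w_def power2_eq_square algebra_simps)
    have 2: "0 \<le> \<eta> * (\<omega>\<^sup>2 * hi + 1 / lo)" "0 \<le> 3 * (1 / lo)"
      using eta_pos hi_pos lo_pos by simp_all
    have split: "\<eta> * (\<omega>\<^sup>2 * hi + 1 / lo + (4 + 8 / \<phi>2) * \<omega>\<^sup>2 * lo)
       = \<eta> * (\<omega>\<^sup>2 * hi + 1 / lo) + \<eta> * ((4 + 8 / \<phi>2) * \<omega>\<^sup>2 * lo)" by (rule distrib_left)
    have aux: "u \<le> 3/4 * (\<omega> - 1/3) - v" if "u \<le> (3 * \<omega> - 1) / 4 - A - (B + C)" "v \<le> C" "0 \<le> A" "0 \<le> B"
      for u v A B C :: real using that by (simp add: field_simps)
    have 3: "(1/2 + \<beta>) * \<tau> \<le> 3/4 * (\<omega> - 1/3) - 8/5 * \<beta> * \<omega> * w\<^sup>2"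
      using aux[OF rate_z[unfolded dual_margin_def split] 1 2(2) 2(1)] .
    have "\<tau> * ((1 + \<beta> + 1/9) / 2) = \<theta> * ((1/2 + \<beta>) * \<tau>)"
      using beta_pos by (simp add: \<theta>_def field_simps)
    also have "\<dots> \<le> \<theta> * (3/4 * (\<omega> - 1/3) - 8/5 * \<beta> * \<omega> * w\<^sup>2)"
      using 3 chi by (intro mult_left_mono) simp_all
    finally show ?thesis .
  qed
  \<comment> \<open>The maximum of a quadratic polynomial in \<open>w\<close>, found by completing the square.\<close>
  define u where "u = 3/4 * w - 8/5 * (\<theta> * \<beta>) * w\<^sup>2"
  have u: "\<theta> * \<beta> * u \<le> 9/102"
  proof -
    have "0 \<le> (3/4 - 16/5 * (\<theta> * \<beta> * w))\<^sup>2" by simp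
    then show ?thesis by (simp add: u_def power2_eq_square algebra_simps)
  qed
  have u1: "u \<le> 13/100"
  proof (rule ccontr)
    assume "\<not> u \<le> 13/100"
    then have "7/10 * (13/100) \<le> \<theta> * \<beta> * u" using chib by (intro mult_mono) simp_all
    then show False using u by simp
  qed
  have u2: "u * \<beta> \<le> 18/100"
  proof (rule ccontr)
    assume *: "\<not> u * \<beta> \<le> 18/100"
    then have "1/2 * (18/100) \<le> \<theta> * (u * \<beta>)" using chi by (intro mult_mono) simp_all
    then show False using u by (simp add: algebra_simps)
  qed
  have main: "(1/4 + 3/64 + 1/60 + 3/4 * \<theta> + u) * \<omega> + ((1 + \<beta>) / (64 * (27/50)) - \<theta> / 4) \<le> \<omega>"
  proof -
    have end0: "1/4 + 3/64 + 1/60 + 3/4 * \<theta> + u \<le> 1" using u1 chi by simp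
    have end3: "1/4 + 3/64 + 1/60 + u + 3 * ((1 + \<beta>) / (64 * (27/50))) \<le> 1"
    proof -
      have "0 \<le> (\<beta> - 1) * (6 - \<beta>)" using beta_gt_1 assms by (intro mult_nonneg_nonneg) simp_all
      then have "\<beta>\<^sup>2 \<le> 7 * \<beta> - 6" by (simp add: power2_eq_square algebra_simps)
      then have "\<beta> * (1/4 + 3/64 + 1/60 + u + 3 * ((1 + \<beta>) / (64 * (27/50)))) \<le> \<beta> * 1"
        using u2 assms by (simp add: power2_eq_square algebra_simps add_divide_distrib)
      then show ?thesis using beta_pos by (subst (asm) mult_le_cancel_left_pos) simp_all
    qed
    define v where "v = 1/4 + 3/64 + 1/60 + 3/4 * \<theta> + u"
    define y where "y = (1 + \<beta>) / (64 * (27/50)) - \<theta> / 4"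
    have "v \<le> 1" "v + 3 * y \<le> 1" using end0 end3 by (simp_all add: v_def y_def)
    then have "y \<le> (1 - v) * (1/3)" "0 \<le> 1 - v" by simp_all
    moreover have "(1 - v) * (1/3) \<le> (1 - v) * \<omega>"
      using \<open>v \<le> 1\<close> omega_gt by (intro mult_left_mono) simp_all
    ultimately have "v * \<omega> + y \<le> \<omega>" by (simp add: algebra_simps diff_divide_distrib)
    then show ?thesis by (simp add: v_def y_def)
  qed
  have "T * \<omega>\<^sup>2 * hi = \<omega> * w" by (simp add: w_def power2_eq_square)
  then show ?thesis using tau main by (simp add: u_def algebra_simps add_divide_distrib)
qed

end

section \<open>Change of the potential in one step\<close>

text \<open>The data of one step: consensus error \<open>x\<close>, dual error \<open>z\<close>, error \<open>e\<close> of the compressed estimates, noise \<open>n\<close> of the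
  stochastic gradients, deviation \<open>l\<close> of the local gradients from the gradients at the mean, drift \<open>d\<close> of the latter,
  and \<open>q\<close> the stacked copies of the mean stochastic gradient.\<close>

locale one_step = laplacian_operators K L P lo hi + admissible_parameters lo hi Lf \<phi>2 \<beta> \<omega> \<eta> \<tau>
  for K L P :: "'a::real_inner \<Rightarrow> 'a" and lo hi Lf \<phi>2 \<beta> \<omega> \<eta> \<tau> :: real +
  fixes c j \<kappa> :: real and x z e n l d q :: 'a
  assumes c_pos: "0 < c" and c_le_1: "c \<le> 1" and j_nonneg: "0 \<le> j" and j_le_1: "j \<le> 1"
    and j_le: "j \<le> c * \<beta>" and kappa: "\<kappa> = j + c * \<beta>" and kappa_le: "\<kappa> \<le> 1 + \<beta>"
    and K_x: "K x = x" and K_z: "K z = z" and K_e: "K e = e" and K_d: "K d = d"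
    and norm_l: "(norm l)\<^sup>2 \<le> Lf\<^sup>2 * (norm x)\<^sup>2"
    and norm_d: "norm d \<le> \<eta> * Lf * norm q"
begin

text \<open>\<open>h\<close> and \<open>b\<close> are the disagreement part and the mean part of the same gradient error \<open>n + l\<close>; the primal
  increments are \<open>- \<eta> a\<close> in the disagreement space and \<open>- \<eta> q\<close> in its complement.\<close>

abbreviation h where "h \<equiv> K n + K l"
abbreviation b where "b \<equiv> (n - K n) + (l - K l)"
abbreviation a where "a \<equiv> (\<beta> * \<omega>) *\<^sub>R L (x + e) + \<omega> *\<^sub>R z + h"
abbreviation "X \<equiv> (norm x)\<^sup>2"
abbreviation "Z \<equiv> z \<bullet> P z"
abbreviation "E \<equiv> (norm e)\<^sup>2"
abbreviation "G \<equiv> (norm q)\<^sup>2"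
abbreviation "N \<equiv> (norm (K n))\<^sup>2"
abbreviation "N' \<equiv> (norm (n - K n))\<^sup>2"

lemma kappa_pos: "0 < \<kappa>" using kappa j_nonneg c_pos beta_pos by (simp add: add_nonneg_pos)

lemma Z_nonneg: "0 \<le> Z" by (rule P_nonneg)

lemma norm_z: "(norm z)\<^sup>2 \<le> hi * Z"
  using P_lower[of z] by (simp add: K_z)

lemma norm_Pz: "(norm (P z))\<^sup>2 \<le> Z / lo"
  using P_upper[of z] lo_pos by (simp add: field_simps)

lemma norm_Pz_omega: "(norm (P z))\<^sup>2 \<le> \<omega> * Z / 4"
proof -
  have "Z * (1 / lo) \<le> Z * (\<omega> / 4)" using inv_lo_le Z_nonneg by (intro mult_left_mono) simp_all
  then have "Z / lo \<le> \<omega> * Z / 4" by (simp add: mult.commute)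
  then show ?thesis using norm_Pz by linarith
qed

lemma norm_Kl: "(norm (K l))\<^sup>2 \<le> Lf\<^sup>2 * X"
  by (rule order_trans[OF power_mono[OF norm_K_le norm_ge_zero] norm_l])

lemma norm_l': "(norm (l - K l))\<^sup>2 \<le> Lf\<^sup>2 * X"
  using norm_l norm_K_complement[of l] zero_le_power2[of "norm (K l)"] by linarith

lemma norm_Kl1: "norm (K l) \<le> Lf * norm x"
proof (rule power2_le_imp_le)
  show "(norm (K l))\<^sup>2 \<le> (Lf * norm x)\<^sup>2" using norm_Kl by (simp add: power_mult_distrib)
  show "0 \<le> Lf * norm x" using Lf_pos by simp
qed

lemma norm_h: "(norm h)\<^sup>2 \<le> 2 * N + 2 * (Lf\<^sup>2 * X)"
proof -
  have "(norm h)\<^sup>2 \<le> 2 * N + 2 * (norm (K l))\<^sup>2"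
    using norm_sum_sq_le[OF zero_less_one, of "K n" "K l"] by simp
  then show ?thesis using norm_Kl by linarith
qed

lemma norm_b:
  assumes "0 < s"
  shows "(norm b)\<^sup>2 \<le> (1 + s) * N' + (1 + 1 / s) * (Lf\<^sup>2 * X)"
proof -
  have "(1 + 1 / s) * (norm (l - K l))\<^sup>2 \<le> (1 + 1 / s) * (Lf\<^sup>2 * X)"
    using norm_l' assms by (intro mult_left_mono) simp_all
  then show ?thesis using norm_sum_sq_le[OF assms, of "n - K n" "l - K l"] by linarith
qed

lemma norm_d2: "(norm d)\<^sup>2 \<le> \<eta>\<^sup>2 * Lf\<^sup>2 * G"
proof -
  have "(norm d)\<^sup>2 \<le> (\<eta> * Lf * norm q)\<^sup>2" using norm_d by (intro power_mono) simp_all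
  then show ?thesis by (simp add: power_mult_distrib)
qed

lemma term_Le: "- (x \<bullet> L e) \<le> 1/2 * (x \<bullet> L x) + hi / 2 * E"
proof -
  have "e \<bullet> L e \<le> hi * E" using L_form_upper[of e] by (simp add: K_e)
  then show ?thesis using L_Young_minus[of "1/2" x e] by linarith
qed

lemma term_ze: "z \<bullet> e \<le> 1/4 * Z + hi * E"
proof -
  have "z \<bullet> e \<le> (1 / (4 * hi)) * (norm z)\<^sup>2 + (norm e)\<^sup>2 / (4 * (1 / (4 * hi)))"
    using hi_pos by (intro inner_Young) simp
  moreover have "(1 / (4 * hi)) * (norm z)\<^sup>2 \<le> (1 / (4 * hi)) * (hi * Z)"
    using norm_z hi_pos by (intro mult_left_mono) simp_all
  moreover have "(1 / (4 * hi)) * (hi * Z) = 1/4 * Z" "(norm e)\<^sup>2 / (4 * (1 / (4 * hi))) = hi * E"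
    using hi_pos by simp_all
  ultimately show ?thesis by linarith
qed

text \<open>Since \<open>z = L (P z)\<close>, the product is an inner product in the form of \<open>L\<close> and can be paid with the full
  contraction of \<open>x\<close>, however large \<open>hi / lo\<close> is.\<close>

lemma term_xz: "- (x \<bullet> z) \<le> \<beta> / 8 * (x \<bullet> L x) + 2 / \<beta> * Z"
proof -
  have *: "P z \<bullet> z = Z" by (simp add: inner_commute)
  show ?thesis
    using L_Young_minus[of "\<beta> / 8" x "P z"] beta_pos by (simp add: L_P K_z *)
qed

lemma term_xh: "- (x \<bullet> h) \<le> 1/2 * X + 1/2 * N + Lf * X"
proof -
  have "- (x \<bullet> K l) \<le> norm x * norm (K l)"
    using norm_cauchy_schwarz[of "- x" "K l"] by simp
  also have "\<dots> \<le> norm x * (Lf * norm x)" using norm_Kl1 by (intro mult_left_mono) simp_all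
  finally have "- (x \<bullet> K l) \<le> Lf * X" by (simp add: power2_eq_square algebra_simps)
  then show ?thesis using inner_Young_minus[of "1/2" x "K n"] by (simp add: inner_add_right)
qed

lemma term_hz: "- (h \<bullet> P z) \<le> 2 * N + 3/64 * (\<omega> * Z) + \<omega> * X / (1 + \<beta>)"
proof -
  have 1: "- (K n \<bullet> P z) \<le> 2 * N + \<omega> * Z / 32"
    using inner_Young_minus[of 2 "K n" "P z"] norm_Pz_omega by simp
  define t where "t = 16 / (\<omega> * lo)"
  have t: "0 < t" using omega_pos lo_pos by (simp add: t_def)
  have "t * (norm (K l))\<^sup>2 \<le> t * (Lf\<^sup>2 * X)" using norm_Kl t by (intro mult_left_mono) simp_all
  also have "\<dots> = 16 * \<omega> * (Lf\<^sup>2 / (\<omega>\<^sup>2 * lo)) * X" using omega_pos lo_pos by (simp add: t_def power2_eq_square field_simps)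
  also have "\<dots> \<le> 16 * \<omega> * (1 / (16 * (1 + \<beta>))) * X"
    using Lf_lo omega_pos by (intro mult_right_mono mult_left_mono) simp_all
  finally have 2: "t * (norm (K l))\<^sup>2 \<le> \<omega> * X / (1 + \<beta>)" using beta_pos by (simp add: field_simps)
  have "(norm (P z))\<^sup>2 / (4 * t) \<le> (Z / lo) / (4 * t)"
    using norm_Pz t by (intro divide_right_mono) simp_all
  also have "\<dots> = \<omega> * Z / 64" using omega_pos lo_pos by (simp add: t_def field_simps)
  finally have "- (K l \<bullet> P z) \<le> \<omega> * X / (1 + \<beta>) + \<omega> * Z / 64"
    using 2 inner_Young_minus[OF t, of "K l" "P z"] by linarith
  then show ?thesis using 1 by (simp add: inner_add_left)
qed

lemma term_zy: "- (\<eta> * \<omega> * (z \<bullet> (x + e))) \<le> 1/60 * Z + 1/120 * X + 1/120 * E"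
proof -
  have "(norm ((\<eta> * \<omega>) *\<^sub>R z))\<^sup>2 = (\<eta> * \<omega>)\<^sup>2 * (norm z)\<^sup>2" by (simp add: power_mult_distrib)
  also have "\<dots> \<le> (\<eta> * \<omega>)\<^sup>2 * (hi * Z)" using norm_z by (intro mult_left_mono) simp_all
  also have "\<dots> = ((\<eta> * \<omega>)\<^sup>2 * hi) * Z" by simp
  also have "\<dots> \<le> (1/3600) * Z" using eta_omega2_hi Z_nonneg by (intro mult_right_mono) simp_all
  finally have *: "30 * (norm ((\<eta> * \<omega>) *\<^sub>R z))\<^sup>2 \<le> 1/120 * Z" by simp
  show ?thesis
    using * inner_Young_minus[of 30 "(\<eta> * \<omega>) *\<^sub>R z" x] inner_Young_minus[of 30 "(\<eta> * \<omega>) *\<^sub>R z" e]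
    by (simp add: inner_add_right algebra_simps)
qed

lemma term_hy: "- (\<eta> * \<omega> * (h \<bullet> (x + e))) \<le> 1/135 * ((norm h)\<^sup>2 + 1/2 * X + 1/2 * E)"
proof -
  have "- (h \<bullet> (x + e)) \<le> (norm h)\<^sup>2 + 1/2 * X + 1/2 * E"
    using inner_Young_minus[of "1/2" h x] inner_Young_minus[of "1/2" h e]
    by (simp add: inner_add_right)
  then have "(\<eta> * \<omega>) * (- (h \<bullet> (x + e))) \<le> (\<eta> * \<omega>) * ((norm h)\<^sup>2 + 1/2 * X + 1/2 * E)"
    using eta_pos omega_pos by (intro mult_left_mono) simp_all
  also have "\<dots> \<le> 1/135 * ((norm h)\<^sup>2 + 1/2 * X + 1/2 * E)"
    using eta_omega by (intro mult_right_mono) simp_all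
  finally show ?thesis by simp
qed

text \<open>The term that limits the size of \<open>\<kappa>\<close>. The weight \<open>s\<close> makes the price in \<open>|q|\<^sup>2\<close> equal to \<open>g\<close>; the remaining one is small
  because \<open>\<omega>\<^sup>2 lo\<close> dominates \<open>(1 + \<beta>) Lf\<^sup>2\<close>.\<close>

lemma term_zd:
  assumes g: "0 < g"
  shows "(\<kappa> / \<omega> - c * \<eta>) * (z \<bullet> P d) \<le> \<eta> * (g * G + \<kappa>\<^sup>2 / (64 * g * (1 + \<beta>)) * Z)"
proof -
  have "(c * \<eta>) * \<omega> \<le> c * (1/135)" using mult_left_mono[OF eta_omega, of c] c_pos by (simp add: algebra_simps)
  also have "\<dots> \<le> c * \<beta>" using c_pos beta_gt_1 by (intro mult_left_mono) simp_all
  also have "\<dots> \<le> \<kappa>" using kappa j_nonneg by simp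
  finally have coef: "0 \<le> \<kappa> / \<omega> - c * \<eta>" using omega_pos by (simp add: field_simps)
  define s where "s = \<kappa> * \<eta> * Lf\<^sup>2 / (4 * g * \<omega>)"
  have s: "0 < s" using kappa_pos eta_pos Lf_pos g omega_pos by (simp add: s_def)
  have "z \<bullet> P d = P z \<bullet> d" by (simp add: adjoint_P)
  also have "\<dots> \<le> s * (norm (P z))\<^sup>2 + (norm d)\<^sup>2 / (4 * s)" by (rule inner_Young[OF s])
  also have "\<dots> \<le> s * (Z / lo) + \<eta>\<^sup>2 * Lf\<^sup>2 * G / (4 * s)"
    using norm_Pz norm_d2 s by (intro add_mono mult_left_mono divide_right_mono) simp_all
  finally have zd: "z \<bullet> P d \<le> s * (Z / lo) + \<eta>\<^sup>2 * Lf\<^sup>2 * G / (4 * s)" (is "_ \<le> ?B") .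
  have B0: "0 \<le> ?B" using s Z_nonneg lo_pos by simp
  have "(\<kappa> / \<omega> - c * \<eta>) * (z \<bullet> P d) \<le> (\<kappa> / \<omega> - c * \<eta>) * ?B"
    using zd coef by (intro mult_left_mono)
  also have "\<dots> \<le> (\<kappa> / \<omega>) * ?B"
    using B0 c_pos eta_pos by (intro mult_right_mono) simp_all
  also have "\<dots> = \<eta> * (\<kappa>\<^sup>2 / (4 * g) * (Lf\<^sup>2 / (\<omega>\<^sup>2 * lo)) * Z + g * G)"
    using kappa_pos eta_pos Lf_pos g omega_pos lo_pos by (simp add: s_def field_simps power2_eq_square)
  also have "\<dots> \<le> \<eta> * (\<kappa>\<^sup>2 / (4 * g) * (1 / (16 * (1 + \<beta>))) * Z + g * G)"
    using Lf_lo g eta_pos Z_nonneg by (intro mult_left_mono add_right_mono mult_right_mono) simp_all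
  finally show ?thesis by (simp add: algebra_simps)
qed

lemma term_yd: "j * \<eta> * ((x + e) \<bullet> d) \<le> \<eta> * (1/180 * G + 1/360 * X + 1/360 * E)"
proof -
  have "norm d \<le> 1/180 * norm q"
    using norm_d mult_right_mono[OF eta_Lf norm_ge_zero[of q]] by simp
  then have d: "(norm d)\<^sup>2 \<le> 1/32400 * G"
    using power_mono[of "norm d" "1/180 * norm q" 2] by (simp add: power_mult_distrib power2_eq_square)
  have *: "u \<bullet> d \<le> 1/360 * (norm u)\<^sup>2 + 1/360 * G" for u
    using inner_Young[of "1/360" u d] d by simp
  have "(j * \<eta>) * ((x + e) \<bullet> d) \<le> (j * \<eta>) * (1/180 * G + 1/360 * X + 1/360 * E)"
    using *[of x] *[of e] j_nonneg eta_pos by (intro mult_left_mono) (simp_all add: inner_add_left)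
  also have "\<dots> \<le> (1 * \<eta>) * (1/180 * G + 1/360 * X + 1/360 * E)"
    using j_le_1 eta_pos by (intro mult_right_mono) simp_all
  finally show ?thesis by simp
qed

lemma norm_Pd2: "(norm (P d))\<^sup>2 \<le> \<eta>\<^sup>2 * (Lf\<^sup>2 / lo\<^sup>2) * G"
proof -
  have "lo\<^sup>2 * (norm (P d))\<^sup>2 \<le> (norm d)\<^sup>2"
    using power_mono[OF norm_P_le[of d], of 2] lo_pos by (simp add: power_mult_distrib)
  then have "lo\<^sup>2 * (norm (P d))\<^sup>2 \<le> \<eta>\<^sup>2 * Lf\<^sup>2 * G" using norm_d2 by simp
  then show ?thesis using lo_pos by (simp add: field_simps)
qed

lemma norm_Pd2_omega: "(norm (P d))\<^sup>2 / \<omega>\<^sup>2 \<le> \<eta>\<^sup>2 * (\<omega> / (64 * (1 + \<beta>))) * G"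
proof -
  have "(norm (P d))\<^sup>2 / \<omega>\<^sup>2 \<le> \<eta>\<^sup>2 * (Lf\<^sup>2 / lo\<^sup>2) * G / \<omega>\<^sup>2"
    using norm_Pd2 by (intro divide_right_mono) simp_all
  also have "\<dots> = \<eta>\<^sup>2 * (Lf\<^sup>2 / (\<omega>\<^sup>2 * lo\<^sup>2)) * G" using omega_pos lo_pos by (simp add: field_simps)
  also have "\<dots> \<le> \<eta>\<^sup>2 * (\<omega> / (64 * (1 + \<beta>))) * G"
    using Lf_lo2 by (intro mult_left_mono mult_right_mono) simp_all
  finally show ?thesis .
qed

lemma term_xd:
  assumes t: "0 < t"
  shows "c / \<omega> * (x \<bullet> P d) \<le> \<eta> * (t * (\<omega> * X) + 1 / (256 * t * (1 + \<beta>)) * G)"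
proof -
  have "(1 / \<omega>) * (x \<bullet> P d) = x \<bullet> ((1 / \<omega>) *\<^sub>R P d)" by simp
  also have "\<dots> \<le> (\<eta> * t * \<omega>) * X + (norm ((1 / \<omega>) *\<^sub>R P d))\<^sup>2 / (4 * (\<eta> * t * \<omega>))"
    using t eta_pos omega_pos by (intro inner_Young) simp
  also have "(norm ((1 / \<omega>) *\<^sub>R P d))\<^sup>2 = (norm (P d))\<^sup>2 / \<omega>\<^sup>2"
    by (simp add: power_divide power_mult_distrib)
  also have "(norm (P d))\<^sup>2 / \<omega>\<^sup>2 / (4 * (\<eta> * t * \<omega>)) \<le> \<eta>\<^sup>2 * (\<omega> / (64 * (1 + \<beta>))) * G / (4 * (\<eta> * t * \<omega>))"
    using norm_Pd2_omega t eta_pos omega_pos by (intro divide_right_mono) simp_all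
  also have "\<dots> = \<eta> * (1 / (256 * t * (1 + \<beta>)) * G)"
  proof -
    have "\<eta> * \<omega> \<noteq> 0" "1 + \<beta> \<noteq> 0" "t \<noteq> 0" using t eta_pos omega_pos beta_pos by simp_all
    then show ?thesis by (simp add: divide_simps power2_eq_square)
  qed
  finally have *: "(1 / \<omega>) * (x \<bullet> P d) \<le> \<eta> * (t * (\<omega> * X) + 1 / (256 * t * (1 + \<beta>)) * G)" (is "_ \<le> ?B")
    by (simp add: algebra_simps)
  have B0: "0 \<le> ?B" using t eta_pos omega_pos beta_pos by simp
  have "c * ((1 / \<omega>) * (x \<bullet> P d)) \<le> c * ?B" using * c_pos by (intro mult_left_mono) simp_all
  also have "\<dots> \<le> 1 * ?B" using c_le_1 B0 by (intro mult_right_mono) simp_all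
  finally show ?thesis by simp
qed

lemma term_dd: "\<kappa> / (2 * \<omega>\<^sup>2) * (d \<bullet> P d) \<le> \<eta> * (1/3840 * G)"
proof -
  have "d \<bullet> P d \<le> norm d * norm (P d)" by (rule norm_cauchy_schwarz)
  also have "\<dots> \<le> norm d * (norm d / lo)"
    using norm_P_le[of d] lo_pos by (intro mult_left_mono) (simp_all add: field_simps)
  also have "\<dots> = (norm d)\<^sup>2 / lo" by (simp add: power2_eq_square)
  also have "\<dots> \<le> \<eta>\<^sup>2 * Lf\<^sup>2 * G / lo" using norm_d2 lo_pos by (intro divide_right_mono) simp_all
  finally have "\<kappa> / (2 * \<omega>\<^sup>2) * (d \<bullet> P d) \<le> \<kappa> / (2 * \<omega>\<^sup>2) * (\<eta>\<^sup>2 * Lf\<^sup>2 * G / lo)"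
    using kappa_pos by (intro mult_left_mono) simp_all
  also have "\<dots> = \<kappa> / 2 * \<eta>\<^sup>2 * (Lf\<^sup>2 / (\<omega>\<^sup>2 * lo)) * G" using omega_pos lo_pos by (simp add: field_simps)
  also have "\<dots> \<le> \<kappa> / 2 * \<eta>\<^sup>2 * (1 / (16 * (1 + \<beta>))) * G"
    using Lf_lo kappa_pos by (intro mult_left_mono mult_right_mono) simp_all
  also have "\<dots> = \<kappa> / (1 + \<beta>) * (\<eta> * (\<eta> / 32 * G))"
    using beta_pos by (simp add: field_simps power2_eq_square)
  also have "\<dots> \<le> 1 * (\<eta> * (1/120 / 32 * G))"
    using kappa_le kappa_pos beta_pos eta_le eta_pos
    by (intro mult_mono mult_left_mono mult_right_mono divide_right_mono) (simp_all add: field_simps)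
  finally show ?thesis by simp
qed

lemma term_hd: "- (c * \<eta> / \<omega> * (h \<bullet> P d)) \<le> \<eta> * (1/1000 * ((norm h)\<^sup>2 + G))"
proof -
  have "(norm ((1 / \<omega>) *\<^sub>R P d))\<^sup>2 = (norm (P d))\<^sup>2 / \<omega>\<^sup>2"
    by (simp add: power_divide power_mult_distrib)
  also have "\<dots> \<le> \<eta>\<^sup>2 * (\<omega> / (64 * (1 + \<beta>))) * G" by (rule norm_Pd2_omega)
  also have "\<dots> \<le> \<eta>\<^sup>2 * (\<omega> / (64 * 1)) * G"
    using beta_pos omega_pos by (intro mult_left_mono mult_right_mono divide_left_mono) simp_all
  also have "\<dots> = (\<eta>\<^sup>2 * \<omega>) / 64 * G" by simp
  also have "\<dots> \<le> (1/16200) / 64 * G" using eta2_omega by (intro mult_right_mono divide_right_mono) simp_all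
  finally have *: "(norm ((1 / \<omega>) *\<^sub>R P d))\<^sup>2 \<le> 1/1036800 * G" by simp
  have "- (h \<bullet> ((1 / \<omega>) *\<^sub>R P d)) \<le> 1/1000 * (norm h)\<^sup>2 + (norm ((1 / \<omega>) *\<^sub>R P d))\<^sup>2 / (4 * (1/1000))"
    by (rule inner_Young_minus) simp
  also have "\<dots> \<le> 1/1000 * ((norm h)\<^sup>2 + G)" 
  proof -
    have "1/1000 * H + w / (4 * (1/1000)) \<le> 1/1000 * (H + g)" if "w \<le> 1/1036800 * g" "0 \<le> g"
      for H w g :: real using that by (simp add: field_simps)
    then show ?thesis using * zero_le_power2 by blast
  qed
  finally have "(c * \<eta>) * (- (h \<bullet> ((1 / \<omega>) *\<^sub>R P d))) \<le> (c * \<eta>) * (1/1000 * ((norm h)\<^sup>2 + G))"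
    using c_pos eta_pos by (intro mult_left_mono) simp_all
  also have "\<dots> \<le> (1 * \<eta>) * (1/1000 * ((norm h)\<^sup>2 + G))"
    using c_le_1 eta_pos by (intro mult_right_mono) simp_all
  finally show ?thesis by simp
qed

lemma term_Phi:
  assumes k: "0 < k"
  shows "potential c \<kappa> x z \<le> (1/2 + c / (2 * k * lo)) * X + (\<kappa> + c * k) / 2 * Z"
proof -
  have "x \<bullet> P z \<le> (1 / (2 * k * lo)) * X + (norm (P z))\<^sup>2 / (4 * (1 / (2 * k * lo)))"
    using k lo_pos by (intro inner_Young) simp
  also have "\<dots> \<le> (1 / (2 * k * lo)) * X + (Z / lo) / (4 * (1 / (2 * k * lo)))"
    using norm_Pz k lo_pos by (intro add_left_mono divide_right_mono) simp_all
  also have "\<dots> = (1 / (2 * k * lo)) * X + k / 2 * Z" using k lo_pos by simp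
  finally have "c * (x \<bullet> P z) \<le> c * ((1 / (2 * k * lo)) * X + k / 2 * Z)"
    using c_pos by (intro mult_left_mono) simp_all
  then show ?thesis unfolding potential_def by (simp add: power2_norm_eq_inner algebra_simps add_divide_distrib)
qed

lemma term_a:
  assumes "0 < w1" "0 < w2" "0 < w3" "0 < w4" "1 / w1 + 1 / w2 + 1 / w3 + 1 / w4 = 1"
  shows "a \<bullet> a \<le> w1 * ((\<beta> * \<omega>)\<^sup>2 * hi\<^sup>2 * X) + w2 * ((\<beta> * \<omega>)\<^sup>2 * hi\<^sup>2 * E) + w3 * (\<omega>\<^sup>2 * hi * Z)
    + w4 * (2 * N + 2 * (Lf\<^sup>2 * X))"
proof -
  have a_eq: "a = (\<beta> * \<omega>) *\<^sub>R L x + (\<beta> * \<omega>) *\<^sub>R L e + \<omega> *\<^sub>R z + h"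
    by (simp add: linear_add[OF linear_L] scaleR_add_right)
  have "(norm a)\<^sup>2 \<le> (norm ((\<beta> * \<omega>) *\<^sub>R L x))\<^sup>2 / (1 / w1) + (norm ((\<beta> * \<omega>) *\<^sub>R L e))\<^sup>2 / (1 / w2)
      + (norm (\<omega> *\<^sub>R z))\<^sup>2 / (1 / w3) + (norm h)\<^sup>2 / (1 / w4)"
    unfolding a_eq using assms by (intro norm_sum4_sq_le) simp_all
  also have "\<dots> = w1 * ((\<beta> * \<omega>)\<^sup>2 * (norm (L x))\<^sup>2) + w2 * ((\<beta> * \<omega>)\<^sup>2 * (norm (L e))\<^sup>2)
      + w3 * (\<omega>\<^sup>2 * (norm z)\<^sup>2) + w4 * (norm h)\<^sup>2"
    by (simp add: power_mult_distrib algebra_simps)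
  also have "\<dots> \<le> w1 * ((\<beta> * \<omega>)\<^sup>2 * (hi\<^sup>2 * X)) + w2 * ((\<beta> * \<omega>)\<^sup>2 * (hi\<^sup>2 * E))
      + w3 * (\<omega>\<^sup>2 * (hi * Z)) + w4 * (2 * N + 2 * (Lf\<^sup>2 * X))"
    using assms L_upper[of x] L_upper[of e] norm_z norm_h
    by (intro add_mono mult_left_mono) (simp_all add: K_x K_e)
  finally show ?thesis by (simp add: power2_norm_eq_inner algebra_simps)
qed

text \<open>Change of the potential, of the gap (by the descent lemma, and with the part reserved for the
  Polyak-Lojasiewicz inequality) and of the squared compression error, up to the contraction of the latter.\<close>

definition drift :: real where
  "drift = potential c \<kappa> (x - \<eta> *\<^sub>R a) (z + (\<eta> * \<omega>) *\<^sub>R L (x + e) + (1 / \<omega>) *\<^sub>R d) - potential c \<kappa> x z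
     - \<eta> * ((q - b) \<bullet> q) + \<eta> / (2 * (1 + 2 * \<beta>)) * (norm (q - b))\<^sup>2 + \<eta>\<^sup>2 * Lf / 2 * G
     + (1 + 2 / \<phi>2) * \<eta>\<^sup>2 * (a \<bullet> a + G)"

lemma drift_le:
  assumes g: "0 < g" and t: "0 < t" and s: "0 < s" and p: "p = 1 / (1 + 2 * \<beta>)"
  shows "drift \<le> \<eta> * (- (\<beta> * \<omega>) * (x \<bullet> L x) - (\<beta> * \<omega>) * (x \<bullet> L e) - (1 - j) * \<omega> * (x \<bullet> z) + j * \<omega> * (z \<bullet> e)
      + (1/2 * X + 1/2 * N + Lf * X) + c * \<omega> * X + c * \<omega> * (x \<bullet> e) - c * \<omega> * Z
      + c * (2 * N + 3/64 * (\<omega> * Z) + \<omega> * X / (1 + \<beta>))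
      + c * \<omega> * (1/60 * Z + 1/120 * X + 1/120 * E)
      + 1/135 * ((norm h)\<^sup>2 + 1/2 * X + 1/2 * E)
      + (T - \<eta>) / 4 * (a \<bullet> a)
      + (g * G + \<kappa>\<^sup>2 / (64 * g * (1 + \<beta>)) * Z) + (1/180 * G + 1/360 * X + 1/360 * E)
      + (t * (\<omega> * X) + 1 / (256 * t * (1 + \<beta>)) * G) + 1/3840 * G + 1/1000 * ((norm h)\<^sup>2 + G)
      - (1 - p / 2 - (1 - p) * s) * G + ((1 - p) / (4 * s) + p / 2) * (norm b)\<^sup>2
      + 1/360 * G + T / 4 * G)"
proof -
  define y where "y = x + e"
  have p1: "0 < p" "p \<le> 1" using beta_pos by (simp_all add: p)
  have Kh: "K h = h" by (simp add: linear_add[OF linear_K] K_K)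
  have yLy: "\<eta>\<^sup>2 * (\<omega>\<^sup>2 * (j - c * \<beta>) / 2 * (y \<bullet> L y)) \<le> 0"
  proof -
    have "(j - c * \<beta>) * (y \<bullet> L y) \<le> 0" using j_le L_nonneg[of y] by (intro mult_nonpos_nonneg) simp_all
    from mult_nonneg_nonpos[OF _ this, of "\<eta>\<^sup>2 * \<omega>\<^sup>2 / 2"]
    have "(\<eta>\<^sup>2 * \<omega>\<^sup>2 / 2) * ((j - c * \<beta>) * (y \<bullet> L y)) \<le> 0" by simp
    then show ?thesis by (simp add: algebra_simps)
  qed
  have zy: "\<eta> * (c * \<omega> * (- (\<eta> * \<omega> * (z \<bullet> y)))) \<le> \<eta> * (c * \<omega> * (1/60 * Z + 1/120 * X + 1/120 * E))"
    unfolding y_def using term_zy c_pos omega_pos eta_pos by (intro mult_left_mono) simp_all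
  have hy: "\<eta> * (c * (- (\<eta> * \<omega> * (h \<bullet> y)))) \<le> \<eta> * (1/135 * ((norm h)\<^sup>2 + 1/2 * X + 1/2 * E))"
  proof -
    have "c * (- (\<eta> * \<omega> * (h \<bullet> y))) \<le> c * (1/135 * ((norm h)\<^sup>2 + 1/2 * X + 1/2 * E))"
      unfolding y_def using term_hy c_pos by (intro mult_left_mono) simp_all
    also have "\<dots> \<le> 1 * (1/135 * ((norm h)\<^sup>2 + 1/2 * X + 1/2 * E))"
      using c_le_1 by (intro mult_right_mono) simp_all
    finally show ?thesis using eta_pos by (intro mult_left_mono) simp_all
  qed
  have xh: "\<eta> * (- (x \<bullet> h)) \<le> \<eta> * (1/2 * X + 1/2 * N + Lf * X)"
    using term_xh eta_pos by (intro mult_left_mono) simp_all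
  have hz: "\<eta> * (c * (- (h \<bullet> P z))) \<le> \<eta> * (c * (2 * N + 3/64 * (\<omega> * Z) + \<omega> * X / (1 + \<beta>)))"
    using term_hz eta_pos c_pos by (intro mult_left_mono) simp_all
  have qq: "\<eta> * (- ((q - b) \<bullet> q) + p / 2 * (norm (q - b))\<^sup>2)
     \<le> \<eta> * (- (1 - p / 2 - (1 - p) * s) * G + ((1 - p) / (4 * s) + p / 2) * (norm b)\<^sup>2)"
    using descent_with_gradient_error[OF s p1(2)] eta_pos by (intro mult_left_mono) simp_all
  have sm: "\<eta>\<^sup>2 * Lf / 2 * G \<le> \<eta> * (1/360 * G)"
  proof -
    have "\<eta> / 2 * (\<eta> * Lf) * G \<le> \<eta> / 2 * (1/180) * G"
      using eta_Lf eta_pos by (intro mult_right_mono mult_left_mono) simp_all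
    then show ?thesis by (simp add: power2_eq_square algebra_simps)
  qed
  have cG: "(1 + 2 / \<phi>2) * \<eta>\<^sup>2 * G \<le> \<eta> * (T / 4 * G)"
  proof -
    have "(1 + 2 / \<phi>2) * \<eta> \<le> T / 4" using eta_pos by (simp add: T_def algebra_simps)
    then have "((1 + 2 / \<phi>2) * \<eta>) * (\<eta> * G) \<le> T / 4 * (\<eta> * G)"
      using eta_pos by (intro mult_right_mono) simp_all
    then show ?thesis by (simp add: power2_eq_square algebra_simps)
  qed
  have ca: "\<eta>\<^sup>2 * (1/2 * (a \<bullet> a)) + (1 + 2 / \<phi>2) * \<eta>\<^sup>2 * (a \<bullet> a) = \<eta> * ((T - \<eta>) / 4 * (a \<bullet> a))"
    by (simp add: T_def power2_eq_square algebra_simps add_divide_distrib)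
  have d_eq: "drift = \<eta> * (- (\<beta> * \<omega>) * (x \<bullet> L x) - (\<beta> * \<omega>) * (x \<bullet> L e) - (1 - j) * \<omega> * (x \<bullet> z)
        + j * \<omega> * (z \<bullet> e) + c * \<omega> * (x \<bullet> x) + c * \<omega> * (x \<bullet> e) - c * \<omega> * Z)
      + \<eta> * (- (x \<bullet> h)) + \<eta> * (c * (- (h \<bullet> P z)))
      + (\<eta>\<^sup>2 * (1/2 * (a \<bullet> a)) + (1 + 2 / \<phi>2) * \<eta>\<^sup>2 * (a \<bullet> a)) + (1 + 2 / \<phi>2) * \<eta>\<^sup>2 * G
      + \<eta>\<^sup>2 * (\<omega>\<^sup>2 * (j - c * \<beta>) / 2 * (y \<bullet> L y))
      + \<eta> * (c * \<omega> * (- (\<eta> * \<omega> * (z \<bullet> y)))) + \<eta> * (c * (- (\<eta> * \<omega> * (h \<bullet> y))))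
      + (\<kappa> / \<omega> - c * \<eta>) * (z \<bullet> P d) + j * \<eta> * (y \<bullet> d) + c / \<omega> * (x \<bullet> P d)
      + \<kappa> / (2 * \<omega>\<^sup>2) * (d \<bullet> P d) + - (c * \<eta> / \<omega> * (h \<bullet> P d))
      + \<eta> * (- ((q - b) \<bullet> q) + p / 2 * (norm (q - b))\<^sup>2) + \<eta>\<^sup>2 * Lf / 2 * G"
  proof -
    have pe: "\<eta> / (2 * (1 + 2 * \<beta>)) * w = \<eta> * (p / 2 * w)" for w by (simp add: p)
    show ?thesis
      unfolding drift_def y_def pe
        potential_step[OF K_x K_z K_e Kh K_d less_imp_neq[OF omega_pos, symmetric] refl kappa]
      by (simp add: algebra_simps power2_eq_square)
  qed
  have sum_le: "drift \<le> \<eta> * (- (\<beta> * \<omega>) * (x \<bullet> L x) - (\<beta> * \<omega>) * (x \<bullet> L e) - (1 - j) * \<omega> * (x \<bullet> z)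
        + j * \<omega> * (z \<bullet> e) + c * \<omega> * X + c * \<omega> * (x \<bullet> e) - c * \<omega> * Z)
      + \<eta> * (1/2 * X + 1/2 * N + Lf * X) + \<eta> * (c * (2 * N + 3/64 * (\<omega> * Z) + \<omega> * X / (1 + \<beta>)))
      + \<eta> * ((T - \<eta>) / 4 * (a \<bullet> a)) + \<eta> * (T / 4 * G) + 0
      + \<eta> * (c * \<omega> * (1/60 * Z + 1/120 * X + 1/120 * E)) + \<eta> * (1/135 * ((norm h)\<^sup>2 + 1/2 * X + 1/2 * E))
      + \<eta> * (g * G + \<kappa>\<^sup>2 / (64 * g * (1 + \<beta>)) * Z) + \<eta> * (1/180 * G + 1/360 * X + 1/360 * E)
      + \<eta> * (t * (\<omega> * X) + 1 / (256 * t * (1 + \<beta>)) * G) + \<eta> * (1/3840 * G) + \<eta> * (1/1000 * ((norm h)\<^sup>2 + G))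
      + \<eta> * (- (1 - p / 2 - (1 - p) * s) * G + ((1 - p) / (4 * s) + p / 2) * (norm b)\<^sup>2) + \<eta> * (1/360 * G)"
    unfolding d_eq ca power2_norm_eq_inner[of x, symmetric]
    by (intro add_mono order_refl xh hz cG yLy zy hy term_zd[OF g] term_yd[folded y_def] term_xd[OF t]
        term_dd term_hd qq sm)
  have re: "\<eta> * (A0 + cX + cxe - cZ) + \<eta> * Bxh + \<eta> * Bhz + \<eta> * Ba + \<eta> * BG + 0 + \<eta> * Bzy + \<eta> * Bhy
      + \<eta> * Bzd + \<eta> * Byd + \<eta> * Bxd + \<eta> * Bdd + \<eta> * Bhd + \<eta> * (- q1 * G + q2) + \<eta> * Bsm
     = \<eta> * (A0 + Bxh + cX + cxe - cZ + Bhz + Bzy + Bhy + Ba + Bzd + Byd + Bxd + Bdd + Bhd - q1 * G + q2 + Bsm + BG)"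
    for A0 cX cxe cZ Bxh Bhz Ba BG Bzy Bhy Bzd Byd Bxd Bdd Bhd q1 q2 Bsm :: real
    by (simp add: algebra_simps)
  show ?thesis using sum_le unfolding re .
qed

lemma Lyapunov_form_le:
  assumes "0 < k"
  shows "\<tau> * potential c \<kappa> x z \<le> \<tau> * (1/2 + c / (2 * k * lo)) * X + \<tau> * ((\<kappa> + c * k) / 2) * Z"
  using mult_left_mono[OF term_Phi[OF assms] rate_nonneg]
  by (simp only: distrib_left[of \<tau> "_ * _"] mult.assoc)

text \<open>With \<open>c = j = 1\<close> the contraction \<open>\<beta> \<omega> lo |x|\<^sup>2\<close> is halved to absorb the product of \<open>x\<close> with the estimate error, and
  its other half is \<open>gamma_lo_eq\<close>. The constants below distribute this half and \<open>\<omega> z \<cdot> P z\<close> among the remaining terms;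
  the final arithmetic is linear once every monomial is treated as a variable.\<close>

lemma drift_small_beta:
  assumes beta6: "\<beta> \<le> 6" and c1: "c = 1" and j1: "j = 1"
  shows "drift \<le> \<eta> * (- (\<tau> * potential c \<kappa> x z)
    + comp_coef * E + noise_coef * (N + N'))"
proof -
  define p where "p = 1 / (1 + 2 * \<beta>)"
  have p: "0 < p" "p \<le> 1/3" using beta_gt_1 by (simp_all add: p_def field_simps)
  have kap: "\<kappa> = 1 + \<beta>" using kappa c1 j1 by simp
  define Y where "Y = (\<beta> * \<omega>)\<^sup>2 * hi\<^sup>2 * X"
  define W where "W = (\<beta> * \<omega>)\<^sup>2 * hi\<^sup>2 * E"
  define V where "V = \<omega>\<^sup>2 * hi * Z"
  define lX where "lX = Lf\<^sup>2 * X"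
  define oX where "oX = \<omega> * X"
  define oZ where "oZ = \<omega> * Z"
  define oE where "oE = \<omega> * E"
  define mX where "mX = margin * X"
  have nn: "0 \<le> Y" "0 \<le> W" "0 \<le> V" "0 \<le> lX" "0 \<le> oX" "0 \<le> oZ" "0 \<le> oE" "0 \<le> X" "0 \<le> E"
    "0 \<le> N" "0 \<le> N'" "0 \<le> G"
    using omega_pos hi_pos Z_nonneg by (simp_all add: Y_def W_def V_def lX_def oX_def oZ_def oE_def)
  have f1: "- (\<beta> * \<omega>) * (x \<bullet> L x) - (\<beta> * \<omega>) * (x \<bullet> L e) \<le> - (\<beta> * \<omega> / 2 * lo * X) + \<beta> * \<omega> * hi / 2 * E"
  proof -
    have "- (x \<bullet> L x) - x \<bullet> L e \<le> - (1/2 * (lo * X)) + hi / 2 * E"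
      using term_Le L_lower[of x] by (simp add: K_x)
    from mult_left_mono[OF this, of "\<beta> * \<omega>"] beta_pos omega_pos show ?thesis by (simp add: algebra_simps)
  qed
  have f2: "\<omega> * (z \<bullet> e) \<le> 1/4 * oZ + \<omega> * hi * E"
    using mult_left_mono[OF term_ze, of \<omega>] omega_pos by (simp add: oZ_def algebra_simps)
  have f3: "\<omega> * (x \<bullet> e) \<le> 1/4 * oX + oE"
  proof -
    have "x \<bullet> e \<le> 1/4 * X + E" using inner_Young[of "1/4" x e] by simp
    from mult_left_mono[OF this, of \<omega>] omega_pos show ?thesis by (simp add: oX_def oE_def algebra_simps)
  qed
  have f4: "(T - \<eta>) / 4 * (a \<bullet> a) \<le> T * Y + T * W + 3/4 * (T * V) + 3 * ((T - \<eta>) * N) + 3 * ((T - \<eta>) * lX)"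
  proof -
    have Te: "0 \<le> T - \<eta>" using eta_le_T eta_pos by simp
    have "a \<bullet> a \<le> 4 * Y + 4 * W + 3 * V + 6 * (2 * N + 2 * lX)"
      unfolding Y_def W_def V_def lX_def by (rule term_a) simp_all
    then have "(T - \<eta>) / 4 * (a \<bullet> a) \<le> (T - \<eta>) / 4 * (4 * Y + 4 * W + 3 * V + 6 * (2 * N + 2 * lX))"
      using Te by (intro mult_left_mono) simp_all
    also have "\<dots> = (T - \<eta>) * Y + (T - \<eta>) * W + 3/4 * ((T - \<eta>) * V) + 3 * ((T - \<eta>) * N) + 3 * ((T - \<eta>) * lX)"
      by (simp add: algebra_simps add_divide_distrib diff_divide_distrib)
    also have "\<dots> \<le> T * Y + T * W + 3/4 * (T * V) + 3 * ((T - \<eta>) * N) + 3 * ((T - \<eta>) * lX)"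
      using eta_pos nn by (intro add_mono mult_right_mono mult_left_mono) simp_all
    finally show ?thesis by simp
  qed
  have f5: "Lf * X \<le> 1/2 * X + 1/2 * lX"
  proof -
    have "0 \<le> (Lf - 1)\<^sup>2" by simp
    then have "Lf \<le> 1/2 + 1/2 * Lf\<^sup>2" by (simp add: power2_eq_square algebra_simps)
    from mult_right_mono[OF this, of X] show ?thesis by (simp add: lX_def algebra_simps)
  qed
  have f6: "27/50 * G + 1/180 * G + 1 / (256 * (1/8) * (1 + \<beta>)) * G + 1/3840 * G + 1/1000 * G
      - (1 - p / 2 - (1 - p) * (7/20)) * G + 1/360 * G + T / 4 * G \<le> 0"
  proof -
    have "1 / (256 * (1/8) * (1 + \<beta>)) \<le> 1/64" using beta_gt_1 by (simp add: field_simps)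
    moreover have "27/50 + 1/180 + u + 1/3840 + 1/1000 - (1 - p / 2 - (1 - p) * (7/20)) + 1/360 + T / 4 \<le> 0"
      if "u \<le> 1/64" for u using that p T_le by (simp add: field_simps)
    ultimately have "27/50 + 1/180 + 1 / (256 * (1/8) * (1 + \<beta>)) + 1/3840 + 1/1000
      - (1 - p / 2 - (1 - p) * (7/20)) + 1/360 + T / 4 \<le> 0" by blast
    from mult_right_mono[OF this, of G] show ?thesis using nn by (simp only: left_diff_distrib distrib_right mult_zero_left)
  qed
  have f7: "((1 - p) / (4 * (7/20)) + p / 2) * (norm b)\<^sup>2 \<le> 20/7 * N' + 20/21 * lX"
  proof -
    have b: "(norm b)\<^sup>2 \<le> 4 * N' + 4/3 * lX" using norm_b[of 3] by (simp add: lX_def)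
    have "((1 - p) / (4 * (7/20)) + p / 2) * (norm b)\<^sup>2 \<le> 5/7 * (norm b)\<^sup>2"
      using p by (intro mult_right_mono) (simp_all add: diff_divide_distrib)
    then show ?thesis using b by simp
  qed
  have f8: "\<tau> * potential c \<kappa> x z \<le> 2/3 * mX + 1/4 * oX + \<tau> * ((1 + \<beta> + 1/9) / 2) * Z"
  proof -
    define k where "k = 1 / (2 * \<beta> * lo)"
    have k: "0 < k" "k \<le> 1/9" using beta_pos lo_pos beta_lo by (simp_all add: k_def field_simps)
    have "1/2 + c / (2 * k * lo) = 1/2 + \<beta>" using lo_pos beta_pos by (simp add: k_def c1)
    then have "\<tau> * potential c \<kappa> x z \<le> \<tau> * (1/2 + \<beta>) * X + \<tau> * ((\<kappa> + c * k) / 2) * Z"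
      using Lyapunov_form_le[OF k(1)] by simp
    also have "\<tau> * ((\<kappa> + c * k) / 2) * Z \<le> \<tau> * ((1 + \<beta> + 1/9) / 2) * Z"
      using rate_nonneg k Z_nonneg by (intro mult_right_mono mult_left_mono) (simp_all add: kap c1)
    also have "\<tau> * (1/2 + \<beta>) * X \<le> 2/3 * mX + 1/4 * oX"
    proof -
      have "\<tau> * (1/2 + \<beta>) \<le> 2/3 * margin + 1/4 * \<omega>"
        using rate_x rate_omega by (simp add: algebra_simps)
      from mult_right_mono[OF this, of X] show ?thesis by (simp add: mX_def oX_def algebra_simps)
    qed
    finally show ?thesis by simp
  qed
  have f9: "\<beta> * \<omega> / 2 * lo * X \<ge> mX + 9/4 * oX + X + 5/4 * lX + 2 * ((T - \<eta>) * lX) + T * Y"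
  proof -
    have e: "\<eta> * (12 + 16 / \<phi>2) = 2 * (T - \<eta>)" by (simp add: T_def algebra_simps)
    have "0 \<le> \<eta> + 2 * \<omega>\<^sup>2 * \<eta>" using eta_pos by simp
    then have "margin + 9/4 * \<omega> + 1 + 5/4 * Lf\<^sup>2 + 2 * (T - \<eta>) * Lf\<^sup>2 + T * (\<beta> * \<omega>)\<^sup>2 * hi\<^sup>2 \<le> \<beta> * \<omega> / 2 * lo"
      using gamma_lo_eq unfolding e by simp
    from mult_right_mono[OF this, of X] show ?thesis
      by (simp add: mX_def oX_def lX_def Y_def algebra_simps)
  qed
  have f10: "5/4 * lX \<le> mX"
    using mult_right_mono[OF margin_ge, of X] by (simp add: mX_def lX_def algebra_simps)
  have f11: "(1/4 + 3/64 + 1/60) * oZ + 3/4 * (T * V) + \<tau> * ((1 + \<beta> + 1/9) / 2) * Z + \<kappa>\<^sup>2 / (64 * (27/50) * (1 + \<beta>)) * Z \<le> oZ"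
  proof -
    have e: "\<kappa>\<^sup>2 / (64 * (27/50) * (1 + \<beta>)) = (1 + \<beta>) / (64 * (27/50))"
    proof -
      have "w * w / (64 * (27/50) * w) = w / (64 * (27/50))" if "0 < w" for w :: real using that by simp
      from this[of "1 + \<beta>"] show ?thesis
        using add_pos_pos[OF zero_less_one beta_pos] unfolding kap power2_eq_square by blast
    qed
    show ?thesis using mult_right_mono[OF z_budget_small_beta[OF beta6] Z_nonneg]
      unfolding e V_def oZ_def by (simp only: distrib_right mult.assoc)
  qed
  have f12: "(T - \<eta>) * lX \<le> 1/8 * lX" "3 * ((T - \<eta>) * N) \<le> (13 * \<eta> + 16 * \<eta> / \<phi>2) * N + 1/8 * N"
  proof -
    show "(T - \<eta>) * lX \<le> 1/8 * lX" using T_le eta_pos nn by (intro mult_right_mono) simp_all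
    have "3 * (T - \<eta>) \<le> 13 * \<eta> + 16 * \<eta> / \<phi>2 + 1/8"
      using T_le eta_pos by (simp add: T_def algebra_simps)
    from mult_right_mono[OF this, of N] show "3 * ((T - \<eta>) * N) \<le> (13 * \<eta> + 16 * \<eta> / \<phi>2) * N + 1/8 * N"
      by (simp add: algebra_simps)
  qed
  have f13: "E \<le> 3 * oE" using mult_right_mono[of 1 "3 * \<omega>" E] omega_gt by (simp add: oE_def)
  have f14: "\<omega> * X / (1 + \<beta>) \<le> 1/2 * oX"
  proof -
    have "oX / (1 + \<beta>) \<le> oX / 2" using beta_gt_1 nn by (intro divide_left_mono) simp_all
    then show ?thesis by (simp add: oX_def)
  qed
  have f15: "X \<le> 3 * oX" using mult_right_mono[of 1 "3 * \<omega>" X] omega_gt by (simp add: oX_def)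
  have f16: "(norm h)\<^sup>2 \<le> 2 * N + 2 * lX" unfolding lX_def by (rule norm_h)
  have target: "comp_coef * E \<ge> \<beta> * \<omega> * hi / 2 * E + \<omega> * hi * E + 2 * oE + T * W"
  proof -
    have "0 \<le> \<eta> * (1 + 2 * \<omega>\<^sup>2) * E" using eta_pos by simp
    moreover have "comp_coef * E = \<beta> * \<omega> * hi / 2 * E + \<omega> * hi * E + 2 * oE + T * W + \<eta> * (1 + 2 * \<omega>\<^sup>2) * E"
      by (simp add: comp_coef_def T_def W_def oE_def algebra_simps)
    ultimately show ?thesis by simp
  qed
  have target2: "noise_coef * (N + N') \<ge> 3 * N + (13 * \<eta> + 16 * \<eta> / \<phi>2) * N + 3 * N'"
  proof -
    have "0 \<le> (13 * \<eta> + 16 * \<eta> / \<phi>2) * N'" using eta_pos phi2_pos by simp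
    then show ?thesis by (simp add: noise_coef_def distrib_left distrib_right)
  qed
  have dr: "drift \<le> \<eta> * (- (\<beta> * \<omega>) * (x \<bullet> L x) - (\<beta> * \<omega>) * (x \<bullet> L e) + \<omega> * (z \<bullet> e)
      + (1/2 * X + 1/2 * N + Lf * X) + oX + \<omega> * (x \<bullet> e) - oZ
      + (2 * N + 3/64 * oZ + \<omega> * X / (1 + \<beta>))
      + (1/60 * oZ + 1/120 * oX + 1/120 * oE)
      + 1/135 * ((norm h)\<^sup>2 + 1/2 * X + 1/2 * E)
      + (T - \<eta>) / 4 * (a \<bullet> a)
      + (27/50 * G + \<kappa>\<^sup>2 / (64 * (27/50) * (1 + \<beta>)) * Z) + (1/180 * G + 1/360 * X + 1/360 * E)
      + (1/8 * oX + 1 / (256 * (1/8) * (1 + \<beta>)) * G) + 1/3840 * G + 1/1000 * ((norm h)\<^sup>2 + G)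
      - (1 - p / 2 - (1 - p) * (7/20)) * G + ((1 - p) / (4 * (7/20)) + p / 2) * (norm b)\<^sup>2
      + 1/360 * G + T / 4 * G)"
    using drift_le[of "27/50" "1/8" "7/20" p, OF _ _ _ p_def]
    unfolding c1 j1 oX_def oZ_def oE_def
    by (simp only: diff_self mult_zero_left mult_1 diff_zero distrib_left[of \<omega>]) simp
  have sum: "A1 + A2 + (1/2 * x2 + 1/2 * n2 + A5) + xo + A3 - zo + (2 * n2 + 3/64 * zo + X1)
      + (1/60 * zo + 1/120 * xo + 1/120 * eo) + 1/135 * (h2 + 1/2 * x2 + 1/2 * e2) + A4
      + (G1 + Z1) + (1/180 * g2 + 1/360 * x2 + 1/360 * e2) + (1/8 * xo + G3) + 1/3840 * g2 + 1/1000 * (h2 + g2)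
      - G4 + B + 1/360 * g2 + G5 \<le> - Ph + R1 + R2"
    if "A1 \<le> - gx + ge" "A2 \<le> 1/4 * zo + he" "A3 \<le> 1/4 * xo + eo"
      "A4 \<le> ty + tw + 3/4 * tv + 3 * tn + 3 * tl" "A5 \<le> 1/2 * x2 + 1/2 * lx"
      "G1 + 1/180 * g2 + G3 + 1/3840 * g2 + 1/1000 * g2 - G4 + 1/360 * g2 + G5 \<le> 0"
      "B \<le> 20/7 * n3 + 20/21 * lx" "Ph \<le> 2/3 * mx + 1/4 * xo + tz"
      "mx + 9/4 * xo + x2 + 5/4 * lx + 2 * tl + ty \<le> gx" "5/4 * lx \<le> mx"
      "(1/4 + 3/64 + 1/60) * zo + 3/4 * tv + tz + Z1 \<le> zo"
      "tl \<le> 1/8 * lx" "3 * tn \<le> nn + 1/8 * n2" "e2 \<le> 3 * eo" "X1 \<le> 1/2 * xo" "x2 \<le> 3 * xo"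
      "h2 \<le> 2 * n2 + 2 * lx" "ge + he + 2 * eo + tw \<le> R1" "3 * n2 + nn + 3 * n3 \<le> R2"
      "0 \<le> lx" "0 \<le> n2" "0 \<le> n3" "0 \<le> xo" "0 \<le> eo"
    for A1 A2 A3 A4 A5 x2 n2 n3 xo zo X1 eo h2 e2 G1 Z1 g2 G3 G4 B G5 Ph R1 R2 gx ge he ty tw tv tn tl lx mx tz nn :: real
    using that by argo
  show ?thesis
    by (rule order_trans[OF dr], rule mult_left_mono,
        rule sum[OF f1 f2 f3 f4 f5 f6 f7 f8 f9 f10 f11 f12 f13 f14 f15 f16 target target2])
      (use nn eta_pos in simp_all)
qed

text \<open>With \<open>j = 0\<close> the product of \<open>z\<close> with the estimate error disappears, and \<open>- \<omega> x \<cdot> z\<close> appears instead: it is paid by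
  an eighth of \<open>\<beta> \<omega> x \<cdot> L x\<close> and a third of \<open>c \<omega> z \<cdot> P z\<close>. This is possible because the second-order terms in \<open>x\<close>
  are given half the weight that they have for small \<open>\<beta>\<close>, at the expense of those in \<open>z\<close>, which here carry the small
  factor \<open>1 / \<beta>\<close> relative to \<open>\<omega>\<close>.\<close>

lemma drift_large_beta:
  assumes beta6: "6 < \<beta>" and c: "c = 6 / \<beta>" and j0: "j = 0"
  shows "drift \<le> \<eta> * (- (\<tau> * potential c \<kappa> x z)
    + comp_coef * E + noise_coef * (N + N'))"
proof -
  define p where "p = 1 / (1 + 2 * \<beta>)"
  have p: "0 < p" "p \<le> 1/13" using beta6 by (simp_all add: p_def field_simps)
  have cb: "c * \<beta> = 6" using beta_pos by (simp add: c)
  have kap: "\<kappa> = 6" using kappa cb j0 by simp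
  have T48: "T \<le> 1/48"
  proof -
    have "T * 6 \<le> T * \<beta>" using T_pos beta6 by (intro mult_left_mono) simp_all
    then show ?thesis using T_beta by simp
  qed
  have tau: "\<tau> \<le> 3/26 * \<omega>"
  proof -
    have "(13/2) * \<tau> \<le> (1/2 + \<beta>) * \<tau>" using beta6 rate_nonneg by (intro mult_right_mono) simp_all
    then show ?thesis using rate_omega by simp
  qed
  define Y where "Y = (\<beta> * \<omega>)\<^sup>2 * hi\<^sup>2 * X"
  define W where "W = (\<beta> * \<omega>)\<^sup>2 * hi\<^sup>2 * E"
  define V where "V = \<omega>\<^sup>2 * hi * Z"
  define lX where "lX = Lf\<^sup>2 * X"
  define oX where "oX = \<omega> * X"
  define cZ where "cZ = c * Z"
  define oZ where "oZ = c * \<omega> * Z"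
  define oE where "oE = \<omega> * E"
  define gX where "gX = \<beta> * \<omega> / 2 * lo * X"
  have nn: "0 \<le> Y" "0 \<le> W" "0 \<le> V" "0 \<le> lX" "0 \<le> oX" "0 \<le> oZ" "0 \<le> oE" "0 \<le> X" "0 \<le> E"
    "0 \<le> N" "0 \<le> N'" "0 \<le> G" "0 \<le> cZ"
    using omega_pos hi_pos Z_nonneg c_pos
    by (simp_all add: Y_def W_def V_def lX_def oX_def oZ_def oE_def cZ_def)
  have f1: "- (\<beta> * \<omega>) * (x \<bullet> L x) - (\<beta> * \<omega>) * (x \<bullet> L e) - \<omega> * (x \<bullet> z) \<le> - (3/4 * gX) + \<beta> * \<omega> * hi / 2 * E + 1/3 * oZ"
  proof -
    have 1: "(\<beta> * \<omega>) * (- (x \<bullet> L e)) \<le> (\<beta> * \<omega>) * (1/2 * (x \<bullet> L x) + hi / 2 * E)"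
      using term_Le beta_pos omega_pos by (intro mult_left_mono) simp_all
    have 2: "\<omega> * (- (x \<bullet> z)) \<le> \<omega> * (\<beta> / 8 * (x \<bullet> L x) + 2 / \<beta> * Z)"
      using term_xz omega_pos by (intro mult_left_mono) simp_all
    have 3: "(\<beta> * \<omega>) * (lo * X) \<le> (\<beta> * \<omega>) * (x \<bullet> L x)"
      using L_lower[of x] beta_pos omega_pos by (intro mult_left_mono) (simp_all add: K_x)
    have 4: "\<omega> * (2 / \<beta> * Z) = 1/3 * oZ" by (simp add: oZ_def c)
    have 5: "gX = 1/2 * ((\<beta> * \<omega>) * (lo * X))" by (simp add: gX_def)
    show ?thesis using 1 2 3 4 unfolding 5 by (simp add: algebra_simps add_divide_distrib)
  qed
  have f3: "c * \<omega> * (x \<bullet> e) \<le> 1/7 * oX + 7/4 * oE"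
  proof -
    have "x \<bullet> e \<le> 1/7 * X + 7/4 * E" using inner_Young[of "1/7" x e] by simp
    then have "(c * \<omega>) * (x \<bullet> e) \<le> (c * \<omega>) * (1/7 * X + 7/4 * E)"
      using c_pos omega_pos by (intro mult_left_mono) simp_all
    also have "\<dots> \<le> (1 * \<omega>) * (1/7 * X + 7/4 * E)"
      using c_le_1 omega_pos by (intro mult_right_mono) simp_all
    finally show ?thesis by (simp add: oX_def oE_def algebra_simps)
  qed
  have f4: "(T - \<eta>) / 4 * (a \<bullet> a) \<le> 1/2 * (T * Y) + T * W + 5/4 * (T * V) + 10/48 * N + 10/48 * lX"
  proof -
    have Te: "0 \<le> T - \<eta>" using eta_le_T eta_pos by simp
    have "a \<bullet> a \<le> 2 * Y + 4 * W + 5 * V + 20 * (2 * N + 2 * lX)"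
      unfolding Y_def W_def V_def lX_def by (rule term_a) simp_all
    then have "(T - \<eta>) / 4 * (a \<bullet> a) \<le> (T - \<eta>) / 4 * (2 * Y + 4 * W + 5 * V + 20 * (2 * N + 2 * lX))"
      using Te by (intro mult_left_mono) simp_all
    also have "\<dots> = 1/2 * ((T - \<eta>) * Y) + (T - \<eta>) * W + 5/4 * ((T - \<eta>) * V) + 10 * ((T - \<eta>) * N) + 10 * ((T - \<eta>) * lX)"
      by (simp add: algebra_simps add_divide_distrib diff_divide_distrib)
    also have "\<dots> \<le> 1/2 * (T * Y) + T * W + 5/4 * (T * V) + 10 * (1/48 * N) + 10 * (1/48 * lX)"
      using eta_pos nn T48 by (intro add_mono mult_right_mono mult_left_mono) simp_all
    finally show ?thesis by simp
  qed
  have f4': "5/4 * (T * V) \<le> 5/48 * oZ"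
  proof -
    have "(T * (\<beta> * \<omega>) * hi) * (c * \<omega> * Z) \<le> 1/2 * (c * \<omega> * Z)"
      using T_hi c_pos omega_pos Z_nonneg by (intro mult_right_mono) simp_all
    moreover have "(T * (\<beta> * \<omega>) * hi) * (c * \<omega> * Z) = (c * \<beta>) * (T * V)"
      by (simp add: V_def power2_eq_square algebra_simps)
    ultimately have "6 * (T * V) \<le> 1/2 * oZ" by (simp only: cb oZ_def)
    then show ?thesis by linarith
  qed
  have f5: "Lf * X \<le> 1/50 * gX + 25/672 * oX"
  proof -
    \<comment> \<open>The arithmetic-geometric mean inequality, as \<open>672 Lf\<^sup>2 \<le> \<beta> \<omega>\<^sup>2 lo\<close> here.\<close>
    define A where "A = \<beta> * \<omega> * lo / 100"
    define B where "B = 25 * \<omega> / 672"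
    have AB: "0 \<le> A" "0 \<le> B" using beta_pos omega_pos lo_pos by (simp_all add: A_def B_def)
    have "672 * Lf\<^sup>2 \<le> \<omega>\<^sup>2 * lo * \<beta>"
    proof -
      have "7 \<le> 1 + \<beta>" using beta6 by simp
      then have "6 * 7 \<le> \<beta> * (1 + \<beta>)" using beta6 by (intro mult_mono) simp_all
      then have "16 * Lf\<^sup>2 * (6 * 7) \<le> 16 * Lf\<^sup>2 * (\<beta> * (1 + \<beta>))" by (intro mult_left_mono) simp_all
      also have "\<dots> = \<beta> * (16 * (1 + \<beta>) * Lf\<^sup>2)" by simp
      also have "\<dots> \<le> \<beta> * (\<omega>\<^sup>2 * lo)" using smooth_le beta_pos by (intro mult_left_mono) simp_all
      finally show ?thesis by (simp add: mult_ac)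
    qed
    also have "\<omega>\<^sup>2 * lo * \<beta> = 672 * (4 * (A * B))" by (simp add: A_def B_def power2_eq_square)
    finally have "Lf\<^sup>2 \<le> 4 * (A * B)" by simp
    moreover have "0 \<le> (A - B)\<^sup>2" by simp
    ultimately have "Lf\<^sup>2 \<le> (A + B)\<^sup>2" by (simp add: power2_eq_square algebra_simps)
    then have "Lf \<le> A + B" by (rule power2_le_imp_le) (use AB in simp)
    from mult_right_mono[OF this, of X] show ?thesis
      by (simp add: A_def B_def gX_def oX_def algebra_simps)
  qed
  have f6: "33/50 * G + 1/180 * G + 1 / (256 * (1/16) * (1 + \<beta>)) * G + 1/3840 * G + 1/1000 * G
      - (1 - p / 2 - (1 - p) * (3/10)) * G + 1/360 * G + T / 4 * G \<le> 0"
  proof -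
    have "1 / (256 * (1/16) * (1 + \<beta>)) \<le> 1/112" using beta6 by (simp add: field_simps)
    moreover have "33/50 + 1/180 + u + 1/3840 + 1/1000 - (1 - p / 2 - (1 - p) * (3/10)) + 1/360 + T / 4 \<le> 0"
      if "u \<le> 1/112" for u using that p T48 by (simp add: field_simps)
    ultimately have "33/50 + 1/180 + 1 / (256 * (1/16) * (1 + \<beta>)) + 1/3840 + 1/1000
      - (1 - p / 2 - (1 - p) * (3/10)) + 1/360 + T / 4 \<le> 0" by blast
    from mult_right_mono[OF this, of G] show ?thesis using nn by (simp only: left_diff_distrib distrib_right mult_zero_left)
  qed
  have f7: "((1 - p) / (4 * (3/10)) + p / 2) * (norm b)\<^sup>2 \<le> 35/12 * N' + 7/6 * lX"
  proof -
    have b: "(norm b)\<^sup>2 \<le> 7/2 * N' + 7/5 * lX" using norm_b[of "5/2"] by (simp add: lX_def)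
    have "((1 - p) / (4 * (3/10)) + p / 2) * (norm b)\<^sup>2 \<le> 5/6 * (norm b)\<^sup>2"
      using p by (intro mult_right_mono) (simp_all add: diff_divide_distrib)
    then show ?thesis using b by simp
  qed
  have f8: "\<tau> * potential c \<kappa> x z \<le> 11/52 * oX + 3/8 * oZ - 1/8 * cZ + 3/104 * oZ"
  proof -
    have "\<tau> * potential c \<kappa> x z \<le> \<tau> * (1/2 + c / lo) * X + \<tau> * ((6 + c * (1/2)) / 2) * Z"
      using Lyapunov_form_le[of "1/2"] by (simp add: kap)
    also have "\<tau> * (1/2 + c / lo) * X \<le> 11/52 * oX"
    proof -
      have "c / lo \<le> 4/3" using beta_lo lo_pos beta_pos by (simp add: c field_simps)
      then have "\<tau> * (1/2 + c / lo) \<le> \<tau> * (1/2 + 4/3)"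
        using rate_nonneg by (intro mult_left_mono add_left_mono)
      also have "\<dots> \<le> 11/52 * \<omega>" using tau by simp
      finally show ?thesis using mult_right_mono[of "\<tau> * (1/2 + c / lo)" "11/52 * \<omega>" X] by (simp add: oX_def)
    qed
    also have "\<tau> * ((6 + c * (1/2)) / 2) * Z \<le> 3/8 * oZ - 1/8 * cZ + 3/104 * oZ"
    proof -
      have "\<beta> * \<tau> \<le> 3/4 * (\<omega> - 1/3)" using rate_omega rate_nonneg by (simp add: algebra_simps)
      then have "c * (\<beta> * \<tau>) \<le> c * (3/4 * (\<omega> - 1/3))" using c_pos by (intro mult_left_mono) simp_all
      then have 1: "6 * \<tau> \<le> c * (3/4 * (\<omega> - 1/3))" using cb by (simp add: mult.assoc[symmetric])
      have 2: "c * \<tau> \<le> c * (3/26 * \<omega>)" using tau c_pos by (intro mult_left_mono) simp_all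
      have "\<tau> * ((6 + c * (1/2)) / 2) \<le> 3/8 * (c * \<omega>) - 1/8 * c + 3/104 * (c * \<omega>)"
        using 1 2 by (simp add: algebra_simps add_divide_distrib)
      from mult_right_mono[OF this Z_nonneg] show ?thesis
        by (simp only: oZ_def cZ_def left_diff_distrib distrib_right mult.assoc)
    qed
    finally show ?thesis by simp
  qed
  have f9: "T * Y + 9/4 * oX + X + 5/2 * lX \<le> gX"
    using mult_right_mono[OF gamma_lo_ge, of X] by (simp add: oX_def lX_def Y_def gX_def algebra_simps)
  have f9': "0 \<le> T * Y" using T_pos nn by simp
  have f11: "\<kappa>\<^sup>2 / (64 * (33/50) * (1 + \<beta>)) * Z \<le> 25/176 * cZ"
  proof -
    have "36 / (64 * (33/50) * (1 + \<beta>)) \<le> 36 / (64 * (33/50) * \<beta>)"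
      using beta_pos by (intro divide_left_mono) simp_all
    then have "36 / (64 * (33/50) * (1 + \<beta>)) \<le> 25/176 * c" by (simp add: c)
    from mult_right_mono[OF this Z_nonneg] show ?thesis by (simp add: kap cZ_def)
  qed
  have f12: "cZ \<le> 3 * oZ"
    using mult_right_mono[of 1 "3 * \<omega>" cZ] omega_gt nn by (simp add: oZ_def cZ_def mult_ac)
  have f13: "E \<le> 3 * oE" using mult_right_mono[of 1 "3 * \<omega>" E] omega_gt by (simp add: oE_def)
  have f14: "c * (\<omega> * X / (1 + \<beta>)) \<le> 1/7 * oX"
  proof -
    have "c * (\<omega> * X / (1 + \<beta>)) \<le> 1 * (\<omega> * X / 7)"
      using c_pos c_le_1 omega_pos beta6 by (intro mult_mono divide_left_mono) simp_all
    then show ?thesis by (simp add: oX_def)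
  qed
  have f16: "(norm h)\<^sup>2 \<le> 2 * N + 2 * lX" unfolding lX_def by (rule norm_h)
  have f17: "c * (2 * N) \<le> 2 * N" using mult_right_mono[OF c_le_1, of "2 * N"] by simp
  have f18: "c * \<omega> * X \<le> oX" using mult_right_mono[OF c_le_1, of "\<omega> * X"] omega_pos by (simp add: oX_def)
  have f19: "c * \<omega> * E \<le> oE" using mult_right_mono[OF c_le_1, of "\<omega> * E"] omega_pos by (simp add: oE_def)
  have target: "comp_coef * E \<ge> \<beta> * \<omega> * hi / 2 * E + 2 * oE + T * W"
  proof -
    have "0 \<le> \<eta> * (1 + 2 * \<omega>\<^sup>2) * E + \<omega> * hi * E" using eta_pos omega_pos hi_pos by simp
    moreover have "comp_coef * E = \<beta> * \<omega> * hi / 2 * E + \<omega> * hi * E + 2 * oE + T * W + \<eta> * (1 + 2 * \<omega>\<^sup>2) * E"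
      by (simp add: comp_coef_def T_def W_def oE_def algebra_simps)
    ultimately show ?thesis by simp
  qed
  have target2: "noise_coef * (N + N') \<ge> 3 * N + 3 * N'"
  proof -
    have "0 \<le> (13 * \<eta> + 16 * \<eta> / \<phi>2) * (N + N')" using eta_pos phi2_pos by simp
    then show ?thesis by (simp add: noise_coef_def distrib_left distrib_right)
  qed
  have dr: "drift \<le> \<eta> * (- (\<beta> * \<omega>) * (x \<bullet> L x) - (\<beta> * \<omega>) * (x \<bullet> L e) - \<omega> * (x \<bullet> z)
      + (1/2 * X + 1/2 * N + Lf * X) + c * \<omega> * X + c * \<omega> * (x \<bullet> e) - oZ
      + (c * (2 * N) + 3/64 * oZ + c * (\<omega> * X / (1 + \<beta>)))
      + (1/60 * oZ + 1/120 * (c * \<omega> * X) + 1/120 * (c * \<omega> * E))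
      + 1/135 * ((norm h)\<^sup>2 + 1/2 * X + 1/2 * E)
      + (T - \<eta>) / 4 * (a \<bullet> a)
      + (33/50 * G + \<kappa>\<^sup>2 / (64 * (33/50) * (1 + \<beta>)) * Z) + (1/180 * G + 1/360 * X + 1/360 * E)
      + (1/16 * oX + 1 / (256 * (1/16) * (1 + \<beta>)) * G) + 1/3840 * G + 1/1000 * ((norm h)\<^sup>2 + G)
      - (1 - p / 2 - (1 - p) * (3/10)) * G + ((1 - p) / (4 * (3/10)) + p / 2) * (norm b)\<^sup>2
      + 1/360 * G + T / 4 * G)"
  proof -
    have e: "c * (2 * N + 3/64 * (\<omega> * Z) + \<omega> * X / (1 + \<beta>)) = c * (2 * N) + 3/64 * (c * \<omega> * Z) + c * (\<omega> * X / (1 + \<beta>))"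
      "c * \<omega> * (1/60 * Z + 1/120 * X + 1/120 * E) = 1/60 * (c * \<omega> * Z) + 1/120 * (c * \<omega> * X) + 1/120 * (c * \<omega> * E)"
      by (simp_all add: distrib_left)
    have pos: "0 < (33/50::real)" "0 < (1/16::real)" "0 < (3/10::real)" by simp_all
    show ?thesis
      using drift_le[OF pos p_def]
      unfolding j0 e oZ_def oX_def by (simp only: diff_zero mult_zero_left mult_1 add_0_right)
  qed
  have sum: "A1 + (1/2 * x2 + 1/2 * n2 + A5) + cx + A3 - zo + (cn + 3/64 * zo + X1)
      + (1/60 * zo + 1/120 * cx + 1/120 * ce) + 1/135 * (h2 + 1/2 * x2 + 1/2 * e2) + A4
      + (G1 + Z1) + (1/180 * g2 + 1/360 * x2 + 1/360 * e2) + (1/16 * xo + G3) + 1/3840 * g2 + 1/1000 * (h2 + g2)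
      - G4 + B + 1/360 * g2 + G5 \<le> - Ph + R1 + R2"
    if "A1 \<le> - (3/4 * gx) + ge + 1/3 * zo" "A3 \<le> 1/7 * xo + 7/4 * eo"
      "A4 \<le> 1/2 * ty + tw + 5/4 * tv + 10/48 * n2 + 10/48 * lx" "5/4 * tv \<le> 5/48 * zo"
      "A5 \<le> 1/50 * gx + 25/672 * xo"
      "G1 + 1/180 * g2 + G3 + 1/3840 * g2 + 1/1000 * g2 - G4 + 1/360 * g2 + G5 \<le> 0"
      "B \<le> 35/12 * n3 + 7/6 * lx" "Ph \<le> 11/52 * xo + 3/8 * zo - 1/8 * zc + 3/104 * zo"
      "ty + 9/4 * xo + x2 + 5/2 * lx \<le> gx" "0 \<le> ty"
      "Z1 \<le> 25/176 * zc" "zc \<le> 3 * zo" "e2 \<le> 3 * eo" "X1 \<le> 1/7 * xo"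
      "h2 \<le> 2 * n2 + 2 * lx" "cn \<le> 2 * n2" "cx \<le> xo" "ce \<le> eo"
      "ge + 2 * eo + tw \<le> R1" "3 * n2 + 3 * n3 \<le> R2"
      "0 \<le> lx" "0 \<le> n2" "0 \<le> n3" "0 \<le> xo" "0 \<le> eo" "0 \<le> x2" "0 \<le> zo" "0 \<le> zc"
    for A1 A3 A4 A5 x2 n2 n3 xo zo zc X1 eo cx ce cn h2 e2 G1 Z1 g2 G3 G4 B G5 Ph R1 R2 gx ge ty tw tv lx :: real
    using that by argo
  show ?thesis
    by (rule order_trans[OF dr], rule mult_left_mono,
        rule sum[OF f1 f3 f4 f4' f5 f6 f7 f8 f9 f9' f11 f12 f13 f14 f16 f17 f18 f19 target target2])
      (use nn eta_pos in simp_all)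
qed

end

section \<open>Smooth functions\<close>

text \<open>The Riesz representation of the derivative shows that the definite description defining the gradient denotes.\<close>

lemma GDERIV_gradient:
  fixes f :: "'a::euclidean_space \<Rightarrow> real"
  assumes "f differentiable (at x)"
  shows "GDERIV f x :> gradient f x"
proof -
  obtain f' where f': "(f has_derivative f') (at x)" using assms by (auto simp: differentiable_def)
  then have lin: "linear f'" by (rule has_derivative_linear)
  define D where "D = (\<Sum>b\<in>Basis. f' b *\<^sub>R b)"
  have "f' h = h \<bullet> D" for h
  proof -
    have "f' h = f' (\<Sum>b\<in>Basis. (h \<bullet> b) *\<^sub>R b)" by (simp add: euclidean_representation)
    also have "\<dots> = (\<Sum>b\<in>Basis. (h \<bullet> b) * f' b)" using lin by (simp add: linear_sum linear_scale)
    also have "\<dots> = h \<bullet> D" by (simp add: D_def inner_sum_right mult.commute)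
    finally show ?thesis .
  qed
  then have "f' = (\<lambda>h. h \<bullet> D)" by (rule ext)
  then have D: "GDERIV f x :> D" using f' by (simp add: gderiv_def)
  have uniq: "D' = D" if "GDERIV f x :> D'" for D'
  proof -
    have "(\<lambda>h. h \<bullet> D') = (\<lambda>h. h \<bullet> D)" using that D unfolding gderiv_def by (rule has_derivative_unique)
    then have "h \<bullet> D' = h \<bullet> D" for h by (rule fun_cong)
    then show ?thesis by (metis vector_eq_ldot)
  qed
  have "gradient f x = D" unfolding gradient_def by (rule the_equality[where P = "gderiv f x", OF D]) (rule uniq)
  then show ?thesis using D by simp
qed

lemma gradient_eqI:
  fixes f :: "'a::euclidean_space \<Rightarrow> real"
  assumes "GDERIV f x :> D"
  shows "gradient f x = D"
proof -
  have "f differentiable (at x)" using assms by (auto simp: gderiv_def differentiable_def)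
  from GDERIV_gradient[OF this] assms have "(\<lambda>h. h \<bullet> gradient f x) = (\<lambda>h. h \<bullet> D)"
    unfolding gderiv_def by (rule has_derivative_unique)
  then have "h \<bullet> gradient f x = h \<bullet> D" for h by (rule fun_cong)
  then show ?thesis by (metis vector_eq_ldot)
qed

text \<open>Along the segment from \<open>x\<close> to \<open>y\<close>, the difference of the two sides has a derivative of constant sign.\<close>

lemma L_smooth_descent:
  fixes f :: "'a::euclidean_space \<Rightarrow> real"
  assumes "L_smooth Lf f"
  shows "f y \<le> f x + gradient f x \<bullet> (y - x) + Lf / 2 * (norm (y - x))\<^sup>2"
proof -
  define v where "v = y - x"
  define \<psi> where "\<psi> t = f (x + t *\<^sub>R v) - t * (gradient f x \<bullet> v) - Lf / 2 * t\<^sup>2 * (norm v)\<^sup>2" for t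
  have deriv: "(\<psi> has_real_derivative (gradient f (x + t *\<^sub>R v) \<bullet> v - gradient f x \<bullet> v - Lf * t * (norm v)\<^sup>2)) (at t)" for t
  proof -
    have "(f has_derivative (\<lambda>h. h \<bullet> gradient f (x + t *\<^sub>R v))) (at (x + t *\<^sub>R v))"
      using assms GDERIV_gradient unfolding L_smooth_def gderiv_def by blast
    then have "((\<lambda>t. f (x + t *\<^sub>R v)) has_derivative (\<lambda>s. (s *\<^sub>R v) \<bullet> gradient f (x + t *\<^sub>R v))) (at t)"
      by (rule has_derivative_compose[rotated]) (auto intro!: derivative_eq_intros)
    then have "((\<lambda>t. f (x + t *\<^sub>R v)) has_real_derivative (gradient f (x + t *\<^sub>R v) \<bullet> v)) (at t)"
      by (rule has_derivative_imp_has_field_derivative) (simp add: inner_commute mult.commute)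
    then show ?thesis unfolding \<psi>_def by (auto intro!: derivative_eq_intros)
  qed
  have "\<psi> 1 \<le> \<psi> 0"
  proof (rule DERIV_nonpos_imp_nonincreasing[of 0 1 \<psi>])
    fix t :: real assume t: "0 \<le> t" "t \<le> 1"
    have "(gradient f (x + t *\<^sub>R v) - gradient f x) \<bullet> v \<le> norm (gradient f (x + t *\<^sub>R v) - gradient f x) * norm v"
      by (rule norm_cauchy_schwarz)
    also have "\<dots> \<le> (Lf * norm (t *\<^sub>R v)) * norm v"
      using assms unfolding L_smooth_def by (intro mult_right_mono) (metis add_diff_cancel_left', simp)
    also have "\<dots> = Lf * t * (norm v)\<^sup>2" using t by (simp add: power2_eq_square)
    finally have "gradient f (x + t *\<^sub>R v) \<bullet> v - gradient f x \<bullet> v - Lf * t * (norm v)\<^sup>2 \<le> 0"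
      by (simp add: inner_diff_left)
    then show "\<exists>y. (\<psi> has_real_derivative y) (at t) \<and> y \<le> 0" using deriv by blast
  qed simp
  then show ?thesis by (simp add: \<psi>_def v_def)
qed

lemma GDERIV_avg_fun:
  fixes f :: "'n::finite \<Rightarrow> 'a::euclidean_space \<Rightarrow> real"
  assumes "\<And>i. L_smooth Lf (f i)"
  shows "GDERIV (avg_fun f) x :> (1 / real CARD('n)) *\<^sub>R (\<Sum>i\<in>UNIV. gradient (f i) x)"
proof -
  have "(f i has_derivative (\<lambda>h. h \<bullet> gradient (f i) x)) (at x)" for i
    using assms[of i] GDERIV_gradient unfolding L_smooth_def gderiv_def by blast
  then have "((\<lambda>x. (1 / real CARD('n)) * (\<Sum>i\<in>UNIV. f i x)) has_derivative
      (\<lambda>h. (1 / real CARD('n)) * (\<Sum>i\<in>UNIV. h \<bullet> gradient (f i) x))) (at x)"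
    by (intro has_derivative_mult_right has_derivative_sum)
  then show ?thesis
    unfolding gderiv_def avg_fun_def by (simp add: inner_sum_right)
qed

lemma gradient_avg_fun:
  fixes f :: "'n::finite \<Rightarrow> 'a::euclidean_space \<Rightarrow> real"
  assumes "\<And>i. L_smooth Lf (f i)"
  shows "gradient (avg_fun f) x = (1 / real CARD('n)) *\<^sub>R (\<Sum>i\<in>UNIV. gradient (f i) x)"
  by (rule gradient_eqI[OF GDERIV_avg_fun[OF assms]])

lemma L_smooth_avg_fun:
  fixes f :: "'n::finite \<Rightarrow> 'a::euclidean_space \<Rightarrow> real"
  assumes "\<And>i. L_smooth Lf (f i)"
  shows "L_smooth Lf (avg_fun f)"
  unfolding L_smooth_def
proof (intro conjI allI)
  show "avg_fun f differentiable (at x)" for x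
  proof -
    have "GDERIV (avg_fun f) x :> (1 / real CARD('n)) *\<^sub>R (\<Sum>i\<in>UNIV. gradient (f i) x)"
      by (rule GDERIV_avg_fun[OF assms])
    then show ?thesis by (auto simp: gderiv_def differentiable_def)
  qed
  fix x y
  have "gradient (avg_fun f) x - gradient (avg_fun f) y
      = (1 / real CARD('n)) *\<^sub>R (\<Sum>i\<in>UNIV. gradient (f i) x - gradient (f i) y)"
    by (simp add: gradient_avg_fun[OF assms] sum_subtractf scaleR_diff_right)
  also have "norm \<dots> \<le> (1 / real CARD('n)) * (\<Sum>i\<in>(UNIV::'n set). Lf * norm (x - y))"
    unfolding norm_scaleR using assms unfolding L_smooth_def
    by (intro mult_mono sum_norm_le) (auto intro: sum_nonneg)
  finally show "norm (gradient (avg_fun f) x - gradient (avg_fun f) y) \<le> Lf * norm (x - y)" by simp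
qed

lemma continuous_gradient:
  fixes f :: "'a::euclidean_space \<Rightarrow> real"
  assumes "L_smooth Lf f"
  shows "continuous_on UNIV (gradient f)"
proof -
  have "(max Lf 0)-lipschitz_on UNIV (gradient f)"
  proof (rule lipschitz_onI)
    fix x y
    have "norm (gradient f x - gradient f y) \<le> Lf * norm (x - y)" using assms by (simp add: L_smooth_def)
    also have "\<dots> \<le> max Lf 0 * norm (x - y)" by (intro mult_right_mono) simp_all
    finally show "dist (gradient f x) (gradient f y) \<le> max Lf 0 * dist x y" by (simp add: dist_norm)
  qed simp
  then show ?thesis by (rule lipschitz_on_continuous_on)
qed

section \<open>Spectral decomposition of the Laplacian\<close>

lemma inner_matrix_mult:
  fixes A :: "real^'n^'m" and X :: "real^'d^'n" and Y :: "real^'d^'m"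
  shows "(A ** X) \<bullet> Y = X \<bullet> (transpose A ** Y)"
proof -
  have "(A ** X) \<bullet> Y = (\<Sum>i\<in>UNIV. \<Sum>k\<in>UNIV. \<Sum>j\<in>UNIV. A$i$j * X$j$k * Y$i$k)"
    by (simp add: inner_vec_def matrix_matrix_mult_def sum_distrib_right)
  also have "\<dots> = (\<Sum>k\<in>UNIV. \<Sum>i\<in>UNIV. \<Sum>j\<in>UNIV. A$i$j * X$j$k * Y$i$k)" by (rule sum.swap)
  also have "\<dots> = (\<Sum>k\<in>UNIV. \<Sum>j\<in>UNIV. \<Sum>i\<in>UNIV. A$i$j * X$j$k * Y$i$k)"
    by (intro sum.cong refl sum.swap)
  also have "\<dots> = (\<Sum>j\<in>UNIV. \<Sum>k\<in>UNIV. \<Sum>i\<in>UNIV. A$i$j * X$j$k * Y$i$k)" by (rule sum.swap)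
  also have "\<dots> = X \<bullet> (transpose A ** Y)"
    by (simp add: inner_vec_def matrix_matrix_mult_def transpose_def sum_distrib_left mult_ac)
  finally show ?thesis .
qed

text \<open>The functions of the Laplacian: \<open>d = lam\<close> gives \<open>L\<close>, \<open>d = 1\<close> the projection \<open>K\<close> and \<open>d = 1 / lam\<close> the pseudo-inverse.\<close>

definition spectral_matrix :: "real^'m^'n \<Rightarrow> real^'m \<Rightarrow> real^'n^'n" where
  "spectral_matrix R d = R ** diag_matrix d ** transpose R"

lemma diag_matrix_mult: "(diag_matrix d ** X) $ j = d $ j *\<^sub>R X $ j"
  by (simp add: diag_matrix_def matrix_matrix_mult_def vec_eq_iff if_distrib[of "\<lambda>x. x * _"] cong: if_cong)

lemma diag_matrix_mult_diag: "diag_matrix d ** diag_matrix e = diag_matrix (\<chi> j. d $ j * e $ j)"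
  by (simp add: vec_eq_iff diag_matrix_mult) (simp add: diag_matrix_def)

lemma transpose_diag_matrix: "transpose (diag_matrix d) = diag_matrix d"
  by (auto simp: diag_matrix_def transpose_def vec_eq_iff)

lemma transpose_spectral_matrix: "transpose (spectral_matrix R d) = spectral_matrix R d"
  by (simp add: spectral_matrix_def matrix_transpose_mul transpose_diag_matrix matrix_mul_assoc)

lemma inner_spectral_matrix:
  fixes X Y :: "real^'d^'n"
  shows "X \<bullet> (spectral_matrix R d ** Y) = (\<Sum>j\<in>UNIV. d $ j * ((transpose R ** X) $ j \<bullet> (transpose R ** Y) $ j))"
proof -
  have "X \<bullet> (spectral_matrix R d ** Y) = (R ** (diag_matrix d ** (transpose R ** Y))) \<bullet> X"
    by (simp add: spectral_matrix_def matrix_mul_assoc inner_commute)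
  also have "\<dots> = (diag_matrix d ** (transpose R ** Y)) \<bullet> (transpose R ** X)" by (rule inner_matrix_mult)
  also have "\<dots> = (\<Sum>j\<in>UNIV. d $ j * ((transpose R ** X) $ j \<bullet> (transpose R ** Y) $ j))"
    by (subst inner_vec_def) (simp add: diag_matrix_mult inner_commute)
  finally show ?thesis .
qed

lemma spectral_matrix_mult:
  assumes "transpose R ** R = mat 1"
  shows "spectral_matrix R d ** spectral_matrix R e = spectral_matrix R (\<chi> j. d $ j * e $ j)"
proof -
  have "spectral_matrix R d ** spectral_matrix R e = R ** diag_matrix d ** (transpose R ** R) ** diag_matrix e ** transpose R"
    by (simp add: spectral_matrix_def matrix_mul_assoc)
  then show ?thesis
    by (simp add: assms spectral_matrix_def matrix_mul_assoc[symmetric] diag_matrix_mult_diag[symmetric])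
qed

lemma sum_option:
  fixes g :: "'m::finite option \<Rightarrow> real"
  shows "(\<Sum>c\<in>UNIV. g c) = g None + (\<Sum>j\<in>UNIV. g (Some j))"
  by (simp add: UNIV_option_conv sum.reindex)

context
  fixes L :: "real^'n^'n" and R :: "real^'m^'n" and lam :: "real^'m"
  assumes dec: "laplacian_decomposition L R lam"
begin

lemma R_orthonormal: "transpose R ** R = mat 1"
proof -
  have "(transpose (rho_R R) ** rho_R R) $ Some j $ Some k = (mat 1 :: real^('m option)^('m option)) $ Some j $ Some k" for j k
    using dec by (simp add: laplacian_decomposition_def)
  then show ?thesis
    by (simp add: vec_eq_iff matrix_matrix_mult_def transpose_def rho_R_def mat_def)
qed

lemma R_transpose_R: "R ** transpose R = K_matrix"
proof -
  have "(rho_R R ** transpose (rho_R R)) $ i $ k = (mat 1 :: real^'n^'n) $ i $ k" for i k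
    using dec by (simp add: laplacian_decomposition_def)
  then have "(rho_vec :: real^'n) $ i * (rho_vec :: real^'n) $ k + (\<Sum>j\<in>UNIV. R $ i $ j * R $ k $ j) = (mat 1 :: real^'n^'n) $ i $ k" for i k
    by (simp add: matrix_matrix_mult_def transpose_def rho_R_def sum_option)
  moreover have "(rho_vec :: real^'n) $ i * (rho_vec :: real^'n) $ k = 1 / real CARD('n)" for i k
    by (simp add: rho_vec_def)
  ultimately have "(\<Sum>j\<in>UNIV. R $ i $ j * R $ k $ j) = (mat 1 :: real^'n^'n) $ i $ k - 1 / real CARD('n)" for i k
    by (metis add_diff_cancel_left')
  then show ?thesis
    by (simp add: vec_eq_iff matrix_matrix_mult_def transpose_def K_matrix_def outer_product_def)
qed

lemma K_spectral: "K_matrix = spectral_matrix R (\<chi> j. 1)"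
proof -
  have "diag_matrix (\<chi> j. 1) = (mat 1 :: real^'m^'m)" by (simp add: diag_matrix_def mat_def vec_eq_iff)
  then show ?thesis by (simp add: spectral_matrix_def R_transpose_R)
qed

lemma L_spectral: "L = spectral_matrix R lam"
  using dec by (simp add: laplacian_decomposition_def spectral_matrix_def)

lemma lam_pos: "0 < lam $ j"
  using dec by (simp add: laplacian_decomposition_def)

text \<open>An eigenvector for \<open>z\<close> distinct from \<open>0\<close> and all \<open>lam\<^sub>j\<close> is orthogonal to every column of \<open>R\<close>, hence annihilated by
  \<open>L\<close>. The field is arbitrary because the smallest positive eigenvalue is taken over the reals and the
  spectral radius over the complex numbers.\<close>

lemma eigenvalues_subset:
  "eigenvalues (\<chi> i k. (of_real (L $ i $ k) :: 'f::{field, real_algebra_1})) \<subseteq> insert 0 (range (\<lambda>j. of_real (lam $ j)))"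
proof
  fix z :: 'f assume "z \<in> eigenvalues (\<chi> i k. of_real (L $ i $ k))"
  then obtain v :: "'f^'n" where v: "v \<noteq> 0" "\<And>i. (\<Sum>k\<in>UNIV. of_real (L $ i $ k) * v $ k) = z * v $ i"
    by (auto simp: eigenvalues_def matrix_vector_mult_def vec_eq_iff)
  show "z \<in> insert 0 (range (\<lambda>j. of_real (lam $ j)))"
  proof (rule ccontr)
    assume z: "z \<notin> insert 0 (range (\<lambda>j. of_real (lam $ j)))"
    have LR: "(\<Sum>i\<in>UNIV. R $ i $ j * L $ i $ k) = lam $ j * R $ k $ j" for j k
    proof -
      have "transpose R ** L = diag_matrix lam ** transpose R"
        by (simp add: L_spectral spectral_matrix_def matrix_mul_assoc R_orthonormal)
      then have "(transpose R ** L) $ j $ k = (diag_matrix lam ** transpose R) $ j $ k" by simp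
      then show ?thesis by (simp add: diag_matrix_mult) (simp add: matrix_matrix_mult_def transpose_def)
    qed
    have zero: "(\<Sum>i\<in>UNIV. of_real (R $ i $ j) * v $ i) = 0" for j
    proof -
      have "z * (\<Sum>i\<in>UNIV. of_real (R $ i $ j) * v $ i)
          = (\<Sum>i\<in>UNIV. of_real (R $ i $ j) * (\<Sum>k\<in>UNIV. of_real (L $ i $ k) * v $ k))"
        by (simp only: v(2) sum_distrib_left mult.left_commute)
      also have "\<dots> = (\<Sum>k\<in>UNIV. \<Sum>i\<in>UNIV. of_real (R $ i $ j * L $ i $ k) * v $ k)"
        by (subst sum.swap) (simp add: sum_distrib_left mult_ac)
      also have "\<dots> = (\<Sum>k\<in>UNIV. of_real (\<Sum>i\<in>UNIV. R $ i $ j * L $ i $ k) * v $ k)"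
        by (simp add: sum_distrib_right)
      also have "\<dots> = of_real (lam $ j) * (\<Sum>i\<in>UNIV. of_real (R $ i $ j) * v $ i)"
        by (simp add: LR sum_distrib_left mult_ac)
      finally show ?thesis using z by auto
    qed
    have mean0: "z * v $ i = 0" for i
    proof -
      have "z * v $ i = (\<Sum>k\<in>UNIV. of_real (L $ i $ k) * v $ k)" by (simp add: v(2))
      also have "\<dots> = (\<Sum>k\<in>UNIV. \<Sum>j\<in>UNIV. of_real (R $ i $ j * lam $ j) * (of_real (R $ k $ j) * v $ k))"
      proof (rule sum.cong[OF refl])
        fix k
        have "L $ i $ k = (R ** (diag_matrix lam ** transpose R)) $ i $ k"
          by (simp add: L_spectral spectral_matrix_def matrix_mul_assoc)
        also have "\<dots> = (\<Sum>j\<in>UNIV. R $ i $ j * (lam $ j * R $ k $ j))"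
          by (subst matrix_matrix_mult_def) (simp add: diag_matrix_mult, simp add: transpose_def)
        finally show "of_real (L $ i $ k) * v $ k = (\<Sum>j\<in>UNIV. of_real (R $ i $ j * lam $ j) * (of_real (R $ k $ j) * v $ k))"
          by (simp add: sum_distrib_left sum_distrib_right mult_ac)
      qed
      also have "\<dots> = (\<Sum>j\<in>UNIV. of_real (R $ i $ j * lam $ j) * (\<Sum>k\<in>UNIV. of_real (R $ k $ j) * v $ k))"
        by (subst sum.swap) (simp add: sum_distrib_left)
      finally show ?thesis by (simp add: zero)
    qed
    then have "v = 0" using z by (auto simp: vec_eq_iff)
    then show False using v(1) by simp
  qed
qed

lemma lam_eigenvalue: "(of_real (lam $ j) :: 'f::{field, real_algebra_1}) \<in> eigenvalues (\<chi> i k. of_real (L $ i $ k))"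
proof -
  define v :: "'f^'n" where "v = (\<chi> i. of_real (R $ i $ j))"
  have LR: "L ** R = R ** diag_matrix lam"
    by (simp add: L_spectral spectral_matrix_def matrix_mul_assoc[symmetric] R_orthonormal)
  have "(\<Sum>k\<in>UNIV. L $ i $ k * R $ k $ j) = lam $ j * R $ i $ j" for i
  proof -
    have "(\<Sum>k\<in>UNIV. L $ i $ k * R $ k $ j) = (L ** R) $ i $ j" by (simp add: matrix_matrix_mult_def)
    also have "\<dots> = lam $ j * R $ i $ j"
      unfolding LR by (simp add: matrix_matrix_mult_def diag_matrix_def if_distrib mult.commute cong: if_cong)
    finally show ?thesis .
  qed
  then have "(\<Sum>k\<in>UNIV. of_real (L $ i $ k) * v $ k) = of_real (lam $ j) * v $ i" for i
    unfolding v_def by (simp flip: of_real_mult of_real_sum)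
  moreover have "v \<noteq> 0"
  proof
    assume "v = 0"
    then have "R $ i $ j = 0" for i by (simp add: v_def vec_eq_iff)
    then have "(transpose R ** R) $ j $ j = 0" by (simp add: matrix_matrix_mult_def transpose_def)
    then show False by (simp add: R_orthonormal mat_def)
  qed
  ultimately show ?thesis
    by (auto simp: eigenvalues_def matrix_vector_mult_def vec_eq_iff intro!: exI[of _ v])
qed

lemma min_pos_eigenvalue:
  shows "min_pos_eigenvalue L \<le> lam $ j" "0 < min_pos_eigenvalue L"
proof -
  have ev: "(\<chi> i k. of_real (L $ i $ k)) = L" by (simp add: vec_eq_iff)
  have sub: "eigenvalues L \<subseteq> insert 0 (range (($) lam))" using eigenvalues_subset[where 'f=real] unfolding ev by auto
  have fin: "finite {z \<in> eigenvalues L. 0 < z}" by (rule finite_subset[of _ "insert 0 (range (($) lam))"]) (use sub in auto)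
  have mem: "lam $ k \<in> {z \<in> eigenvalues L. 0 < z}" for k
    using lam_eigenvalue[where 'f=real, of k] lam_pos unfolding ev by simp
  show "min_pos_eigenvalue L \<le> lam $ j" unfolding min_pos_eigenvalue_def using fin mem by (intro Min_le)
  have "Min {z \<in> eigenvalues L. 0 < z} \<in> {z \<in> eigenvalues L. 0 < z}" using fin mem by (intro Min_in) auto
  then show "0 < min_pos_eigenvalue L" unfolding min_pos_eigenvalue_def by simp
qed

lemma lam_le_spectral_radius: "lam $ j \<le> spectral_radius L"
proof -
  have fin: "finite (cmod ` eigenvalues (\<chi> i k. complex_of_real (L $ i $ k)))"
    by (intro finite_imageI finite_subset[OF eigenvalues_subset]) simp
  have "cmod (of_real (lam $ j)) \<in> cmod ` eigenvalues (\<chi> i k. complex_of_real (L $ i $ k))"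
    using lam_eigenvalue by (rule imageI)
  then have "cmod (of_real (lam $ j)) \<le> spectral_radius L"
    unfolding spectral_radius_def using fin by (intro Max_ge)
  then show ?thesis using lam_pos[of j] by simp
qed

end

lemma linear_matrix_mult: "linear (\<lambda>X :: real^'d^'n. (A :: real^'n^'m) ** X)"
  by (rule linearI) (simp_all add: vec_eq_iff matrix_matrix_mult_def distrib_left sum.distrib sum_distrib_left mult.left_commute)

text \<open>In the coordinates given by the columns of \<open>R\<close> all operators are diagonal, so that every operator inequality is an
  inequality between their diagonal entries.\<close>

lemma laplacian_operators_spectral:
  fixes L :: "real^'n^'n" and R :: "real^'m^'n"
  assumes dec: "laplacian_decomposition L R lam"
  shows "laplacian_operators (\<lambda>X :: real^'d^'n. K_matrix ** X) (\<lambda>X. L ** X)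
    (\<lambda>X. spectral_matrix R (\<chi> j. 1 / lam $ j) ** X) (min_pos_eigenvalue L) (spectral_radius L)"
proof -
  define S where "S d X = spectral_matrix R d ** X" for d and X :: "real^'d^'n"
  define coef where "coef X j = (norm ((transpose R ** X) $ j))\<^sup>2" for X :: "real^'d^'n" and j
  have coef0: "0 \<le> coef X j" for X j by (simp add: coef_def)
  have S_adj: "S d X \<bullet> Y = X \<bullet> S d Y" for d and X Y :: "real^'d^'n"
    by (simp add: S_def inner_matrix_mult transpose_spectral_matrix)
  have S_S: "S d (S e X) = S (\<chi> j. d $ j * e $ j) X" for d e and X :: "real^'d^'n"
    by (simp add: S_def matrix_mul_assoc spectral_matrix_mult[OF R_orthonormal[OF dec]])
  have form: "X \<bullet> S d X = (\<Sum>j\<in>UNIV. d $ j * coef X j)" for d and X :: "real^'d^'n"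
    by (simp add: S_def inner_spectral_matrix coef_def power2_norm_eq_inner)
  have nrm: "(norm (S d X))\<^sup>2 = (\<Sum>j\<in>UNIV. (d $ j)\<^sup>2 * coef X j)" for d and X :: "real^'d^'n"
  proof -
    have "(norm (S d X))\<^sup>2 = X \<bullet> S d (S d X)" by (simp add: power2_norm_eq_inner S_adj)
    also have "\<dots> = (\<Sum>j\<in>UNIV. (d $ j)\<^sup>2 * coef X j)" by (simp add: S_S form power2_eq_square)
    finally show ?thesis .
  qed
  define one :: "real^'m" where "one = (\<chi> j. 1)"
  define inv :: "real^'m" where "inv = (\<chi> j. 1 / lam $ j)"
  have K: "(\<lambda>X :: real^'d^'n. K_matrix ** X) = S one" by (simp add: fun_eq_iff S_def K_spectral[OF dec] one_def)
  have L: "(\<lambda>X :: real^'d^'n. L ** X) = S lam" by (simp add: fun_eq_iff S_def L_spectral[OF dec, symmetric])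
  have P: "(\<lambda>X :: real^'d^'n. spectral_matrix R (\<chi> j. 1 / lam $ j) ** X) = S inv" by (simp add: fun_eq_iff S_def inv_def)
  have lam0: "lam $ j \<noteq> 0" for j using lam_pos[OF dec, of j] by simp
  note lo = min_pos_eigenvalue[OF dec] and hi = lam_le_spectral_radius[OF dec] and lp = lam_pos[OF dec]
  have mults: "(\<chi> j. one $ j * one $ j) = one" "(\<chi> j. one $ j * lam $ j) = lam" "(\<chi> j. lam $ j * one $ j) = lam"
    "(\<chi> j. one $ j * inv $ j) = inv" "(\<chi> j. inv $ j * lam $ j) = one" "(\<chi> j. lam $ j * inv $ j) = one"
    using lam0 by (simp_all add: one_def inv_def vec_eq_iff)
  show ?thesis unfolding K L P
  proof (rule laplacian_operators.intro)
    show "linear (S one)" "linear (S lam)" "linear (S inv)" unfolding S_def by (rule linear_matrix_mult)+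
    show "S one X \<bullet> Y = X \<bullet> S one Y" "S lam X \<bullet> Y = X \<bullet> S lam Y" "S inv X \<bullet> Y = X \<bullet> S inv Y" for X Y :: "real^'d^'n"
      by (rule S_adj)+
    show "S one (S one X) = S one X" "S one (S lam X) = S lam X" "S lam (S one X) = S lam X" "S one (S inv X) = S inv X"
      "S inv (S lam X) = S one X" "S lam (S inv X) = S one X" for X :: "real^'d^'n"
      by (simp_all only: S_S mults)
    show "0 < min_pos_eigenvalue L" by (rule lo)
    show "min_pos_eigenvalue L \<le> spectral_radius L"
      using lo(1)[of undefined] hi[of undefined] by simp
    have mono: "(\<Sum>j\<in>UNIV. d j * coef X j) \<le> (\<Sum>j\<in>UNIV. e j * coef X j)" if "\<And>j. d j \<le> e j" for d e and X :: "real^'d^'n"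
      by (intro sum_mono mult_right_mono that coef0)
    fix X :: "real^'d^'n"
    have one1: "one $ j = 1" "inv $ j = 1 / lam $ j" for j by (simp_all add: one_def inv_def)
    show "min_pos_eigenvalue L * (norm (S one X))\<^sup>2 \<le> X \<bullet> S lam X"
      unfolding nrm form sum_distrib_left mult.assoc[symmetric] by (rule mono) (simp add: one1 lo)
    show "(norm (S lam X))\<^sup>2 \<le> (spectral_radius L)\<^sup>2 * (norm (S one X))\<^sup>2"
      unfolding nrm form sum_distrib_left mult.assoc[symmetric]
      by (rule mono) (use hi lp in \<open>simp add: one1 power_mono less_imp_le\<close>)
    show "X \<bullet> S lam X \<le> spectral_radius L * (norm (S one X))\<^sup>2"
      unfolding nrm form sum_distrib_left mult.assoc[symmetric] by (rule mono) (simp add: one1 hi)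
    show "(norm (S one X))\<^sup>2 \<le> spectral_radius L * (X \<bullet> S inv X)"
      unfolding nrm form sum_distrib_left mult.assoc[symmetric] by (rule mono) (use hi lp in \<open>simp add: one1\<close>)
    show "min_pos_eigenvalue L * (norm (S inv X))\<^sup>2 \<le> X \<bullet> S inv X"
      unfolding nrm form sum_distrib_left mult.assoc[symmetric]
    proof (rule mono)
      fix j
      have "min_pos_eigenvalue L * (1 / lam $ j * (1 / lam $ j)) \<le> lam $ j * (1 / lam $ j * (1 / lam $ j))"
        using lo(1)[of j] by (intro mult_right_mono) simp_all
      then show "min_pos_eigenvalue L * (inv $ j)\<^sup>2 \<le> inv $ j" using lam0[of j] by (simp add: one1 power2_eq_square)
    qed
  qed
qed

lemma K_matrix_mult: "(K_matrix ** X) $ i = X $ i - mean (X :: real^'d^'n)"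
proof -
  have "(K_matrix ** X) $ i $ k = X $ i $ k - mean X $ k" for k
  proof -
    have "(K_matrix ** X) $ i $ k = (\<Sum>j\<in>UNIV. (if i = j then X $ j $ k else 0) - (1 / real CARD('n)) * X $ j $ k)"
      unfolding matrix_matrix_mult_def
      by (auto simp: K_matrix_def mat_def outer_product_def algebra_simps intro!: sum.cong)
    also have "\<dots> = X $ i $ k - mean X $ k"
      by (simp add: sum_subtractf mean_def sum_component sum_distrib_left)
    finally show ?thesis .
  qed
  then show ?thesis by (simp add: vec_eq_iff)
qed

lemma mean_K_matrix: "K_matrix ** X = X \<Longrightarrow> mean (X :: real^'d^'n) = 0"
  using K_matrix_mult[of X undefined] by simp

lemma mean_add: "mean (X + Y) = mean X + mean (Y :: real^'d^'n)"
  by (simp add: mean_def sum.distrib scaleR_add_right)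

lemma mean_diff: "mean (X - Y) = mean X - mean (Y :: real^'d^'n)"
  by (simp add: mean_def sum_subtractf scaleR_diff_right)

lemma mean_scaleR: "mean (c *\<^sub>R X) = c *\<^sub>R mean (X :: real^'d^'n)"
  by (simp add: mean_def scaleR_sum_right)

lemma norm_vec_sq: "(norm (X :: real^'d^'n))\<^sup>2 = (\<Sum>i\<in>UNIV. (norm (X $ i))\<^sup>2)"
  by (simp add: power2_norm_eq_inner inner_vec_def[of X X])

lemma norm_constant_sq: "(norm (\<chi> i::'n::finite. v))\<^sup>2 = real CARD('n) * (norm (v :: real^'d))\<^sup>2"
  by (simp add: norm_vec_sq)

lemma inner_constant: "(\<chi> i::'n::finite. v) \<bullet> (\<chi> i. w) = real CARD('n) * ((v :: real^'d) \<bullet> w)"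
  by (subst inner_vec_def) simp

lemma complement_K_matrix: "X - K_matrix ** X = (\<chi> i. mean (X :: real^'d^'n))"
  by (rule vec_eq_iff[THEN iffD2]) (simp add: K_matrix_mult)

section \<open>One step of the algorithm\<close>

text \<open>The deterministic data of the problem, together with the conditions on the parameters.\<close>

locale cpsgd_problem =
  admissible_parameters "min_pos_eigenvalue L" "spectral_radius L" Lf \<phi>2 \<beta> \<omega> \<eta> \<tau>
  for L :: "real^'n^'n" and Lf \<phi>2 \<beta> \<omega> \<eta> \<tau> :: real +
  fixes R :: "real^'m^'n" and lam :: "real^'m" and f :: "'n \<Rightarrow> real^'d \<Rightarrow> real" and \<nu> :: real
  assumes dec: "laplacian_decomposition L R lam"
    and smooth: "\<And>i. L_smooth Lf (f i)"
    and bdd: "bdd_below (range (avg_fun f))"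
    and PL: "\<And>x. 1/2 * (norm (gradient (avg_fun f) x))\<^sup>2 \<ge> \<nu> * (avg_fun f x - inf_value (avg_fun f))"
    and rate_PL: "(1/2 + \<beta>) * \<tau> \<le> \<nu> / 2"
begin

abbreviation Kop :: "real^'d^'n \<Rightarrow> real^'d^'n" where "Kop \<equiv> (\<lambda>X. K_matrix ** X)"
abbreviation Lop :: "real^'d^'n \<Rightarrow> real^'d^'n" where "Lop \<equiv> (\<lambda>X. L ** X)"
abbreviation Pop :: "real^'d^'n \<Rightarrow> real^'d^'n" where "Pop \<equiv> (\<lambda>X. spectral_matrix R (\<chi> j. 1 / lam $ j) ** X)"

sublocale ops: laplacian_operators Kop Lop Pop "min_pos_eigenvalue L" "spectral_radius L"
  by (rule laplacian_operators_spectral[OF dec])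

definition gap :: "real^'d \<Rightarrow> real" where
  "gap x = avg_fun f x - inf_value (avg_fun f)"

definition dual :: "real^'d^'n \<Rightarrow> real^'d^'n \<Rightarrow> real^'d^'n" where
  "dual X V = Kop (V + (1 / \<omega>) *\<^sub>R grad_at_mean f X)"

text \<open>The threshold \<open>6\<close> lets both estimates of the drift succeed: below it \<open>\<kappa> = 1 + \<beta>\<close> is small enough, and above it
  \<open>\<kappa> = 6\<close> is large enough for the second-order terms in \<open>z\<close>.\<close>

definition c :: real where "c = (if \<beta> \<le> 6 then 1 else 6 / \<beta>)"
definition j :: real where "j = (if \<beta> \<le> 6 then 1 else 0)"
definition \<kappa> :: real where "\<kappa> = j + c * \<beta>"

definition energy :: "real^'d^'n \<Rightarrow> real^'d^'n \<Rightarrow> real" where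
  "energy X V = ops.potential c \<kappa> (Kop X) (dual X V) + real CARD('n) * gap (mean X)"

lemma c_pos: "0 < c" and c_le_1: "c \<le> 1" and c_beta: "j \<le> c * \<beta>" and kappa_le: "\<kappa> \<le> 1 + \<beta>"
  using beta_gt_1 by (auto simp: c_def j_def \<kappa>_def)

lemma gap_nonneg: "0 \<le> gap x"
  unfolding gap_def inf_value_def using bdd by (simp add: cINF_lower)

lemma mean_L: "mean (L ** (X :: real^'d^'n)) = 0"
  by (rule mean_K_matrix) (rule ops.K_L)

lemma norm_gradient_deviation:
  "(norm ((\<chi> i. gradient (f i) (X $ i)) - grad_at_mean f X))\<^sup>2 \<le> Lf\<^sup>2 * (norm (Kop X))\<^sup>2"
proof -
  have "(norm ((\<chi> i. gradient (f i) (X $ i)) - grad_at_mean f X))\<^sup>2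
      = (\<Sum>i\<in>UNIV. (norm (gradient (f i) (X $ i) - gradient (f i) (mean X)))\<^sup>2)"
    by (simp add: norm_vec_sq grad_at_mean_def)
  also have "\<dots> \<le> (\<Sum>i\<in>UNIV. (Lf * norm (X $ i - mean X))\<^sup>2)"
    using smooth unfolding L_smooth_def by (intro sum_mono power_mono) auto
  also have "\<dots> = Lf\<^sup>2 * (norm (Kop X))\<^sup>2"
    by (simp add: norm_vec_sq K_matrix_mult power_mult_distrib sum_distrib_left)
  finally show ?thesis .
qed

lemma norm_gradient_at_mean_change:
  "norm (grad_at_mean f X - grad_at_mean f Y) \<le> Lf * norm ((\<chi> i. mean X - mean Y) :: real^'d^'n)"
proof (rule power2_le_imp_le)
  have "(norm (grad_at_mean f X - grad_at_mean f Y))\<^sup>2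
      = (\<Sum>i\<in>UNIV. (norm (gradient (f i) (mean X) - gradient (f i) (mean Y)))\<^sup>2)"
    by (simp add: norm_vec_sq grad_at_mean_def)
  also have "\<dots> \<le> (\<Sum>i\<in>(UNIV :: 'n set). (Lf * norm (mean X - mean Y))\<^sup>2)"
    using smooth unfolding L_smooth_def by (intro sum_mono power_mono) auto
  also have "\<dots> = (Lf * norm ((\<chi> i. mean X - mean Y) :: real^'d^'n))\<^sup>2"
    by (simp add: power_mult_distrib norm_constant_sq)
  finally show "(norm (grad_at_mean f X - grad_at_mean f Y))\<^sup>2 \<le> (Lf * norm ((\<chi> i. mean X - mean Y) :: real^'d^'n))\<^sup>2" .
  show "0 \<le> Lf * norm ((\<chi> i. mean X - mean Y) :: real^'d^'n)" using Lf_pos by simp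
qed

lemma mean_grad_at_mean: "mean (grad_at_mean f X) = gradient (avg_fun f) (mean X)"
  by (simp add: gradient_avg_fun[OF smooth] grad_at_mean_def) (simp add: mean_def)

text \<open>One step with arbitrary estimates \<open>Xh\<close> and gradients \<open>G\<close>. As \<open>V\<close> has mean zero, the mean of \<open>X\<close> moves by \<open>- \<eta>\<close> times
  the mean of \<open>G\<close>, while its disagreement part moves by \<open>- \<eta> a\<close>, so that the drift estimate applies.\<close>

lemma energy_step:
  fixes X Xc V Xh G :: "real^'d^'n"
  assumes V: "mean V = 0"
    and X': "X' = X - \<eta> *\<^sub>R ((\<beta> * \<omega>) *\<^sub>R (L ** Xh) + \<omega> *\<^sub>R V + G)"
    and V': "V' = V + (\<eta> * \<omega>) *\<^sub>R (L ** Xh)"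
    and Xc': "Xc' = Xc + D"
  shows "energy X' V' + (norm (X' - Xc'))\<^sup>2 \<le> (1 - \<eta> * \<tau>) * energy X V
    + (1 + \<phi>2 / 2) * (norm (X - Xc - D))\<^sup>2
    + \<eta> * (comp_coef * (norm (Xh - X))\<^sup>2)
    + \<eta> * (noise_coef * (norm (G - (\<chi> i. gradient (f i) (X $ i))))\<^sup>2)"
proof -
  define gt where "gt = (\<chi> i. gradient (f i) (X $ i))"
  define gb where "gb = grad_at_mean f X"
  define gb' where "gb' = grad_at_mean f X'"
  define x where "x = Kop X"
  define z where "z = dual X V"
  define e where "e = Kop (Xh - X)"
  define d where "d = Kop (gb' - gb)"
  define q where "q = G - Kop G"
  define n where "n = G - gt"
  define l where "l = gt - gb"
  note lK = ops.linear_K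
  have KV: "Kop V = V" using V by (simp add: vec_eq_iff K_matrix_mult)
  have mean_X': "mean X' - mean X = - \<eta> *\<^sub>R mean G"
    by (simp add: X' mean_diff mean_add mean_scaleR mean_L V)
  have q: "q = (\<chi> i. mean G)" by (simp add: q_def complement_K_matrix)
  interpret st: one_step Kop Lop Pop "min_pos_eigenvalue L" "spectral_radius L" Lf \<phi>2 \<beta> \<omega> \<eta> \<tau> c j \<kappa> x z e n l d q
  proof
    show "0 < c" "c \<le> 1" "j \<le> c * \<beta>" "\<kappa> \<le> 1 + \<beta>" by (rule c_pos c_le_1 c_beta kappa_le)+
    show "0 \<le> j" "j \<le> 1" by (simp_all add: j_def)
    show "\<kappa> = j + c * \<beta>" by (rule \<kappa>_def)
    show "Kop x = x" "Kop z = z" "Kop e = e" "Kop d = d"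
      by (simp_all only: x_def z_def dual_def e_def d_def ops.K_K)
    show "(norm l)\<^sup>2 \<le> Lf\<^sup>2 * (norm x)\<^sup>2"
      unfolding l_def gt_def gb_def x_def by (rule norm_gradient_deviation)
    have "norm d \<le> norm (gb' - gb)" unfolding d_def by (rule ops.norm_K_le)
    also have "\<dots> \<le> Lf * norm ((\<chi> i. mean X' - mean X) :: real^'d^'n)"
      unfolding gb'_def gb_def by (rule norm_gradient_at_mean_change)
    also have "(\<chi> i. mean X' - mean X) = - \<eta> *\<^sub>R q"
      by (simp add: mean_X' q vec_eq_iff)
    also have "Lf * norm (- \<eta> *\<^sub>R q) = \<eta> * Lf * norm q" using eta_pos by simp
    finally show "norm d \<le> \<eta> * Lf * norm q" .
  qed
  have sum_nl: "n + l = G - gb" by (simp add: n_def l_def)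
  have h: "Kop n + Kop l = Kop G - Kop gb"
    by (simp add: linear_add[OF lK, symmetric] sum_nl linear_diff[OF lK])
  have xe: "Lop (x + e) = Lop Xh"
    by (simp add: x_def e_def linear_add[OF lK, symmetric] ops.L_K)
  have a: "st.a = (\<beta> * \<omega>) *\<^sub>R Lop Xh + \<omega> *\<^sub>R V + Kop G"
    unfolding xe h using omega_pos
    by (simp add: z_def dual_def linear_add[OF lK] linear_scale[OF lK] KV gb_def algebra_simps)
  have X'_a: "X' = X - \<eta> *\<^sub>R (st.a + q)" unfolding a by (simp add: X' q_def)
  have Ka: "Kop st.a = st.a"
    unfolding a by (simp add: linear_add[OF lK] linear_scale[OF lK] ops.K_L KV ops.K_K)
  have Kq: "Kop q = 0" by (simp add: q_def linear_diff[OF lK] ops.K_K)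
  have KX': "Kop X' = x - \<eta> *\<^sub>R st.a"
  proof -
    have "Kop X' = Kop X - \<eta> *\<^sub>R (Kop st.a + Kop q)"
      unfolding X'_a
      by (simp only: linear_diff[OF lK, of X "\<eta> *\<^sub>R (st.a + q)"] linear_scale[OF lK, of \<eta> "st.a + q"]
          linear_add[OF lK, of st.a q])
    then show ?thesis by (simp only: Kq add_0_right Ka x_def[symmetric])
  qed
  have z': "dual X' V' = z + (\<eta> * \<omega>) *\<^sub>R Lop (x + e) + (1 / \<omega>) *\<^sub>R d"
    unfolding xe
    by (simp add: z_def dual_def V' d_def gb'_def gb_def linear_add[OF lK] linear_diff[OF lK] linear_scale[OF lK]
        ops.K_L scaleR_add_right scaleR_diff_right)
  have orth: "st.a \<bullet> q = 0"
  proof -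
    have "st.a \<bullet> q = Kop st.a \<bullet> q" by (simp only: Ka)
    also have "\<dots> = st.a \<bullet> Kop q" by (rule ops.adjoint_K)
    finally show ?thesis by (simp only: Kq inner_zero_right)
  qed
  have b: "q - st.b = (\<chi> i. mean gb)"
  proof -
    have "q - st.b = gb - Kop gb"
      using sum_nl h unfolding q_def by (simp add: algebra_simps)
    then show ?thesis by (simp add: complement_K_matrix)
  qed
  have mg: "mean gb = gradient (avg_fun f) (mean X)" by (simp add: gb_def mean_grad_at_mean)
  define G0 where "G0 = gradient (avg_fun f) (mean X)"
  have smooth_step: "real CARD('n) * gap (mean X') \<le> real CARD('n) * gap (mean X) - \<eta> * ((q - st.b) \<bullet> q) + \<eta>\<^sup>2 * Lf / 2 * (norm q)\<^sup>2"
  proof -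
    have "avg_fun f (mean X') \<le> avg_fun f (mean X) + G0 \<bullet> (mean X' - mean X) + Lf / 2 * (norm (mean X' - mean X))\<^sup>2"
      unfolding G0_def by (rule L_smooth_descent[OF L_smooth_avg_fun[OF smooth]])
    then have "gap (mean X') \<le> gap (mean X) - \<eta> * (G0 \<bullet> mean G) + \<eta>\<^sup>2 * Lf / 2 * (norm (mean G))\<^sup>2"
      unfolding mean_X' gap_def by (simp add: power_mult_distrib mult_ac)
    then have 1: "real CARD('n) * gap (mean X') \<le> real CARD('n)
        * (gap (mean X) - \<eta> * (G0 \<bullet> mean G) + \<eta>\<^sup>2 * Lf / 2 * (norm (mean G))\<^sup>2)"
      by (intro mult_left_mono) simp_all
    have 2: "(q - st.b) \<bullet> q = real CARD('n) * (G0 \<bullet> mean G)"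
      unfolding b mg G0_def[symmetric] unfolding q by (rule inner_constant)
    have 3: "(norm q)\<^sup>2 = real CARD('n) * (norm (mean G))\<^sup>2"
      unfolding q by (rule norm_constant_sq)
    show ?thesis using 1 unfolding 2 3 by (simp add: right_diff_distrib distrib_left mult_ac)
  qed
  have PL_step: "\<eta> * \<tau> * (real CARD('n) * gap (mean X)) \<le> \<eta> / (2 * (1 + 2 * \<beta>)) * (norm (q - st.b))\<^sup>2"
  proof -
    have "\<tau> * (1 + 2 * \<beta>) * gap (mean X) \<le> \<nu> * gap (mean X)"
      using rate_PL gap_nonneg by (intro mult_right_mono) (simp_all add: algebra_simps)
    also have "\<dots> \<le> 1/2 * (norm G0)\<^sup>2" using PL unfolding gap_def G0_def .
    finally have "\<tau> * gap (mean X) \<le> 1 / (2 * (1 + 2 * \<beta>)) * (norm G0)\<^sup>2" using beta_pos by (simp add: field_simps)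
    then have "(\<eta> * real CARD('n)) * (\<tau> * gap (mean X)) \<le> (\<eta> * real CARD('n)) * (1 / (2 * (1 + 2 * \<beta>)) * (norm G0)\<^sup>2)"
      using eta_pos by (intro mult_left_mono) simp_all
    then show ?thesis unfolding b mg G0_def[symmetric] norm_constant_sq by (simp add: mult_ac)
  qed
  have comp_step: "(norm (X' - Xc'))\<^sup>2 \<le> (1 + \<phi>2 / 2) * (norm (X - Xc - D))\<^sup>2 + (1 + 2 / \<phi>2) * \<eta>\<^sup>2 * (st.a \<bullet> st.a + (norm q)\<^sup>2)"
  proof -
    have "X' - Xc' = (X - Xc - D) + (- \<eta>) *\<^sub>R (st.a + q)" by (simp add: X'_a Xc')
    then have "(norm (X' - Xc'))\<^sup>2 \<le> (1 + \<phi>2 / 2) * (norm (X - Xc - D))\<^sup>2 + (1 + 1 / (\<phi>2 / 2)) * (norm ((- \<eta>) *\<^sub>R (st.a + q)))\<^sup>2"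
      using norm_sum_sq_le[of "\<phi>2 / 2" "X - Xc - D" "(- \<eta>) *\<^sub>R (st.a + q)"] phi2_pos by simp
    moreover
    have "(norm ((- \<eta>) *\<^sub>R (u + w)))\<^sup>2 = \<eta>\<^sup>2 * (u \<bullet> u + (norm w)\<^sup>2)" if "u \<bullet> w = 0"
      for u w :: "real^'d^'n"
      using that unfolding norm_scaleR power_mult_distrib power2_norm_eq_inner
      by (simp add: inner_add_left inner_add_right inner_commute[of w u])
    from this[OF orth] have "(norm ((- \<eta>) *\<^sub>R (st.a + q)))\<^sup>2 = \<eta>\<^sup>2 * (st.a \<bullet> st.a + (norm q)\<^sup>2)" .
    ultimately show ?thesis by (simp add: mult.assoc)
  qed
  have drift: "st.drift \<le> \<eta> * (- (\<tau> * ops.potential c \<kappa> x z) + comp_coef * (norm e)\<^sup>2 + noise_coef * ((norm (Kop n))\<^sup>2 + (norm (n - Kop n))\<^sup>2))"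
  proof (cases "\<beta> \<le> 6")
    case True
    show ?thesis
      by (rule st.drift_small_beta[OF True]) (simp_all add: c_def j_def True)
  next
    case False
    then have "6 < \<beta>" by simp
    then show ?thesis
      by (rule st.drift_large_beta) (simp_all add: c_def j_def False)
  qed
  have nn: "(norm (Kop n))\<^sup>2 + (norm (n - Kop n))\<^sup>2 = (norm n)\<^sup>2" by (rule ops.norm_K_complement)
  have ee: "comp_coef * (norm e)\<^sup>2 \<le> comp_coef * (norm (Xh - X))\<^sup>2"
    using comp_coef_nonneg ops.norm_K_le unfolding e_def by (intro mult_left_mono power_mono) simp_all
  have drift': "st.drift \<le> \<eta> * (- (\<tau> * ops.potential c \<kappa> x z)) + \<eta> * (comp_coef * (norm (Xh - X))\<^sup>2) + \<eta> * (noise_coef * (norm n)\<^sup>2)"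
  proof -
    have "\<eta> * (comp_coef * (norm e)\<^sup>2) \<le> \<eta> * (comp_coef * (norm (Xh - X))\<^sup>2)" by (rule mult_left_mono[OF ee]) (use eta_pos in simp)
    then show ?thesis using drift unfolding nn by (simp only: distrib_left)
  qed
  have "energy X' V' + (norm (X' - Xc'))\<^sup>2 \<le> (1 - \<eta> * \<tau>) * energy X V + (1 + \<phi>2 / 2) * (norm (X - Xc - D))\<^sup>2
     + \<eta> * (comp_coef * (norm (Xh - X))\<^sup>2) + \<eta> * (noise_coef * (norm n)\<^sup>2)"
  proof -
    have fin: "p' + g' + u' \<le> (1 - w) * (p + g0) + uu + E1 + N1"
      if "p' - p - q1 + q2 + q3 + q4 \<le> - (w * p) + E1 + N1" "g' \<le> g0 - q1 + q3" "w * g0 \<le> q2" "u' \<le> uu + q4"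
      for p p' g' u' w g0 uu E1 N1 q1 q2 q3 q4 :: real
      using that by (simp add: algebra_simps)
    show ?thesis
      unfolding energy_def KX' z' x_def[symmetric] z_def[symmetric]
    proof (rule fin)
      show "ops.potential c \<kappa> (x - \<eta> *\<^sub>R st.a) (z + (\<eta> * \<omega>) *\<^sub>R Lop (x + e) + (1 / \<omega>) *\<^sub>R d) - ops.potential c \<kappa> x z
          - \<eta> * ((q - st.b) \<bullet> q) + \<eta> / (2 * (1 + 2 * \<beta>)) * (norm (q - st.b))\<^sup>2 + \<eta>\<^sup>2 * Lf / 2 * (norm q)\<^sup>2
          + (1 + 2 / \<phi>2) * \<eta>\<^sup>2 * (st.a \<bullet> st.a + (norm q)\<^sup>2)
        \<le> - (\<eta> * \<tau> * ops.potential c \<kappa> x z) + \<eta> * (comp_coef * (norm (Xh - X))\<^sup>2) + \<eta> * (noise_coef * (norm n)\<^sup>2)"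
        using drift' unfolding st.drift_def by (simp only: mult_minus_right mult.assoc)
    qed (rule smooth_step PL_step comp_step)+
  qed
  then show ?thesis unfolding n_def gt_def .
qed

abbreviation lo where "lo \<equiv> min_pos_eigenvalue L"

lemma beta_lo_gt_1: "1 < \<beta> * lo" using beta_lo by simp

text \<open>The constant in the lower bound for the potential with coefficient \<open>c\<close>; for \<open>c = 1\<close> it is the one in
  the theorem.\<close>

definition weight :: real where "weight = (\<beta> * lo - c) / (2 * \<beta> * lo)"

lemma weight_pos: "0 < weight" and weight_le: "weight \<le> 1"
  using beta_lo_gt_1 c_le_1 c_pos beta_pos lo_pos by (simp_all add: weight_def field_simps)

lemma weight_ge: "(\<beta> * lo - 1) / (2 * \<beta> * lo) \<le> weight"
  unfolding weight_def using c_le_1 beta_pos lo_pos by (intro divide_right_mono) simp_all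

lemma c_beta_le_kappa: "c * \<beta> \<le> \<kappa>" by (simp add: \<kappa>_def j_def)

lemma energy_lower: "weight * ((norm (Kop X))\<^sup>2 + real CARD('n) * gap (mean X)) \<le> energy X V"
proof -
  have "weight = 1/2 * (1 - c / (\<beta> * lo))" unfolding weight_def using beta_pos lo_pos by (simp add: field_simps)
  then have "weight * (norm (Kop X))\<^sup>2 \<le> ops.potential c \<kappa> (Kop X) (dual X V)"
    using ops.potential_lower[OF beta_pos less_imp_le[OF c_pos] c_beta_le_kappa, of "Kop X" "dual X V"]
    by (simp only: ops.K_K)
  moreover have "weight * (real CARD('n) * gap (mean X)) \<le> 1 * (real CARD('n) * gap (mean X))"
    using weight_le gap_nonneg by (intro mult_right_mono) simp_all
  ultimately show ?thesis unfolding energy_def distrib_left mult_1 by linarith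
qed

lemma P_matrix_eq: "P_matrix R lam = (1 / Max (range (($) lam))) *\<^sub>R outer_product rho_vec + spectral_matrix R (\<chi> j. 1 / lam $ j)"
  by (simp add: P_matrix_def spectral_matrix_def)

lemma outer_product_form: "0 \<le> Y \<bullet> (outer_product u ** (Y :: real^'d^'n))"
proof -
  have "Y \<bullet> (outer_product u ** Y) = (\<Sum>k\<in>UNIV. (\<Sum>i\<in>UNIV. u $ i * Y $ i $ k)\<^sup>2)"
  proof -
    have "Y \<bullet> (outer_product u ** Y) = (\<Sum>i\<in>UNIV. \<Sum>k\<in>UNIV. Y $ i $ k * (u $ i * (\<Sum>l\<in>UNIV. u $ l * Y $ l $ k)))"
      by (simp add: inner_vec_def matrix_matrix_mult_def outer_product_def sum_distrib_left mult.assoc)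
    also have "\<dots> = (\<Sum>k\<in>UNIV. \<Sum>i\<in>UNIV. Y $ i $ k * (u $ i * (\<Sum>l\<in>UNIV. u $ l * Y $ l $ k)))"
      by (rule sum.swap)
    also have "\<dots> = (\<Sum>k\<in>UNIV. (\<Sum>i\<in>UNIV. u $ i * Y $ i $ k)\<^sup>2)"
      by (simp add: power2_eq_square sum_distrib_right mult_ac)
    finally show ?thesis .
  qed
  also have "0 \<le> \<dots>" by (intro sum_nonneg) simp
  finally show ?thesis .
qed

lemma K_matrix_rho: "K_matrix ** outer_product rho_vec = (0 :: real^'n^'n)"
proof -
  have "(K_matrix ** outer_product rho_vec) $ i = (0 :: real^'n)" for i :: 'n
  proof -
    have const: "(outer_product rho_vec :: real^'n^'n) = (\<chi> i. \<chi> k. 1 / real CARD('n))"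
      by (simp add: vec_eq_iff outer_product_def rho_vec_def)
    show ?thesis
      unfolding const K_matrix_mult by (simp add: mean_def sum_constant_scaleR del: sum_constant)
  qed
  then show ?thesis by (simp add: vec_eq_iff)
qed

text \<open>The dual term of \<open>lyapunov\<close> also has a part in the direction of the constant vectors; it is nonnegative and is dropped.\<close>

lemma lyapunov_ge:
  "ops.potential 1 (1 + \<beta>) (Kop X) (dual X 0) + real CARD('n) * gap (mean X) + (norm X)\<^sup>2
    \<le> lyapunov (P_matrix R lam) \<beta> \<omega> f X 0 0"
proof -
  define Y where "Y = (0 :: real^'d^'n) + (1 / \<omega>) *\<^sub>R grad_at_mean f X"
  define S where "S = spectral_matrix R (\<chi> j. 1 / lam $ j)"
  have dual: "dual X 0 = Kop Y" by (simp add: dual_def Y_def)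
  have PKY: "Pop (Kop Y) = S ** Y" by (simp add: ops.P_K S_def)
  have K: "sq_norm_wrt K_matrix X = Kop X \<bullet> Kop X"
    by (simp add: sq_norm_wrt_def ops.adjoint_K ops.K_K)
  have Max0: "0 \<le> Max (range (($) lam))"
    using lam_pos[OF dec, of undefined] by (intro order_trans[OF less_imp_le Max_ge]) auto
  have split: "A ** Y + B ** Y = (A + B) ** Y" for A B :: "real^'n^'n"
    by (simp add: vec_eq_iff matrix_matrix_mult_def distrib_right sum.distrib)
  have scale: "(k *\<^sub>R A) ** Y = k *\<^sub>R (A ** Y)" for A :: "real^'n^'n" and k
    by (simp add: vec_eq_iff matrix_matrix_mult_def sum_distrib_left mult.assoc)
  have "sq_norm_wrt (P_matrix R lam) Y = (1 / Max (range (($) lam))) * (Y \<bullet> (outer_product rho_vec ** Y)) + Y \<bullet> (S ** Y)"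
    unfolding sq_norm_wrt_def P_matrix_eq S_def split[symmetric] scale inner_add_right by simp
  moreover have "Y \<bullet> (S ** Y) = Kop Y \<bullet> Pop (Kop Y)"
    unfolding PKY ops.adjoint_K S_def ops.K_P ..
  ultimately have P: "Kop Y \<bullet> Pop (Kop Y) \<le> sq_norm_wrt (P_matrix R lam) Y"
    using outer_product_form Max0 by simp
  have KP: "(K_matrix ** P_matrix R lam) ** Y = S ** Y"
  proof -
    have "K_matrix ** P_matrix R lam = K_matrix ** S"
    proof -
      have "K_matrix ** (k *\<^sub>R A) = k *\<^sub>R (K_matrix ** A)" for k and A :: "real^'n^'n"
        by (simp add: vec_eq_iff matrix_matrix_mult_def sum_distrib_left mult.left_commute)
      then show ?thesis by (simp add: P_matrix_eq S_def matrix_add_ldistrib K_matrix_rho)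
    qed
    then show ?thesis by (simp add: matrix_mul_assoc[symmetric] S_def ops.K_P)
  qed
  have X: "X \<bullet> ((K_matrix ** P_matrix R lam) ** Y) = Kop X \<bullet> Pop (Kop Y)"
    unfolding KP PKY ops.adjoint_K S_def ops.K_P ..
  have "(1 + \<beta>) / 2 * (Kop Y \<bullet> Pop (Kop Y)) \<le> (1 + \<beta>) / 2 * sq_norm_wrt (P_matrix R lam) Y"
    using P beta_pos by (intro mult_left_mono) simp_all
  then show ?thesis
    unfolding lyapunov_def Let_def Y_def[symmetric] K X ops.potential_def dual gap_def by simp
qed

lemma lyapunov_nonneg: "0 \<le> lyapunov (P_matrix R lam) \<beta> \<omega> f X 0 0"
proof -
  have "0 \<le> 1/2 * (1 - 1 / (\<beta> * lo)) * (norm (Kop X))\<^sup>2" using beta_lo_gt_1 by simp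
  also have "\<dots> \<le> ops.potential 1 (1 + \<beta>) (Kop X) (dual X 0)"
    using beta_pos by (intro ops.potential_lower) simp_all
  moreover have "0 \<le> real CARD('n) * gap (mean X)" using gap_nonneg by simp
  ultimately show ?thesis using lyapunov_ge[of X] zero_le_power2[of "norm X"] by linarith
qed

lemma energy_initial:
  "(\<beta> * lo - 1) / (2 * \<beta> * lo) * (energy X 0 + (norm X)\<^sup>2) \<le> weight * lyapunov (P_matrix R lam) \<beta> \<omega> f X 0 0"
proof -
  define A where "A = ops.potential c \<kappa> (Kop X) (dual X 0)"
  define B where "B = ops.potential 1 (1 + \<beta>) (Kop X) (dual X 0)"
  define r where "r = real CARD('n) * gap (mean X) + (norm X)\<^sup>2"
  define V where "V = lyapunov (P_matrix R lam) \<beta> \<omega> f X 0 0"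
  have r: "0 \<le> r" using gap_nonneg by (simp add: r_def)
  have "(\<beta> * lo - 1) * A \<le> (\<beta> * lo - c) * B"
    unfolding A_def B_def using beta_pos beta_lo_gt_1 c_pos c_le_1
    by (intro ops.potential_compare) (simp_all add: \<kappa>_def j_def algebra_simps)
  moreover have "(\<beta> * lo - 1) * r \<le> (\<beta> * lo - c) * r" using r c_le_1 by (intro mult_right_mono) simp_all
  moreover have "(\<beta> * lo - c) * (B + r) \<le> (\<beta> * lo - c) * V"
    using lyapunov_ge[of X] beta_lo_gt_1 c_le_1
    by (intro mult_left_mono) (simp_all add: B_def r_def V_def)
  ultimately have "(\<beta> * lo - 1) * (A + r) \<le> (\<beta> * lo - c) * V" by (simp add: distrib_left)
  from divide_right_mono[OF this, of "2 * \<beta> * lo"] beta_pos lo_pos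
  show ?thesis by (simp add: weight_def energy_def A_def r_def V_def add.assoc)
qed

end

section \<open>Expectations given the past and square-integrability\<close>

text \<open>The notion of independence is spelled out because the two variables may have different value types.\<close>

lemma (in prob_space) distr_pair_indep:
  assumes YZ: "Y \<in> M \<rightarrow>\<^sub>M N1" "Z \<in> M \<rightarrow>\<^sub>M N2"
    and indep: "\<And>A B. A \<in> sets N1 \<Longrightarrow> B \<in> sets N2 \<Longrightarrow>
      prob ((Y -` A \<inter> space M) \<inter> (Z -` B \<inter> space M)) = prob (Y -` A \<inter> space M) * prob (Z -` B \<inter> space M)"
  shows "distr M N1 Y \<Otimes>\<^sub>M distr M N2 Z = distr M (N1 \<Otimes>\<^sub>M N2) (\<lambda>w. (Y w, Z w))"
proof (rule pair_measure_eqI)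
  interpret Y: prob_space "distr M N1 Y" by (rule prob_space_distr[OF YZ(1)])
  interpret Z: prob_space "distr M N2 Z" by (rule prob_space_distr[OF YZ(2)])
  show "sigma_finite_measure (distr M N1 Y)" "sigma_finite_measure (distr M N2 Z)" by unfold_locales
  show "sets (distr M N1 Y \<Otimes>\<^sub>M distr M N2 Z) = sets (distr M (N1 \<Otimes>\<^sub>M N2) (\<lambda>w. (Y w, Z w)))"
    by (simp cong: sets_pair_measure_cong)
  fix A B assume "A \<in> sets (distr M N1 Y)" "B \<in> sets (distr M N2 Z)"
  then have AB: "A \<in> sets N1" "B \<in> sets N2" by simp_all
  have "emeasure (distr M (N1 \<Otimes>\<^sub>M N2) (\<lambda>w. (Y w, Z w))) (A \<times> B) = emeasure M ((\<lambda>w. (Y w, Z w)) -` (A \<times> B) \<inter> space M)"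
    using YZ AB by (intro emeasure_distr) simp_all
  also have "(\<lambda>w. (Y w, Z w)) -` (A \<times> B) \<inter> space M = (Y -` A \<inter> space M) \<inter> (Z -` B \<inter> space M)" by auto
  also have "emeasure M \<dots> = ennreal (prob (Y -` A \<inter> space M) * prob (Z -` B \<inter> space M))"
    using indep[OF AB] by (simp add: emeasure_eq_measure)
  also have "\<dots> = emeasure (distr M N1 Y) A * emeasure (distr M N2 Z) B"
    using YZ AB by (simp add: emeasure_distr emeasure_eq_measure ennreal_mult)
  finally show "emeasure (distr M N1 Y) A * emeasure (distr M N2 Z) B
    = emeasure (distr M (N1 \<Otimes>\<^sub>M N2) (\<lambda>w. (Y w, Z w))) (A \<times> B)" by simp
qed

text \<open>A bound on the expectation over \<open>Z\<close> with \<open>Y\<close> fixed is integrated over the law of \<open>Y\<close>, by Fubini's theorem. This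
  replaces conditional expectations given the past.\<close>

lemma (in prob_space) expectation_indep_le:
  fixes h :: "'y \<Rightarrow> 'z \<Rightarrow> real" and b :: "'y \<Rightarrow> real"
  assumes YZ: "Y \<in> M \<rightarrow>\<^sub>M N1" "Z \<in> M \<rightarrow>\<^sub>M N2"
    and indep: "\<And>A B. A \<in> sets N1 \<Longrightarrow> B \<in> sets N2 \<Longrightarrow>
      prob ((Y -` A \<inter> space M) \<inter> (Z -` B \<inter> space M)) = prob (Y -` A \<inter> space M) * prob (Z -` B \<inter> space M)"
    and h: "(\<lambda>(y, z). h y z) \<in> borel_measurable (N1 \<Otimes>\<^sub>M N2)" "\<And>y z. 0 \<le> h y z"
    and int: "\<And>y. integrable (distr M N2 Z) (h y)"
    and le: "\<And>y. (\<integral>z. h y z \<partial>distr M N2 Z) \<le> b y"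
    and b: "b \<in> borel_measurable N1" "integrable M (\<lambda>w. b (Y w))"
  shows "integrable M (\<lambda>w. h (Y w) (Z w))" "expectation (\<lambda>w. h (Y w) (Z w)) \<le> expectation (\<lambda>w. b (Y w))"
proof -
  have joint: "distr M N1 Y \<Otimes>\<^sub>M distr M N2 Z = distr M (N1 \<Otimes>\<^sub>M N2) (\<lambda>w. (Y w, Z w))"
    by (rule distr_pair_indep[OF YZ]) (rule indep)
  interpret D: prob_space "distr M N2 Z" by (rule prob_space_distr[OF YZ(2)])
  have b0: "0 \<le> b y" for y by (rule order_trans[OF integral_nonneg_AE le]) (use h in simp)
  have YZm: "(\<lambda>w. (Y w, Z w)) \<in> M \<rightarrow>\<^sub>M N1 \<Otimes>\<^sub>M N2" using YZ by simp
  have hYZ: "(\<lambda>w. h (Y w) (Z w)) \<in> borel_measurable M"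
    using measurable_compose[OF YZm h(1)] by simp
  have "(\<integral>\<^sup>+w. ennreal (h (Y w) (Z w)) \<partial>M)
      = (\<integral>\<^sup>+p. ennreal ((\<lambda>(y, z). h y z) p) \<partial>distr M (N1 \<Otimes>\<^sub>M N2) (\<lambda>w. (Y w, Z w)))"
    using h(1) by (subst nn_integral_distr[OF YZm]) simp_all
  also have "\<dots> = (\<integral>\<^sup>+p. ennreal ((\<lambda>(y, z). h y z) p) \<partial>(distr M N1 Y \<Otimes>\<^sub>M distr M N2 Z))"
    by (simp only: joint)
  also have "\<dots> = (\<integral>\<^sup>+y. \<integral>\<^sup>+z. ennreal (h y z) \<partial>distr M N2 Z \<partial>distr M N1 Y)"
    using h(1) by (subst D.nn_integral_fst[symmetric]) (simp_all cong: measurable_cong_sets)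
  also have "\<dots> \<le> (\<integral>\<^sup>+y. ennreal (b y) \<partial>distr M N1 Y)"
  proof (rule nn_integral_mono)
    fix y
    have "(\<integral>\<^sup>+z. ennreal (h y z) \<partial>distr M N2 Z) = ennreal (\<integral>z. h y z \<partial>distr M N2 Z)"
      using int h(2) by (intro nn_integral_eq_integral) simp_all
    then show "(\<integral>\<^sup>+z. ennreal (h y z) \<partial>distr M N2 Z) \<le> ennreal (b y)" using le by (simp add: ennreal_leI)
  qed
  also have "\<dots> = (\<integral>\<^sup>+w. ennreal (b (Y w)) \<partial>M)"
    using b(1) by (subst nn_integral_distr[OF YZ(1)]) simp_all
  also have "\<dots> = ennreal (expectation (\<lambda>w. b (Y w)))"
    using b(2) b0 by (intro nn_integral_eq_integral) simp_all
  finally have le: "(\<integral>\<^sup>+w. ennreal (h (Y w) (Z w)) \<partial>M) \<le> ennreal (expectation (\<lambda>w. b (Y w)))" .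
  show int': "integrable M (\<lambda>w. h (Y w) (Z w))"
    using hYZ h(2) le by (intro integrableI_nonneg) (auto simp: less_top[symmetric] top_unique)
  have "ennreal (expectation (\<lambda>w. h (Y w) (Z w))) = (\<integral>\<^sup>+w. ennreal (h (Y w) (Z w)) \<partial>M)"
    using int' h(2) by (intro nn_integral_eq_integral[symmetric]) simp_all
  then have "ennreal (expectation (\<lambda>w. h (Y w) (Z w))) \<le> ennreal (expectation (\<lambda>w. b (Y w)))"
    using le by (simp only:)
  moreover have "0 \<le> expectation (\<lambda>w. b (Y w))" by (rule integral_nonneg_AE) (simp add: b0)
  ultimately show "expectation (\<lambda>w. h (Y w) (Z w)) \<le> expectation (\<lambda>w. b (Y w))"
    using ennreal_le_iff by blast
qed

lemma borel_measurable_vec_lambda: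
  fixes F :: "'n::finite \<Rightarrow> 'w \<Rightarrow> 'a::euclidean_space"
  assumes "\<And>i. F i \<in> borel_measurable N"
  shows "(\<lambda>w. \<chi> i. F i w) \<in> borel_measurable N"
proof (rule borel_measurable_euclidean_space[THEN iffD2], rule ballI)
  fix u :: "'a^'n" assume "u \<in> Basis"
  then obtain i v where u: "u = axis i v" by (auto simp: Basis_vec_def)
  have "(\<lambda>w. F i w \<bullet> v) \<in> borel_measurable N" using assms by simp
  then show "(\<lambda>w. (\<chi> i. F i w) \<bullet> u) \<in> borel_measurable N" by (simp add: u inner_axis)
qed

lemma borel_measurable_vec_nth:
  fixes F :: "'w \<Rightarrow> 'a::euclidean_space^'n"
  assumes "F \<in> borel_measurable N"
  shows "(\<lambda>w. F w $ i) \<in> borel_measurable N"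
  by (rule measurable_compose[OF assms]) (intro borel_measurable_continuous_onI continuous_intros)

lemma borel_measurable_linear:
  fixes A :: "'a::euclidean_space \<Rightarrow> 'b::euclidean_space"
  assumes "linear A" "F \<in> borel_measurable N"
  shows "(\<lambda>w. A (F w)) \<in> borel_measurable N"
  by (rule measurable_compose[OF assms(2)])
    (intro borel_measurable_continuous_onI linear_continuous_on linear_conv_bounded_linear[THEN iffD1] assms)

definition square_integrable :: "'w measure \<Rightarrow> ('w \<Rightarrow> 'a::euclidean_space) \<Rightarrow> bool" where
  "square_integrable M F \<longleftrightarrow> F \<in> borel_measurable M \<and> integrable M (\<lambda>w. (norm (F w))\<^sup>2)"

lemma square_integrable_bound:
  fixes F :: "'w \<Rightarrow> 'a::euclidean_space"
  assumes "F \<in> borel_measurable M" "integrable M h" "\<And>w. (norm (F w))\<^sup>2 \<le> h w"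
  shows "square_integrable M F"
  unfolding square_integrable_def
proof
  show "integrable M (\<lambda>w. (norm (F w))\<^sup>2)"
    by (rule Bochner_Integration.integrable_bound[OF assms(2)])
      (use assms in \<open>auto intro: order_trans[OF _ abs_ge_self]\<close>)
qed (rule assms)

lemma square_integrable_add:
  assumes "square_integrable M F" "square_integrable M G"
  shows "square_integrable M (\<lambda>w. F w + G w)"
proof (rule square_integrable_bound)
  show "(\<lambda>w. F w + G w) \<in> borel_measurable M"
    using assms by (auto simp: square_integrable_def intro: borel_measurable_add)
  show "integrable M (\<lambda>w. 2 * (norm (F w))\<^sup>2 + 2 * (norm (G w))\<^sup>2)"
    using assms by (simp add: square_integrable_def)
  show "(norm (F w + G w))\<^sup>2 \<le> 2 * (norm (F w))\<^sup>2 + 2 * (norm (G w))\<^sup>2" for w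
    using norm_sum_sq_le[OF zero_less_one, of "F w" "G w"] by simp
qed

lemma square_integrable_linear:
  fixes A :: "'a::euclidean_space \<Rightarrow> 'b::euclidean_space"
  assumes "linear A" "square_integrable M F"
  shows "square_integrable M (\<lambda>w. A (F w))"
proof -
  obtain B where B: "\<And>x. norm (A x) \<le> B * norm x" using linear_bounded[OF assms(1)] by blast
  show ?thesis
  proof (rule square_integrable_bound)
    show "(\<lambda>w. A (F w)) \<in> borel_measurable M"
      by (rule borel_measurable_linear[OF assms(1)]) (use assms(2) in \<open>simp add: square_integrable_def\<close>)
    show "integrable M (\<lambda>w. B\<^sup>2 * (norm (F w))\<^sup>2)" using assms by (simp add: square_integrable_def)
    show "(norm (A (F w)))\<^sup>2 \<le> B\<^sup>2 * (norm (F w))\<^sup>2" for w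
      using power_mono[OF B[of "F w"] norm_ge_zero, of 2] by (simp add: power_mult_distrib)
  qed
qed

lemma square_integrable_scaleR:
  "square_integrable M F \<Longrightarrow> square_integrable M (\<lambda>w. k *\<^sub>R F w)"
  by (rule square_integrable_linear[OF linear_scaleR])

lemma square_integrable_diff:
  assumes "square_integrable M F" "square_integrable M G"
  shows "square_integrable M (\<lambda>w. F w - G w)"
  using square_integrable_add[OF assms(1) square_integrable_scaleR[OF assms(2), of "-1"]] by simp

lemma square_integrable_inner:
  assumes "square_integrable M F" "square_integrable M G"
  shows "integrable M (\<lambda>w. F w \<bullet> G w)"
proof (rule Bochner_Integration.integrable_bound)
  show "integrable M (\<lambda>w. (norm (F w))\<^sup>2 + (norm (G w))\<^sup>2)" using assms by (simp add: square_integrable_def)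
  show "(\<lambda>w. F w \<bullet> G w) \<in> borel_measurable M"
    using assms by (auto simp: square_integrable_def intro: borel_measurable_inner)
  have "\<bar>F w \<bullet> G w\<bar> \<le> (norm (F w))\<^sup>2 + (norm (G w))\<^sup>2" for w
  proof -
    have "0 \<le> (norm (F w) - norm (G w))\<^sup>2" by simp
    then have "2 * (norm (F w) * norm (G w)) \<le> (norm (F w))\<^sup>2 + (norm (G w))\<^sup>2"
      by (simp add: power2_diff)
    moreover have "\<bar>F w \<bullet> G w\<bar> \<le> norm (F w) * norm (G w)" by (rule Cauchy_Schwarz_ineq2)
    moreover have "0 \<le> norm (F w) * norm (G w)" by simp
    ultimately show ?thesis by linarith
  qed
  then show "AE w in M. norm (F w \<bullet> G w) \<le> norm ((norm (F w))\<^sup>2 + (norm (G w))\<^sup>2)" by simp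
qed

lemma square_integrable_Lipschitz:
  fixes A :: "'a::euclidean_space \<Rightarrow> 'b::euclidean_space"
  assumes "finite_measure M" "continuous_on UNIV A" "\<And>x y. norm (A x - A y) \<le> K * norm (x - y)" "square_integrable M F"
  shows "square_integrable M (\<lambda>w. A (F w))"
proof (rule square_integrable_bound)
  interpret finite_measure M by fact
  show "(\<lambda>w. A (F w)) \<in> borel_measurable M"
    by (rule measurable_compose[OF _ borel_measurable_continuous_onI[OF assms(2)]])
      (use assms(4) in \<open>simp add: square_integrable_def\<close>)
  show "integrable M (\<lambda>w. 2 * (K\<^sup>2 * (norm (F w))\<^sup>2) + 2 * (norm (A 0))\<^sup>2)"
    using assms by (simp add: square_integrable_def)
  fix w
  have "(norm ((A (F w) - A 0) + A 0))\<^sup>2 \<le> 2 * (norm (A (F w) - A 0))\<^sup>2 + 2 * (norm (A 0))\<^sup>2"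
    using norm_sum_sq_le[OF zero_less_one, of "A (F w) - A 0" "A 0"] by simp
  also have "(norm (A (F w) - A 0))\<^sup>2 \<le> K\<^sup>2 * (norm (F w))\<^sup>2"
    using power_mono[OF assms(3)[of "F w" 0] norm_ge_zero, of 2] by (simp add: power_mult_distrib)
  finally show "(norm (A (F w)))\<^sup>2 \<le> 2 * (K\<^sup>2 * (norm (F w))\<^sup>2) + 2 * (norm (A 0))\<^sup>2" by simp
qed

lemma square_integrable_vec_nth:
  fixes F :: "'w \<Rightarrow> 'a::euclidean_space^'n"
  assumes "square_integrable M F"
  shows "square_integrable M (\<lambda>w. F w $ i)"
  by (rule square_integrable_linear[OF _ assms]) (simp add: linear_iff)

lemma square_integrable_vec_lambda:
  fixes F :: "'n::finite \<Rightarrow> 'w \<Rightarrow> real^'d"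
  assumes "\<And>i. square_integrable M (F i)"
  shows "square_integrable M (\<lambda>w. \<chi> i. F i w)"
  using assms by (auto simp: square_integrable_def norm_vec_sq intro: borel_measurable_vec_lambda)

lemma linear_recursion_le:
  fixes a :: "nat \<Rightarrow> real"
  assumes "0 < \<rho>" "\<rho> \<le> 1" "0 \<le> s" "\<And>k. a (Suc k) \<le> (1 - \<rho>) * a k + s"
  shows "a k \<le> (1 - \<rho>) ^ k * a 0 + s / \<rho>"
proof (induction k)
  case 0
  then show ?case using assms by simp
next
  case (Suc k)
  have "a (Suc k) \<le> (1 - \<rho>) * ((1 - \<rho>) ^ k * a 0 + s / \<rho>) + s"
    using assms Suc by (intro order_trans[OF assms(4)] add_right_mono mult_left_mono) simp_all
  also have "\<dots> = (1 - \<rho>) ^ Suc k * a 0 + s / \<rho>" using assms by (simp add: field_simps)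
  finally show ?case .
qed

section \<open>Expected decrease along the random iteration\<close>

text \<open>The condition \<open>rate_u\<close> says that the contraction of the compression error outweighs what the estimate errors
  inject.\<close>

locale cpsgd_run =
  cpsgd_problem L Lf \<phi>2 \<beta> \<omega> \<eta> \<tau> R lam f \<nu> + prob_space M
  for L :: "real^'n^'n" and Lf \<phi>2 \<beta> \<omega> \<eta> \<tau> :: real and R :: "real^'m^'n" and lam :: "real^'m"
    and f :: "'n \<Rightarrow> real^'d \<Rightarrow> real" and \<nu> :: real and M :: "'w measure" +
  fixes S :: "'n \<Rightarrow> 's measure" and Q :: "'r measure"
    and \<xi> :: "'n \<Rightarrow> nat \<Rightarrow> 'w \<Rightarrow> 's" and \<zeta> :: "'n \<Rightarrow> nat \<Rightarrow> 'w \<Rightarrow> 'r"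
    and g :: "'n \<Rightarrow> real^'d \<Rightarrow> 's \<Rightarrow> real^'d" and C :: "'r \<Rightarrow> real^'d \<Rightarrow> real^'d"
    and x0 :: "real^'d^'n" and \<sigma> \<phi> r \<alpha> :: real
  assumes sample_rv: "\<And>i k. \<xi> i k \<in> M \<rightarrow>\<^sub>M S i"
    and fresh: "fresh_seeds M S Q \<xi> \<zeta>"
    and g_measurable: "\<And>i. (\<lambda>(x, s). g i x s) \<in> borel \<Otimes>\<^sub>M S i \<rightarrow>\<^sub>M borel"
    and C_measurable: "(\<lambda>(z, x). C z x) \<in> Q \<Otimes>\<^sub>M borel \<rightarrow>\<^sub>M borel"
    and noise_integrable: "\<And>i k x. integrable M (\<lambda>w. (norm (g i x (\<xi> i k w) - gradient (f i) x))\<^sup>2)"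
    and noise_le: "\<And>i k x. (\<integral>w. (norm (g i x (\<xi> i k w) - gradient (f i) x))\<^sup>2 \<partial>M) \<le> \<sigma>\<^sup>2"
    and r_pos: "0 < r" and phi: "0 < \<phi>" "\<phi> \<le> 1" and alpha: "0 < \<alpha>" "\<alpha> * r < 1"
    and phi2: "\<phi>2 = \<alpha> * r * \<phi>"
    and compressor_integrable: "\<And>x. integrable Q (\<lambda>z. (norm ((1/r) *\<^sub>R C z x - x))\<^sup>2)"
    and compressor_le: "\<And>x. (\<integral>z. (norm ((1/r) *\<^sub>R C z x - x))\<^sup>2 \<partial>Q) \<le> (1 - \<phi>) * (norm x)\<^sup>2"
    and rate_u: "\<eta> * \<tau> \<le> \<phi>2 / 2 + \<phi>2\<^sup>2 / 2 - \<eta> * comp_coef * (2 * r\<^sup>2 * (1 - \<phi>) + 2 * (1 - r)\<^sup>2)"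
    and rate_pos: "0 < \<tau>"
begin

abbreviation state where
  "state k w \<equiv> cpsgd L C g \<alpha> (\<lambda>_. \<eta>) (\<lambda>_. \<beta> * \<omega>) (\<lambda>_. \<omega>) x0 \<xi> \<zeta> w k"

definition iter where "iter k w = fst (state k w)"
definition ref where "ref k w = fst (snd (state k w))"
definition aux where "aux k w = snd (snd (state k w))"
definition est where "est k w = (\<chi> i. ref k w $ i + C (\<zeta> i k w) (iter k w $ i - ref k w $ i))"
definition grads where "grads k w = (\<chi> i. g i (iter k w $ i) (\<xi> i k w))"

lemma state_eq: "state k w = (iter k w, ref k w, aux k w)"
  by (simp add: iter_def ref_def aux_def)

lemma mix_eq: "(\<chi> i. \<Sum>j\<in>UNIV. L $ i $ j *\<^sub>R Y $ j) = L ** (Y :: real^'d^'n)"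
  by (simp add: vec_eq_iff matrix_matrix_mult_def sum_component)

lemma step:
  "iter (Suc k) w = iter k w - \<eta> *\<^sub>R ((\<beta> * \<omega>) *\<^sub>R (L ** est k w) + \<omega> *\<^sub>R aux k w + grads k w)"
  "aux (Suc k) w = aux k w + (\<eta> * \<omega>) *\<^sub>R (L ** est k w)"
  "ref (Suc k) w = ref k w + \<alpha> *\<^sub>R (est k w - ref k w)"
proof -
  have "state (Suc k) w = cpsgd_step L C g \<alpha> \<eta> (\<beta> * \<omega>) \<omega> (\<lambda>i. \<xi> i k w) (\<lambda>i. \<zeta> i k w) (state k w)" by simp
  also have "\<dots> = ((\<chi> i. iter k w $ i - \<eta> *\<^sub>R ((\<beta> * \<omega>) *\<^sub>R (\<Sum>j\<in>UNIV. L $ i $ j *\<^sub>R est k w $ j)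
        + \<omega> *\<^sub>R aux k w $ i + g i (iter k w $ i) (\<xi> i k w))),
      (\<chi> i. (1 - \<alpha>) *\<^sub>R ref k w $ i + \<alpha> *\<^sub>R est k w $ i),
      (\<chi> i. aux k w $ i + (\<eta> * \<omega>) *\<^sub>R (\<Sum>j\<in>UNIV. L $ i $ j *\<^sub>R est k w $ j)))"
    unfolding state_eq cpsgd_step_def est_def by (simp add: Let_def)
  finally have eq: "state (Suc k) w = \<dots>" .
  have mix: "(\<Sum>j\<in>UNIV. L $ i $ j *\<^sub>R est k w $ j) = (L ** est k w) $ i" for i
    by (simp add: mix_eq[symmetric])
  show "iter (Suc k) w = iter k w - \<eta> *\<^sub>R ((\<beta> * \<omega>) *\<^sub>R (L ** est k w) + \<omega> *\<^sub>R aux k w + grads k w)"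
    unfolding iter_def[of "Suc k"] eq mix by (simp add: vec_eq_iff grads_def)
  show "aux (Suc k) w = aux k w + (\<eta> * \<omega>) *\<^sub>R (L ** est k w)"
    unfolding aux_def[of "Suc k"] eq mix by (simp add: vec_eq_iff)
  show "ref (Suc k) w = ref k w + \<alpha> *\<^sub>R (est k w - ref k w)"
    unfolding ref_def[of "Suc k"] eq mix by (simp add: vec_eq_iff algebra_simps)
qed

lemma init: "iter 0 w = x0" "ref 0 w = 0" "aux 0 w = 0"
  by (simp_all add: iter_def ref_def aux_def)

lemma mean_aux: "mean (aux k w) = 0"
proof (induction k)
  case 0
  show ?case by (simp add: init mean_def)
next
  case (Suc k)
  then show ?case by (simp add: step(2) mean_add mean_scaleR mean_L)
qed

text \<open>The events of the individual samples and seeds; the history at time \<open>k\<close> is generated by those with time index below \<open>k\<close>.\<close>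

definition source_events where
  "source_events = case_sum (\<lambda>(i, k). events_of M (S i) (\<xi> i k)) (\<lambda>(i, k). events_of M Q (\<zeta> i k))"

definition past :: "nat \<Rightarrow> (('n \<times> nat) + ('n \<times> nat)) set" where
  "past k = {a. case_sum snd snd a < k}"

definition history :: "nat \<Rightarrow> 'w measure" where
  "history k = sigma (space M) (\<Union>a\<in>past k. source_events a)"

lemma seed_rv: "\<zeta> i k \<in> M \<rightarrow>\<^sub>M Q" and seed_distr: "distr M Q (\<zeta> i k) = Q"
  using fresh by (auto simp: fresh_seeds_def)

lemma indep_sources: "indep_sets source_events UNIV"
  using fresh by (simp add: fresh_seeds_def source_events_def)

lemma events_of_subset: "X \<in> M \<rightarrow>\<^sub>M N \<Longrightarrow> events_of M N X \<subseteq> sets M"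
  by (auto simp: events_of_def)

lemma events_subset: "source_events a \<subseteq> sets M"
  by (cases a) (simp_all add: source_events_def events_of_subset sample_rv seed_rv split: prod.split)

lemma Int_stable_events_of: "Int_stable (events_of M N X)"
proof (rule Int_stableI)
  fix a b assume "a \<in> events_of M N X" "b \<in> events_of M N X"
  then obtain A B where "A \<in> sets N" "B \<in> sets N" "a = X -` A \<inter> space M" "b = X -` B \<inter> space M"
    by (auto simp: events_of_def)
  then have "a \<inter> b = X -` (A \<inter> B) \<inter> space M" "A \<inter> B \<in> sets N" by auto
  then show "a \<inter> b \<in> events_of M N X" unfolding events_of_def by blast
qed

lemma Int_stable_events: "Int_stable (source_events a)"
  by (cases a) (auto simp: source_events_def Int_stable_events_of split: prod.split)

lemma space_history: "space (history k) = space M"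
  unfolding history_def by (rule space_measure_of_conv)

lemma sets_history: "sets (history k) = sigma_sets (space M) (\<Union>a\<in>past k. source_events a)"
  unfolding history_def
proof (rule sets_measure_of)
  show "(\<Union>a\<in>past k. source_events a) \<subseteq> Pow (space M)" using events_subset sets.space_closed by blast
qed

lemma history_subalgebra: "subalgebra M (history k)"
  unfolding subalgebra_def space_history sets_history
  using events_subset by (auto intro!: sets.sigma_sets_subset)

lemma history_mono: "subalgebra (history (Suc k)) (history k)"
  unfolding subalgebra_def space_history sets_history
  by (auto simp: past_def intro!: sigma_sets_mono' intro: less_SucI)

lemma rv_history:
  assumes "X \<in> M \<rightarrow>\<^sub>M N" "source_events a = events_of M N X" "a \<in> past k"
  shows "X \<in> history k \<rightarrow>\<^sub>M N"
proof (rule measurableI)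
  show "X w \<in> space N" if "w \<in> space (history k)" for w
    using that measurable_space[OF assms(1)] by (simp add: space_history)
  fix A assume "A \<in> sets N"
  then have "X -` A \<inter> space M \<in> source_events a" by (auto simp: assms(2) events_of_def)
  then show "X -` A \<inter> space (history k) \<in> sets (history k)"
    using assms(3) by (auto simp: space_history sets_history)
qed

lemma sample_history: "\<xi> i k \<in> history (Suc k) \<rightarrow>\<^sub>M S i"
  by (rule rv_history[OF sample_rv, where a = "Inl (i, k)"]) (simp_all add: source_events_def past_def)

lemma seed_history: "\<zeta> i k \<in> history (Suc k) \<rightarrow>\<^sub>M Q"
  by (rule rv_history[OF seed_rv, where a = "Inr (i, k)"]) (simp_all add: source_events_def past_def)

lemma est_measurable:
  assumes "iter k \<in> borel_measurable N" "ref k \<in> borel_measurable N" "\<And>i. \<zeta> i k \<in> N \<rightarrow>\<^sub>M Q"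
  shows "est k \<in> borel_measurable N"
proof -
  have "(\<lambda>w. (\<zeta> i k w, iter k w $ i - ref k w $ i)) \<in> N \<rightarrow>\<^sub>M Q \<Otimes>\<^sub>M borel" for i
    by (intro measurable_Pair assms borel_measurable_diff borel_measurable_vec_nth)
  from measurable_compose[OF this C_measurable]
  have "(\<lambda>w. C (\<zeta> i k w) (iter k w $ i - ref k w $ i)) \<in> borel_measurable N" for i by simp
  then show ?thesis
    unfolding est_def[abs_def]
    by (intro borel_measurable_vec_lambda borel_measurable_add borel_measurable_vec_nth assms)
qed

lemma grads_measurable:
  assumes "iter k \<in> borel_measurable N" "\<And>i. \<xi> i k \<in> N \<rightarrow>\<^sub>M S i"
  shows "grads k \<in> borel_measurable N"
proof -
  have "(\<lambda>w. (iter k w $ i, \<xi> i k w)) \<in> N \<rightarrow>\<^sub>M borel \<Otimes>\<^sub>M S i" for i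
    by (intro measurable_Pair assms borel_measurable_vec_nth)
  from measurable_compose[OF this g_measurable]
  have "(\<lambda>w. g i (iter k w $ i) (\<xi> i k w)) \<in> borel_measurable N" for i by simp
  then show ?thesis unfolding grads_def[abs_def] by (intro borel_measurable_vec_lambda)
qed

lemma state_history:
  "iter k \<in> borel_measurable (history k) \<and> ref k \<in> borel_measurable (history k) \<and> aux k \<in> borel_measurable (history k)"
proof (induction k)
  case 0
  then show ?case by (simp add: init[abs_def])
next
  case (Suc k)
  let ?N = "history (Suc k)"
  have st: "iter k \<in> borel_measurable ?N" "ref k \<in> borel_measurable ?N" "aux k \<in> borel_measurable ?N"
    using Suc measurable_from_subalg[OF history_mono] by blast+
  have est: "est k \<in> borel_measurable ?N" by (rule est_measurable[OF st(1,2) seed_history])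
  have gr: "grads k \<in> borel_measurable ?N" by (rule grads_measurable[OF st(1) sample_history])
  have Lest: "(\<lambda>w. L ** est k w) \<in> borel_measurable ?N"
    by (rule borel_measurable_linear[OF linear_matrix_mult est])
  show ?case
    unfolding step[abs_def] using st est gr Lest
    by (intro conjI borel_measurable_add borel_measurable_diff borel_measurable_scaleR borel_measurable_const) 
qed

lemma state_measurable: "iter k \<in> borel_measurable M" "ref k \<in> borel_measurable M" "aux k \<in> borel_measurable M"
  using state_history measurable_from_subalg[OF history_subalgebra] by blast+

lemma indep_history:
  assumes Y: "Y \<in> history k \<rightarrow>\<^sub>M N1" and Z: "source_events a = events_of M N2 Z" "a \<notin> past k"
    and A: "A \<in> sets N1" and B: "B \<in> sets N2"
  shows "prob ((Y -` A \<inter> space M) \<inter> (Z -` B \<inter> space M)) = prob (Y -` A \<inter> space M) * prob (Z -` B \<inter> space M)"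
proof -
  define I where "I b = (if b then past k else {a})" for b
  have "indep_sets (\<lambda>b. sigma_sets (space M) (\<Union>i\<in>I b. source_events i)) UNIV"
  proof (rule indep_sets_collect_sigma)
    show "indep_sets source_events (\<Union>b\<in>UNIV. I b)" by (rule indep_sets_mono_index[OF _ indep_sources]) simp
    show "disjoint_family_on I UNIV" using Z(2) by (auto simp: disjoint_family_on_def I_def)
  qed (rule Int_stable_events)
  then have "indep_set (sets (history k)) (sigma_sets (space M) (source_events a))"
    unfolding indep_set_def by (rule indep_sets_mono_sets) (simp add: sets_history I_def split: bool.split)
  moreover have "Y -` A \<inter> space M \<in> sets (history k)"
    using measurable_sets[OF Y A] by (simp add: space_history)
  moreover have "Z -` B \<inter> space M \<in> sigma_sets (space M) (source_events a)"
    using B by (auto simp: Z(1) events_of_def)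
  ultimately show ?thesis by (rule indep_setD)
qed

definition comp_err where
  "comp_err k w = (\<Sum>i\<in>UNIV. (norm ((1/r) *\<^sub>R C (\<zeta> i k w) (iter k w $ i - ref k w $ i) - (iter k w $ i - ref k w $ i)))\<^sup>2)"

definition noise_err where
  "noise_err k w = (norm (grads k w - (\<chi> i. gradient (f i) (iter k w $ i))))\<^sup>2"

text \<open>The update moves \<open>u\<close> to \<open>(1 - \<alpha> r) u + \<alpha> r (u - C(u) / r)\<close>, a convex combination as \<open>\<alpha> r < 1\<close>.\<close>

lemma norm_reference_gap_le:
  "(norm (iter k w - ref k w - \<alpha> *\<^sub>R (est k w - ref k w)))\<^sup>2
    \<le> (1 - \<alpha> * r) * (norm (iter k w - ref k w))\<^sup>2 + \<alpha> * r * comp_err k w"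
proof -
  have one: "(norm (u - \<alpha> *\<^sub>R y))\<^sup>2 \<le> (1 - \<alpha> * r) * (norm u)\<^sup>2 + \<alpha> * r * (norm ((1/r) *\<^sub>R y - u))\<^sup>2" for u y :: "real^'d"
  proof -
    define t where "t = \<alpha> * r"
    have t: "0 \<le> t" "t \<le> 1" using alpha r_pos by (simp_all add: t_def)
    define v where "v = u - (1/r) *\<^sub>R y"
    have "u - \<alpha> *\<^sub>R y = (1 - t) *\<^sub>R u + t *\<^sub>R v"
      using r_pos by (simp add: v_def t_def algebra_simps)
    moreover have "(norm ((1 - t) *\<^sub>R u + t *\<^sub>R v))\<^sup>2 = (1 - t) * (norm u)\<^sup>2 + t * (norm v)\<^sup>2 - t * (1 - t) * (norm (u - v))\<^sup>2"
      unfolding power2_norm_eq_inner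
      by (simp add: inner_add_left inner_add_right inner_diff_left inner_diff_right inner_commute[of v u] algebra_simps)
    moreover have "0 \<le> t * (1 - t) * (norm (u - v))\<^sup>2" using t by simp
    moreover have "norm v = norm ((1/r) *\<^sub>R y - u)" unfolding v_def by (rule norm_minus_commute)
    ultimately show ?thesis by (simp add: t_def)
  qed
  have comp: "(iter k w - ref k w - \<alpha> *\<^sub>R (est k w - ref k w)) $ i
      = (iter k w $ i - ref k w $ i) - \<alpha> *\<^sub>R C (\<zeta> i k w) (iter k w $ i - ref k w $ i)" for i
    by (simp add: est_def)
  have "(norm (iter k w - ref k w - \<alpha> *\<^sub>R (est k w - ref k w)))\<^sup>2
      \<le> (\<Sum>i\<in>UNIV. (1 - \<alpha> * r) * (norm ((iter k w - ref k w) $ i))\<^sup>2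
        + \<alpha> * r * (norm ((1/r) *\<^sub>R C (\<zeta> i k w) (iter k w $ i - ref k w $ i) - (iter k w $ i - ref k w $ i)))\<^sup>2)"
    unfolding norm_vec_sq comp by (intro sum_mono order_trans[OF one]) simp
  also have "\<dots> = (1 - \<alpha> * r) * (norm (iter k w - ref k w))\<^sup>2 + \<alpha> * r * comp_err k w"
    unfolding norm_vec_sq comp_err_def sum.distrib sum_distrib_left ..
  finally show ?thesis .
qed

lemma norm_est_error_le:
  "(norm (est k w - iter k w))\<^sup>2 \<le> 2 * r\<^sup>2 * comp_err k w + 2 * (1 - r)\<^sup>2 * (norm (iter k w - ref k w))\<^sup>2"
proof -
  have one: "(norm (y - u))\<^sup>2 \<le> 2 * r\<^sup>2 * (norm ((1/r) *\<^sub>R y - u))\<^sup>2 + 2 * (1 - r)\<^sup>2 * (norm u)\<^sup>2" for u y :: "real^'d"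
  proof -
    have "y - u = r *\<^sub>R ((1/r) *\<^sub>R y - u) + (r - 1) *\<^sub>R u" using r_pos by (simp add: algebra_simps)
    then have "(norm (y - u))\<^sup>2 \<le> 2 * (norm (r *\<^sub>R ((1/r) *\<^sub>R y - u)))\<^sup>2 + 2 * (norm ((r - 1) *\<^sub>R u))\<^sup>2"
      using norm_sum_sq_le[OF zero_less_one, of "r *\<^sub>R ((1/r) *\<^sub>R y - u)" "(r - 1) *\<^sub>R u"] by simp
    then show ?thesis unfolding norm_scaleR power_mult_distrib by (simp add: power2_commute[of r 1])
  qed
  have comp: "(est k w - iter k w) $ i
      = C (\<zeta> i k w) (iter k w $ i - ref k w $ i) - (iter k w $ i - ref k w $ i)" for i
    by (simp add: est_def)
  have "(norm (est k w - iter k w))\<^sup>2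
      \<le> (\<Sum>i\<in>UNIV. 2 * r\<^sup>2 * (norm ((1/r) *\<^sub>R C (\<zeta> i k w) (iter k w $ i - ref k w $ i) - (iter k w $ i - ref k w $ i)))\<^sup>2
         + 2 * (1 - r)\<^sup>2 * (norm ((iter k w - ref k w) $ i))\<^sup>2)"
    unfolding norm_vec_sq comp by (intro sum_mono order_trans[OF one]) simp
  also have "\<dots> = 2 * r\<^sup>2 * comp_err k w + 2 * (1 - r)\<^sup>2 * (norm (iter k w - ref k w))\<^sup>2"
    unfolding norm_vec_sq comp_err_def sum.distrib sum_distrib_left ..
  finally show ?thesis .
qed

lemma continuous_grad: "continuous_on UNIV (gradient (f i))"
  by (rule continuous_gradient[OF smooth])

lemma comp_err_expectation:
  assumes "square_integrable M (iter k)" "square_integrable M (ref k)"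
  shows "integrable M (comp_err k)"
    "expectation (comp_err k) \<le> (1 - \<phi>) * expectation (\<lambda>w. (norm (iter k w - ref k w))\<^sup>2)"
proof -
  define u where "u i w = iter k w $ i - ref k w $ i" for i w
  define e where "e i w = (norm ((1/r) *\<^sub>R C (\<zeta> i k w) (u i w) - u i w))\<^sup>2" for i w
  have sq: "square_integrable M (u i)" for i
    unfolding u_def[abs_def] by (intro square_integrable_diff square_integrable_vec_nth assms)
  have u_hist: "u i \<in> borel_measurable (history k)" for i
    unfolding u_def[abs_def] using state_history by (intro borel_measurable_diff borel_measurable_vec_nth) blast+
  have sqi: "integrable M (\<lambda>w. (norm (u i w))\<^sup>2)" for i using sq by (simp add: square_integrable_def)
  have e: "integrable M (e i) \<and> expectation (e i) \<le> expectation (\<lambda>w. (1 - \<phi>) * (norm (u i w))\<^sup>2)" for i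
  proof -
    have swap: "(\<lambda>(y, z). (z, y)) \<in> borel \<Otimes>\<^sub>M Q \<rightarrow>\<^sub>M Q \<Otimes>\<^sub>M (borel :: (real^'d) measure)" by measurable
    from measurable_compose[OF swap C_measurable]
    have Cm: "(\<lambda>p. C (snd p) (fst p)) \<in> borel_measurable (borel \<Otimes>\<^sub>M Q)" by (simp add: case_prod_unfold)
    have hm: "(\<lambda>(y, z). (norm ((1/r) *\<^sub>R C z y - y))\<^sup>2) \<in> borel_measurable (borel \<Otimes>\<^sub>M Q)"
      unfolding case_prod_unfold using Cm by simp
    have indep: "prob ((u i -` A \<inter> space M) \<inter> (\<zeta> i k -` B \<inter> space M)) = prob (u i -` A \<inter> space M) * prob (\<zeta> i k -` B \<inter> space M)"
      if "A \<in> sets borel" "B \<in> sets Q" for A B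
      by (rule indep_history[OF u_hist _ _ that, where a = "Inr (i, k)"]) (simp_all add: source_events_def past_def)
    have um: "u i \<in> M \<rightarrow>\<^sub>M borel" using sq by (simp add: square_integrable_def)
    define h where "h y z = (norm ((1/r) *\<^sub>R C z y - y))\<^sup>2" for y z
    define b where "b y = (1 - \<phi>) * (norm y)\<^sup>2" for y :: "real^'d"
    have hm': "(\<lambda>(y, z). h y z) \<in> borel_measurable (borel \<Otimes>\<^sub>M Q)" unfolding h_def by (rule hm)
    have hi: "integrable (distr M Q (\<zeta> i k)) (h y)" for y
      unfolding seed_distr h_def by (rule compressor_integrable)
    have hl: "(\<integral>z. h y z \<partial>distr M Q (\<zeta> i k)) \<le> b y" for y
      unfolding seed_distr h_def b_def by (rule compressor_le)
    have bm: "b \<in> borel_measurable borel" unfolding b_def[abs_def] by simp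
    have bi: "integrable M (\<lambda>w. b (u i w))" unfolding b_def using sqi by simp
    have h0: "0 \<le> h y z" for y z by (simp add: h_def)
    have ei: "e i = (\<lambda>w. h (u i w) (\<zeta> i k w))" by (simp add: e_def h_def fun_eq_iff)
    note est = expectation_indep_le[where Y = "u i" and Z = "\<zeta> i k" and h = h and b = b,
        OF um seed_rv indep hm' h0 hi hl bm bi]
    show ?thesis unfolding ei using est unfolding b_def by blast
  qed
  have ce: "comp_err k = (\<lambda>w. \<Sum>i\<in>UNIV. e i w)" by (simp add: fun_eq_iff comp_err_def e_def u_def)
  show "integrable M (comp_err k)" unfolding ce using e by (intro Bochner_Integration.integrable_sum) blast
  have "expectation (comp_err k) = (\<Sum>i\<in>UNIV. expectation (e i))"
    unfolding ce using e by (intro Bochner_Integration.integral_sum) blast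
  also have "\<dots> \<le> (\<Sum>i\<in>UNIV. expectation (\<lambda>w. (1 - \<phi>) * (norm (u i w))\<^sup>2))" using e by (intro sum_mono) blast
  also have "\<dots> = expectation (\<lambda>w. \<Sum>i\<in>UNIV. (1 - \<phi>) * (norm (u i w))\<^sup>2)"
    using sqi by (intro Bochner_Integration.integral_sum[symmetric]) simp
  also have "\<dots> = (1 - \<phi>) * expectation (\<lambda>w. (norm (iter k w - ref k w))\<^sup>2)"
    by (simp add: norm_vec_sq u_def sum_distrib_left[symmetric])
  finally show "expectation (comp_err k) \<le> (1 - \<phi>) * expectation (\<lambda>w. (norm (iter k w - ref k w))\<^sup>2)" .
qed

lemma noise_err_expectation:
  shows "integrable M (noise_err k)" "expectation (noise_err k) \<le> real CARD('n) * \<sigma>\<^sup>2"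
proof -
  define e where "e i w = (norm (g i (iter k w $ i) (\<xi> i k w) - gradient (f i) (iter k w $ i)))\<^sup>2" for i w
  have x_hist: "(\<lambda>w. iter k w $ i) \<in> borel_measurable (history k)" for i
    using state_history by (intro borel_measurable_vec_nth) blast
  have x_m: "(\<lambda>w. iter k w $ i) \<in> borel_measurable M" for i
    by (intro borel_measurable_vec_nth state_measurable)
  have e: "integrable M (e i) \<and> expectation (e i) \<le> \<sigma>\<^sup>2" for i
  proof -
    have gm: "(\<lambda>p. g i (fst p) (snd p)) \<in> borel_measurable (borel \<Otimes>\<^sub>M S i)"
      using g_measurable[of i] by (simp add: case_prod_unfold)
    have grad: "(\<lambda>p. gradient (f i) (fst p)) \<in> borel_measurable (borel \<Otimes>\<^sub>M S i)"
      by (rule measurable_compose[OF measurable_fst borel_measurable_continuous_onI[OF continuous_grad]])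
    have hm: "(\<lambda>(x, s). (norm (g i x s - gradient (f i) x))\<^sup>2) \<in> borel_measurable (borel \<Otimes>\<^sub>M S i)"
      unfolding case_prod_unfold using gm grad by simp
    have hx: "(\<lambda>s. (norm (g i x s - gradient (f i) x))\<^sup>2) \<in> borel_measurable (S i)" for x
      using measurable_compose[OF measurable_Pair1' hm, of x] by simp
    have indep: "prob (((\<lambda>w. iter k w $ i) -` A \<inter> space M) \<inter> (\<xi> i k -` B \<inter> space M))
        = prob ((\<lambda>w. iter k w $ i) -` A \<inter> space M) * prob (\<xi> i k -` B \<inter> space M)"
      if "A \<in> sets borel" "B \<in> sets (S i)" for A B
      by (rule indep_history[OF x_hist _ _ that, where a = "Inl (i, k)"]) (simp_all add: source_events_def past_def)
    define h where "h x s = (norm (g i x s - gradient (f i) x))\<^sup>2" for x s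
    have hm': "(\<lambda>(x, s). h x s) \<in> borel_measurable (borel \<Otimes>\<^sub>M S i)" unfolding h_def by (rule hm)
    have hx': "h x \<in> borel_measurable (S i)" for x unfolding h_def[abs_def] by (rule hx)
    have hi: "integrable (distr M (S i) (\<xi> i k)) (h x)" for x
      unfolding integrable_distr_eq[OF sample_rv hx'] unfolding h_def by (rule noise_integrable)
    have hl: "(\<integral>s. h x s \<partial>distr M (S i) (\<xi> i k)) \<le> \<sigma>\<^sup>2" for x
      unfolding integral_distr[OF sample_rv hx'] unfolding h_def by (rule noise_le)
    have h0: "0 \<le> h x s" for x s by (simp add: h_def)
    have ei: "e i = (\<lambda>w. h (iter k w $ i) (\<xi> i k w))" by (simp add: e_def h_def fun_eq_iff)
    have bm: "(\<lambda>_. \<sigma>\<^sup>2) \<in> borel_measurable borel" "integrable M (\<lambda>w. \<sigma>\<^sup>2)" by simp_all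
    note est = expectation_indep_le[where Y = "\<lambda>w. iter k w $ i" and Z = "\<xi> i k" and h = h and b = "\<lambda>_. \<sigma>\<^sup>2",
        OF x_m sample_rv indep hm' h0 hi hl bm]
    have "integrable M (e i) \<and> expectation (e i) \<le> expectation (\<lambda>w. \<sigma>\<^sup>2)"
      unfolding ei using est by blast
    then show ?thesis by (simp add: prob_space)
  qed
  have ne: "noise_err k = (\<lambda>w. \<Sum>i\<in>UNIV. e i w)"
    by (simp add: fun_eq_iff noise_err_def e_def norm_vec_sq grads_def)
  show "integrable M (noise_err k)" unfolding ne using e by (intro Bochner_Integration.integrable_sum) blast
  have "expectation (noise_err k) = (\<Sum>i\<in>UNIV. expectation (e i))"
    unfolding ne using e by (intro Bochner_Integration.integral_sum) blast
  also have "\<dots> \<le> (\<Sum>i\<in>(UNIV :: 'n set). \<sigma>\<^sup>2)" using e by (intro sum_mono) blast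
  finally show "expectation (noise_err k) \<le> real CARD('n) * \<sigma>\<^sup>2" by simp
qed

lemma gradient_square_integrable:
  "square_integrable M F \<Longrightarrow> square_integrable M (\<lambda>w. gradient (f i) (F w))"
  by (rule square_integrable_Lipschitz[where K = Lf, OF finite_measure_axioms continuous_grad])
    (use smooth in \<open>simp_all add: L_smooth_def\<close>)

lemma state_square_integrable:
  "square_integrable M (iter k) \<and> square_integrable M (ref k) \<and> square_integrable M (aux k)"
proof (induction k)
  case 0
  then show ?case by (simp add: square_integrable_def init[abs_def])
next
  case (Suc k)
  then have sq: "square_integrable M (iter k)" "square_integrable M (ref k)" "square_integrable M (aux k)" by blast+
  have est_m: "est k \<in> borel_measurable M" by (rule est_measurable[OF state_measurable(1,2) seed_rv])
  have gr_m: "grads k \<in> borel_measurable M" by (rule grads_measurable[OF state_measurable(1) sample_rv])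
  have "square_integrable M (\<lambda>w. est k w - iter k w)"
  proof (rule square_integrable_bound)
    show "integrable M (\<lambda>w. 2 * r\<^sup>2 * comp_err k w + 2 * (1 - r)\<^sup>2 * (norm (iter k w - ref k w))\<^sup>2)"
      using comp_err_expectation(1)[OF sq(1,2)] square_integrable_diff[OF sq(1,2)]
      by (simp add: square_integrable_def)
  qed (use est_m state_measurable in \<open>simp_all add: norm_est_error_le borel_measurable_diff\<close>)
  from square_integrable_add[OF this sq(1)] have est: "square_integrable M (est k)" by simp
  have gt: "square_integrable M (\<lambda>w. \<chi> i. gradient (f i) (iter k w $ i))"
    by (intro square_integrable_vec_lambda gradient_square_integrable square_integrable_vec_nth sq)
  have "square_integrable M (\<lambda>w. grads k w - (\<chi> i. gradient (f i) (iter k w $ i)))"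
  proof (rule square_integrable_bound[OF _ noise_err_expectation(1)[of k]])
    show "(\<lambda>w. grads k w - (\<chi> i. gradient (f i) (iter k w $ i))) \<in> borel_measurable M"
      using gr_m gt by (auto simp: square_integrable_def intro: borel_measurable_diff)
  qed (simp add: noise_err_def)
  from square_integrable_add[OF this gt] have gr: "square_integrable M (grads k)" by simp
  have Lest: "square_integrable M (\<lambda>w. L ** est k w)" by (rule square_integrable_linear[OF linear_matrix_mult est])
  show ?case
    unfolding step[abs_def] using sq est gr Lest
    by (intro conjI square_integrable_add square_integrable_diff square_integrable_scaleR)
qed

lemmas iter_square_integrable = state_square_integrable[THEN conjunct1]
lemmas ref_square_integrable = state_square_integrable[THEN conjunct2, THEN conjunct1]
lemmas aux_square_integrable = state_square_integrable[THEN conjunct2, THEN conjunct2]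

lemma linear_mean: "linear (mean :: real^'d^'n \<Rightarrow> real^'d)"
  by (rule linearI) (simp_all add: mean_add mean_scaleR)

lemma gap_integrable: "integrable M (\<lambda>w. gap (mean (iter k w)))"
proof -
  have sm: "L_smooth Lf (avg_fun f)" by (rule L_smooth_avg_fun[OF smooth])
  have mi: "square_integrable M (\<lambda>w. mean (iter k w))"
    by (rule square_integrable_linear[OF linear_mean iter_square_integrable])
  define D where "D = gradient (avg_fun f) 0"
  have const: "square_integrable M (\<lambda>w. D)" by (simp add: square_integrable_def)
  have bound: "gap x \<le> gap 0 + D \<bullet> x + Lf / 2 * (norm x)\<^sup>2" for x
    using L_smooth_descent[OF sm, of x 0] by (simp add: gap_def D_def)
  show ?thesis
  proof (rule Bochner_Integration.integrable_bound)
    show "integrable M (\<lambda>w. gap 0 + D \<bullet> mean (iter k w) + Lf / 2 * (norm (mean (iter k w)))\<^sup>2)"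
      using square_integrable_inner[OF const mi] mi by (simp add: square_integrable_def)
    have "continuous_on UNIV (avg_fun f)"
      using sm unfolding L_smooth_def
      by (intro continuous_at_imp_continuous_on ballI differentiable_imp_continuous_within) blast
    then have "continuous_on UNIV gap" unfolding gap_def[abs_def] by (intro continuous_intros)
    then show "(\<lambda>w. gap (mean (iter k w))) \<in> borel_measurable M"
      using mi by (intro measurable_compose[OF _ borel_measurable_continuous_onI, of _ _ gap]) (simp_all add: square_integrable_def)
    show "AE w in M. norm (gap (mean (iter k w))) \<le> norm (gap 0 + D \<bullet> mean (iter k w) + Lf / 2 * (norm (mean (iter k w)))\<^sup>2)"
      using bound gap_nonneg by (auto intro!: AE_I2 order_trans[OF _ abs_ge_self])
  qed
qed

lemma dual_square_integrable: "square_integrable M (\<lambda>w. dual (iter k w) (aux k w))"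
proof -
  have "square_integrable M (\<lambda>w. grad_at_mean f (iter k w))"
    unfolding grad_at_mean_def
    by (intro square_integrable_vec_lambda gradient_square_integrable
        square_integrable_linear[OF linear_mean] iter_square_integrable)
  then show ?thesis
    unfolding dual_def
    by (intro square_integrable_linear[OF ops.linear_K] square_integrable_add square_integrable_scaleR aux_square_integrable)
qed

lemma K_iter_square_integrable: "square_integrable M (\<lambda>w. Kop (iter k w))"
  by (rule square_integrable_linear[OF ops.linear_K iter_square_integrable])

lemma energy_integrable: "integrable M (\<lambda>w. energy (iter k w) (aux k w))"
proof -
  have P: "square_integrable M (\<lambda>w. Pop (dual (iter k w) (aux k w)))"
    by (rule square_integrable_linear[OF ops.linear_P dual_square_integrable])
  show ?thesis
    unfolding energy_def ops.potential_def
    by (intro Bochner_Integration.integrable_add integrable_mult_right square_integrable_inner gap_integrable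
        K_iter_square_integrable dual_square_integrable P)
qed

lemma gap_sq_integrable: "integrable M (\<lambda>w. (norm (iter k w - ref k w))\<^sup>2)"
  using square_integrable_diff[OF iter_square_integrable ref_square_integrable] by (simp add: square_integrable_def)

definition lyap where
  "lyap k = expectation (\<lambda>w. energy (iter k w) (aux k w) + (norm (iter k w - ref k w))\<^sup>2)"

text \<open>The expected compression error of \<open>u\<close> is at most \<open>(1 - \<phi>) |u|\<^sup>2\<close>. So its total contribution to the next step
  has the factor \<open>(1 + \<phi>2 / 2) (1 - \<phi>2)\<close> plus the injected estimate error, which is at most \<open>1 - \<eta> \<tau>\<close>.\<close>

lemma lyap_step: "lyap (Suc k) \<le> (1 - \<eta> * \<tau>) * lyap k + \<eta> * noise_coef * (real CARD('n) * \<sigma>\<^sup>2)"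
proof -
  define U where "U w = (norm (iter k w - ref k w))\<^sup>2" for w
  define e where "e w = energy (iter k w) (aux k w)" for w
  have int: "integrable M e" "integrable M U" "integrable M (comp_err k)" "integrable M (noise_err k)"
    unfolding e_def[abs_def] U_def[abs_def]
    using energy_integrable gap_sq_integrable comp_err_expectation(1)[OF iter_square_integrable ref_square_integrable]
      noise_err_expectation(1) by blast+
  have path: "energy (iter (Suc k) w) (aux (Suc k) w) + (norm (iter (Suc k) w - ref (Suc k) w))\<^sup>2
      \<le> (1 - \<eta> * \<tau>) * e w + (1 + \<phi>2 / 2) * ((1 - \<alpha> * r) * U w + \<alpha> * r * comp_err k w)
        + \<eta> * (comp_coef * (2 * r\<^sup>2 * comp_err k w + 2 * (1 - r)\<^sup>2 * U w)) + \<eta> * (noise_coef * noise_err k w)" for w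
  proof -
    have "energy (iter (Suc k) w) (aux (Suc k) w) + (norm (iter (Suc k) w - ref (Suc k) w))\<^sup>2
        \<le> (1 - \<eta> * \<tau>) * energy (iter k w) (aux k w)
        + (1 + \<phi>2 / 2) * (norm (iter k w - ref k w - \<alpha> *\<^sub>R (est k w - ref k w)))\<^sup>2
        + \<eta> * (comp_coef * (norm (est k w - iter k w))\<^sup>2) + \<eta> * (noise_coef * noise_err k w)"
      unfolding noise_err_def
      by (rule energy_step[OF mean_aux step(1,2,3)])
    also have "\<dots> \<le> (1 - \<eta> * \<tau>) * e w + (1 + \<phi>2 / 2) * ((1 - \<alpha> * r) * U w + \<alpha> * r * comp_err k w)
        + \<eta> * (comp_coef * (2 * r\<^sup>2 * comp_err k w + 2 * (1 - r)\<^sup>2 * U w)) + \<eta> * (noise_coef * noise_err k w)"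
      unfolding e_def U_def using phi2_pos eta_pos comp_coef_nonneg
      by (intro add_mono order_refl mult_left_mono norm_reference_gap_le norm_est_error_le) simp_all
    finally show ?thesis .
  qed
  define EU where "EU = expectation U"
  define EA where "EA = expectation (comp_err k)"
  define EB where "EB = expectation (noise_err k)"
  have EA: "EA \<le> (1 - \<phi>) * EU" unfolding EA_def EU_def U_def[abs_def]
    by (rule comp_err_expectation(2)[OF iter_square_integrable ref_square_integrable])
  have EB: "EB \<le> real CARD('n) * \<sigma>\<^sup>2" unfolding EB_def by (rule noise_err_expectation(2))
  have EU0: "0 \<le> EU" unfolding EU_def U_def[abs_def] by (rule integral_nonneg_AE) simp
  have "lyap (Suc k) \<le> expectation (\<lambda>w. (1 - \<eta> * \<tau>) * e w + (1 + \<phi>2 / 2) * ((1 - \<alpha> * r) * U w + \<alpha> * r * comp_err k w)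
        + \<eta> * (comp_coef * (2 * r\<^sup>2 * comp_err k w + 2 * (1 - r)\<^sup>2 * U w)) + \<eta> * (noise_coef * noise_err k w))"
    unfolding lyap_def using int energy_integrable gap_sq_integrable path
    by (intro integral_mono) simp_all
  also have "\<dots> = (1 - \<eta> * \<tau>) * expectation e + (1 + \<phi>2 / 2) * ((1 - \<alpha> * r) * EU + \<alpha> * r * EA)
        + \<eta> * (comp_coef * (2 * r\<^sup>2 * EA + 2 * (1 - r)\<^sup>2 * EU)) + \<eta> * (noise_coef * EB)"
    using int by (simp add: EU_def EA_def EB_def)
  also have "\<dots> \<le> (1 - \<eta> * \<tau>) * expectation e + (1 + \<phi>2 / 2) * ((1 - \<alpha> * r) * EU + \<alpha> * r * ((1 - \<phi>) * EU))
        + \<eta> * (comp_coef * (2 * r\<^sup>2 * ((1 - \<phi>) * EU) + 2 * (1 - r)\<^sup>2 * EU)) + \<eta> * (noise_coef * (real CARD('n) * \<sigma>\<^sup>2))"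
    using phi2_pos eta_pos comp_coef_nonneg noise_coef_nonneg alpha r_pos
    by (intro add_mono order_refl mult_left_mono EA EB) simp_all
  also have "\<dots> = (1 - \<eta> * \<tau>) * expectation e + (1 - (\<phi>2 / 2 + \<phi>2\<^sup>2 / 2)
        + \<eta> * comp_coef * (2 * r\<^sup>2 * (1 - \<phi>) + 2 * (1 - r)\<^sup>2)) * EU + \<eta> * noise_coef * (real CARD('n) * \<sigma>\<^sup>2)"
  proof -
    have "(1 - \<alpha> * r) * EU + \<alpha> * r * ((1 - \<phi>) * EU) = (1 - \<phi>2) * EU" by (simp add: phi2 algebra_simps)
    then show ?thesis by (simp only:) (simp add: algebra_simps power2_eq_square add_divide_distrib diff_divide_distrib)
  qed
  also have "\<dots> \<le> (1 - \<eta> * \<tau>) * expectation e + (1 - \<eta> * \<tau>) * EU + \<eta> * noise_coef * (real CARD('n) * \<sigma>\<^sup>2)"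
    using rate_u EU0 by (intro add_mono order_refl mult_right_mono) simp_all
  also have "\<dots> = (1 - \<eta> * \<tau>) * lyap k + \<eta> * noise_coef * (real CARD('n) * \<sigma>\<^sup>2)"
    unfolding lyap_def EU_def using int by (simp add: e_def[symmetric] U_def[symmetric] distrib_left)
  finally show ?thesis .
qed

lemma eta_rate: "0 < \<eta> * \<tau>" "\<eta> * \<tau> \<le> 1"
proof -
  show "0 < \<eta> * \<tau>" using eta_pos rate_pos by simp
  have "0 \<le> \<eta> * comp_coef * (2 * r\<^sup>2 * (1 - \<phi>) + 2 * (1 - r)\<^sup>2)"
    using eta_pos comp_coef_nonneg phi by simp
  then have "\<eta> * \<tau> \<le> \<phi>2 / 2 + \<phi>2\<^sup>2 / 2" using rate_u by linarith
  moreover have "\<phi>2\<^sup>2 \<le> 1" using phi2_pos phi2_less_1 by (simp add: power_le_one)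
  ultimately show "\<eta> * \<tau> \<le> 1" using phi2_less_1 by simp
qed

text \<open>Iterating the recursion and comparing both ends: the weight of the lower bound cancels against the initial value, and
  in the noise term it is at least the constant of the theorem.\<close>

theorem convergence:
  defines "W \<equiv> (\<lambda>k w. (\<Sum>i\<in>UNIV. (norm (iter k w $ i - mean (iter k w)))\<^sup>2)
        + real CARD('n) * (avg_fun f (mean (iter k w)) - inf_value (avg_fun f)))"
  shows "integrable M (W k)"
    "expectation (W k) \<le> (1 - \<eta> * \<tau>) ^ k * (lyapunov (P_matrix R lam) \<beta> \<omega> f x0 0 0 / ((\<beta> * lo - 1) / (2 * \<beta> * lo)))
      + noise_coef * real CARD('n) * \<sigma>\<^sup>2 / (\<tau> * ((\<beta> * lo - 1) / (2 * \<beta> * lo)))"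
proof -
  define c1 where "c1 = (\<beta> * lo - 1) / (2 * \<beta> * lo)"
  define V0 where "V0 = lyapunov (P_matrix R lam) \<beta> \<omega> f x0 0 0"
  have c1: "0 < c1" using beta_lo_gt_1 beta_pos lo_pos by (simp add: c1_def)
  have W_eq: "W k = (\<lambda>w. (norm (Kop (iter k w)))\<^sup>2 + real CARD('n) * gap (mean (iter k w)))" for k
    by (simp add: W_def fun_eq_iff norm_vec_sq K_matrix_mult gap_def)
  show int: "integrable M (W k)"
    unfolding W_eq using K_iter_square_integrable gap_integrable by (simp add: square_integrable_def)
  have "weight * expectation (W k) = expectation (\<lambda>w. weight * W k w)" by simp
  also have "\<dots> \<le> lyap k"
    unfolding lyap_def
  proof (rule integral_mono)
    show "integrable M (\<lambda>w. weight * W k w)" using int by simp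
    show "integrable M (\<lambda>w. energy (iter k w) (aux k w) + (norm (iter k w - ref k w))\<^sup>2)"
      using energy_integrable gap_sq_integrable by simp
    show "weight * W k w \<le> energy (iter k w) (aux k w) + (norm (iter k w - ref k w))\<^sup>2" for w
      using energy_lower[of "iter k w" "aux k w"] zero_le_power2[of "norm (iter k w - ref k w)"]
      unfolding W_eq by linarith
  qed
  also have "lyap k \<le> (1 - \<eta> * \<tau>) ^ k * lyap 0 + \<eta> * noise_coef * (real CARD('n) * \<sigma>\<^sup>2) / (\<eta> * \<tau>)"
    by (rule linear_recursion_le[where a = lyap, OF eta_rate _ lyap_step]) (use eta_pos noise_coef_nonneg in simp)
  also have "\<eta> * noise_coef * (real CARD('n) * \<sigma>\<^sup>2) / (\<eta> * \<tau>) = noise_coef * real CARD('n) * \<sigma>\<^sup>2 / \<tau>" using eta_pos by simp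
  also have "lyap 0 = energy x0 0 + (norm x0)\<^sup>2" by (simp add: lyap_def init prob_space)
  finally have main: "weight * expectation (W k) \<le> (1 - \<eta> * \<tau>) ^ k * (energy x0 0 + (norm x0)\<^sup>2) + noise_coef * real CARD('n) * \<sigma>\<^sup>2 / \<tau>" .
  have init_le: "energy x0 0 + (norm x0)\<^sup>2 \<le> weight * (V0 / c1)"
    using energy_initial[of x0] c1 unfolding c1_def[symmetric] V0_def[symmetric] by (simp add: field_simps)
  have noise_le: "noise_coef * real CARD('n) * \<sigma>\<^sup>2 / \<tau> \<le> weight * (noise_coef * real CARD('n) * \<sigma>\<^sup>2 / (\<tau> * c1))"
  proof -
    have "c1 \<le> weight" unfolding c1_def by (rule weight_ge)
    then have "c1 * (noise_coef * real CARD('n) * \<sigma>\<^sup>2 / (\<tau> * c1)) \<le> weight * (noise_coef * real CARD('n) * \<sigma>\<^sup>2 / (\<tau> * c1))"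
      using noise_coef_nonneg rate_pos c1 by (intro mult_right_mono) simp_all
    then show ?thesis using c1 by simp
  qed
  have "(1 - \<eta> * \<tau>) ^ k * (energy x0 0 + (norm x0)\<^sup>2) \<le> (1 - \<eta> * \<tau>) ^ k * (weight * (V0 / c1))"
    using eta_rate init_le by (intro mult_left_mono) simp_all
  then have "weight * expectation (W k) \<le> weight * ((1 - \<eta> * \<tau>) ^ k * (V0 / c1) + noise_coef * real CARD('n) * \<sigma>\<^sup>2 / (\<tau> * c1))"
    using main noise_le by (simp add: distrib_left mult_ac)
  then show "expectation (W k) \<le> (1 - \<eta> * \<tau>) ^ k * (V0 / c1) + noise_coef * real CARD('n) * \<sigma>\<^sup>2 / (\<tau> * c1)"
    using weight_pos by (rule mult_left_le_imp_le)
qed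

end

section \<open>The step-size conditions and the convergence rate\<close>

text \<open>Each entry of the maximum \<open>beta3_check\<close> makes one of the \<open>\<epsilon>\<close> constants positive or, through \<open>\<eta> = \<beta>\<^sub>2 / \<omega>\<close>, makes \<open>\<eta>\<close>
  smaller than \<open>beta4_check\<close> and hence one of the entries of the minimum in \<open>beta9\<close> positive. The rate is that
  minimum divided by \<open>beta8\<close>, which is at least \<open>1/2 + \<beta>\<^sub>1 > 3/2\<close>.\<close>

lemma cpsgd_step_size_conditions:
  fixes p :: cp_params
  assumes lo: "0 < lam_min p" "lam_min p \<le> lam_max p" and Lf: "0 < Lip p" and nu: "0 < pl_nu p"
    and phi: "0 < cmp_phi p" "cmp_phi p \<le> 1" and r: "0 < cmp_r p"
    and alpha: "0 < alpha_x p" "alpha_x p < 1 / cmp_r p"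
    and b5: "0 < beta5 p" and b1: "c0 p < beta1 p" and b2: "0 < beta2 p" and om: "beta3_check p < omega p"
  shows "admissible_parameters (lam_min p) (lam_max p) (Lip p) (phi2 p) (beta1 p) (omega p) (eta p) (beta_bar p)"
    and "(1/2 + beta1 p) * beta_bar p \<le> pl_nu p / 2"
    and "eta p * beta_bar p \<le> eps10 p - eta p * eps11 p - (eta p)\<^sup>2 * eps12 p"
    and "0 < beta_bar p" "0 < eta p" "eta p * beta_bar p \<le> 2/3" "0 < beta3_check p" "0 < c0 p"
    "0 < c1_check p" "0 < c3_check p" "alpha_x p * cmp_r p < 1"
proof -
  define \<delta> where "\<delta> = lam_min p"
  define \<Lambda> where "\<Lambda> = lam_max p"
  define \<beta> where "\<beta> = beta1 p"
  define \<omega> where "\<omega> = omega p"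
  define \<eta> where "\<eta> = eta p"
  define Lf where "Lf = Lip p"
  have l0: "0 < \<delta>" "\<delta> \<le> \<Lambda>" "0 < \<Lambda>" and Lf0: "0 < Lf" using lo Lf by (simp_all add: \<delta>_def \<Lambda>_def Lf_def)
  have beta: "1 < \<beta>" "(9 + beta5 p) / (2 * \<delta>) < \<beta>" using b1 by (simp_all add: c0_def \<beta>_def \<delta>_def)
  have beta_lo: "9 + beta5 p < 2 * (\<beta> * \<delta>)" using beta(2) l0 by (simp add: field_simps)
  have oms: "(4 + 10 * Lf\<^sup>2) / beta5 p < \<omega>" "(12 * (1 / \<delta>) + 1) / 3 < \<omega>" "sqrt (beta6 p) < \<omega>"
    "beta2 p / beta4_check p < \<omega>" "4 * beta2 p * Lf < \<omega>"
    using om by (simp_all add: beta3_check_def \<omega>_def \<delta>_def Lf_def)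
  show ar: "alpha_x p * cmp_r p < 1" using alpha r by (simp add: field_simps)
  have om0: "0 < \<omega>" using oms(5) b2 Lf0 by (smt (verit) mult_pos_pos)
  have beta3_ge: "4 * beta2 p * Lf \<le> beta3_check p" by (simp add: beta3_check_def Lf_def)
  show "0 < beta3_check p" by (rule less_le_trans[OF _ beta3_ge]) (use b2 Lf0 in simp)
  show "0 < c0 p" by (simp add: c0_def less_max_iff_disj)
  have eta_eq: "\<eta> = beta2 p / \<omega>" by (simp add: \<eta>_def eta_def \<omega>_def)
  have eta0: "0 < \<eta>" using b2 om0 by (simp add: eta_eq)
  then show "0 < eta p" by (simp add: \<eta>_def)
  have ph: "0 < phi2 p" "phi2 p < 1"
  proof -
    show "0 < phi2 p" using alpha r phi by (simp add: phi2_def)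
    have "phi2 p \<le> alpha_x p * cmp_r p * 1" unfolding phi2_def using alpha r phi by (intro mult_left_mono) simp_all
    then show "phi2 p < 1" using ar by simp
  qed
  have gam: "gamma p = \<beta> * \<omega>" by (simp add: gamma_def \<beta>_def \<omega>_def)
  have omega_lo: "4 + \<delta> / 3 < \<omega> * \<delta>"
    using oms(2) l0 by (simp add: field_simps)
  have b6: "0 \<le> beta6 p" unfolding beta6_def using l0 beta by (simp add: \<delta>_def \<beta>_def)
  have b6_le: "beta6 p \<le> \<omega>\<^sup>2"
    using power_mono[OF less_imp_le[OF oms(3)], of 2] b6 by simp
  have smooth: "16 * (1 + \<beta>) * Lf\<^sup>2 \<le> \<omega>\<^sup>2 * \<delta>"
  proof -
    have "16 * (1 + \<beta>) / \<delta> * Lf\<^sup>2 \<le> beta6 p"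
      unfolding beta6_def \<delta>_def[symmetric] \<beta>_def[symmetric] Lf_def[symmetric]
      by (intro mult_right_mono) simp_all
    then have "16 * (1 + \<beta>) / \<delta> * Lf\<^sup>2 \<le> \<omega>\<^sup>2" using b6_le by linarith
    then show ?thesis using l0 by (simp add: field_simps)
  qed
  have e1: "0 < eps1_check p"
  proof -
    have 1: "4 + 10 * Lf\<^sup>2 < \<omega> * beta5 p" using oms(1) b5 by (simp add: field_simps)
    have 2: "\<omega> * (9 + beta5 p) \<le> \<omega> * (2 * (\<beta> * \<delta>))" using beta_lo om0 by (intro mult_left_mono) simp_all
    have "eps1_check p = (\<omega> * (2 * (\<beta> * \<delta>)) - (9 * \<omega> + 4 + 10 * Lf\<^sup>2)) / 4"
      by (simp add: eps1_check_def eps1_tilde_def gam \<delta>_def[symmetric] \<omega>_def[symmetric] Lf_def[symmetric] field_simps)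
    then show ?thesis using 1 2 by (simp add: algebra_simps)
  qed
  have e2t: "0 < eps2_tilde p" unfolding eps2_tilde_def using ph by (intro add_nonneg_pos add_pos_nonneg) simp_all
  have e2: "0 < eps2_check p" unfolding eps2_check_def using e2t by (simp add: add_pos_nonneg)
  have e4: "0 < eps4 p" unfolding eps4_def \<delta>_def[symmetric] \<omega>_def[symmetric] using oms(2) by simp
  have e5: "0 < eps5 p" unfolding eps5_def \<delta>_def[symmetric] \<Lambda>_def[symmetric] \<omega>_def[symmetric]
    using l0 ph om0 by (intro add_pos_nonneg add_pos_pos) simp_all
  have e6: "0 < eps6_check p"
  proof -
    have "beta6 p / (16 * \<omega>\<^sup>2) \<le> 1/16" using b6_le om0 by (simp add: field_simps)
    moreover have "((1 + \<beta>) / (\<omega>\<^sup>2 * \<delta>) + 1 / (2 * \<omega>\<^sup>2 * \<delta>\<^sup>2)) * Lf\<^sup>2 = beta6 p / (16 * \<omega>\<^sup>2)"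
      unfolding beta6_def \<delta>_def[symmetric] \<beta>_def[symmetric] Lf_def[symmetric]
      using om0 l0 by (simp add: field_simps power2_eq_square)
    ultimately show ?thesis
      unfolding eps6_check_def \<delta>_def[symmetric] \<beta>_def[symmetric] Lf_def[symmetric] \<omega>_def[symmetric] by simp
  qed
  have e7: "0 < eps7_check p"
    unfolding eps7_check_def \<delta>_def[symmetric] \<beta>_def[symmetric] Lf_def[symmetric] \<omega>_def[symmetric]
    using Lf0 om0 l0 beta by (intro add_nonneg_pos mult_nonneg_nonneg add_nonneg_nonneg) simp_all
  have e10: "0 < eps10 p" "eps10 p \<le> 1"
  proof -
    show "0 < eps10 p" using ph by (simp add: eps10_def add_pos_pos)
    have "(phi2 p)\<^sup>2 \<le> 1" using ph by (simp add: power_le_one)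
    then show "eps10 p \<le> 1" using ph by (simp add: eps10_def)
  qed
  have r0: "0 \<le> r0 p" using phi by (simp add: r0_def)
  have e11: "0 \<le> eps11 p" unfolding eps11_def gam \<Lambda>_def[symmetric] \<omega>_def[symmetric]
    using l0 r0 om0 beta by (intro add_nonneg_nonneg mult_nonneg_nonneg) simp_all
  have e12: "r0 p \<le> eps12 p"
  proof -
    have "0 \<le> (8 + 7 * phi2 p) * (gamma p)\<^sup>2 * (lam_max p)\<^sup>2 * r0 p / phi2 p" using ph r0 by simp
    moreover have "0 \<le> 2 * (omega p)\<^sup>2 * r0 p" using r0 by simp
    ultimately show ?thesis unfolding eps12_def by (simp add: distrib_right)
  qed
  have root_pos: "0 < (sqrt ((eps11 p)\<^sup>2 + 4 * eps10 p * eps12 p) - eps11 p) / (2 * eps12 p)" if "0 < eps12 p"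
  proof -
    have "sqrt ((eps11 p)\<^sup>2) < sqrt ((eps11 p)\<^sup>2 + 4 * eps10 p * eps12 p)"
      using that e10 by (intro real_sqrt_less_mono) simp
    then show ?thesis using that e11 by simp
  qed
  have b4: "0 < beta4_check p"
    unfolding beta4_check_def using e1 e2 e4 e5 e6 e7 root_pos e12 r0
    by (subst Min_gr_iff) auto
  have eta_b4: "\<eta> < beta4_check p"
    using oms(4) b4 om0 by (simp add: eta_eq field_simps)
  have eta1: "\<eta> < eps1_check p / eps2_check p" and eta4: "\<eta> < eps4 p / eps5 p"
    using eta_b4 unfolding beta4_check_def by (subst (asm) Min_gr_iff; simp)+
  have m1: "0 < eps1_check p - eps2_check p * \<eta>" using eta1 e2 by (simp add: field_simps)
  have m1': "5/4 * Lf\<^sup>2 < eps1_tilde p - eps2_tilde p * \<eta>"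
  proof -
    have "0 \<le> Lf\<^sup>2 * \<eta>" using eta0 by simp
    then show ?thesis using m1 by (simp add: eps1_check_def eps2_check_def Lf_def[symmetric] algebra_simps)
  qed
  have m4: "0 < eps4 p - eps5 p * \<eta>" using eta4 e5 by (simp add: field_simps)
  have m10: "0 < eps10 p - eps11 p * \<eta> - eps12 p * \<eta>\<^sup>2"
  \<comment> \<open>If \<open>\<epsilon>\<^sub>1\<^sub>2 = 0\<close> then \<open>r\<^sub>0 = 0\<close>, so that \<open>\<epsilon>\<^sub>1\<^sub>1 = 0\<close> as well.\<close>
  proof (cases "eps12 p = 0")
    case True
    then have "r0 p = 0" using e12 r0 by simp
    then have "eps11 p = 0" by (simp add: eps11_def)
    then show ?thesis using True e10 by simp
  next
    case False
    then have p12: "0 < eps12 p" using e12 r0 by simp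
    have "\<eta> < (sqrt ((eps11 p)\<^sup>2 + 4 * eps10 p * eps12 p) - eps11 p) / (2 * eps12 p)"
      using eta_b4 False unfolding beta4_check_def by (subst (asm) Min_gr_iff) simp_all
    then have "2 * eps12 p * \<eta> + eps11 p < sqrt ((eps11 p)\<^sup>2 + 4 * eps10 p * eps12 p)"
      using p12 by (simp add: field_simps)
    \<comment> \<open>Below the positive root of \<open>\<epsilon>\<^sub>1\<^sub>0 - \<epsilon>\<^sub>1\<^sub>1 t - \<epsilon>\<^sub>1\<^sub>2 t\<^sup>2\<close> this polynomial is positive.\<close>
    then have "(2 * eps12 p * \<eta> + eps11 p)\<^sup>2 < (sqrt ((eps11 p)\<^sup>2 + 4 * eps10 p * eps12 p))\<^sup>2"
      using p12 eta0 e11 by (intro power_strict_mono) simp_all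
    also have "\<dots> = (eps11 p)\<^sup>2 + 4 * eps10 p * eps12 p" using p12 e10 by simp
    finally have "(4 * eps12 p) * (eps11 p * \<eta> + eps12 p * \<eta>\<^sup>2) < (4 * eps12 p) * eps10 p"
      by (simp add: power2_eq_square algebra_simps)
    then show ?thesis using p12 by simp
  qed
  define \<mu> where "\<mu> = Min {eps1_tilde p - eps2_tilde p * \<eta>, eps4 p - eps5 p * \<eta>, pl_nu p / 2,
      eps10 p / \<eta> - eps11 p - eps12 p * \<eta>}"
  have m10': "0 < eps10 p / \<eta> - eps11 p - eps12 p * \<eta>"
  proof -
    have "\<eta> * (eps10 p / \<eta> - eps11 p - eps12 p * \<eta>) = eps10 p - eps11 p * \<eta> - eps12 p * \<eta>\<^sup>2"
      using eta0 by (simp add: power2_eq_square algebra_simps)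
    then show ?thesis using m10 eta0 by (metis zero_less_mult_pos)
  qed
  have mu0: "0 < \<mu>"
  proof -
    have "0 < eps1_tilde p - eps2_tilde p * \<eta>" using m1' zero_le_power2[of Lf] by linarith
    then show ?thesis unfolding \<mu>_def using m4 m10' nu by simp
  qed
  have mu: "\<mu> \<le> eps1_tilde p - eps2_tilde p * \<eta>" "\<mu> \<le> eps4 p - eps5 p * \<eta>" "\<mu> \<le> pl_nu p / 2"
    "\<mu> \<le> eps10 p / \<eta> - eps11 p - eps12 p * \<eta>" unfolding \<mu>_def by (rule Min_le; simp)+
  define b8 where "b8 = beta8 p"
  have b8: "1/2 + \<beta> \<le> b8" by (simp add: b8_def beta8_def \<beta>_def)
  have bb: "beta_bar p = \<mu> / b8"
    using eta0 by (simp add: beta_bar_def beta9_def \<mu>_def b8_def \<eta>_def)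
  define \<tau> where "\<tau> = beta_bar p"
  have tau0: "0 < \<tau>" using mu0 b8 beta by (simp add: \<tau>_def bb)
  then show "0 < beta_bar p" by (simp add: \<tau>_def)
  have tau_le: "(1/2 + \<beta>) * \<tau> \<le> \<mu>"
  proof -
    have "(1/2 + \<beta>) * \<tau> \<le> b8 * \<tau>" using b8 tau0 by (intro mult_right_mono) simp_all
    then show ?thesis using b8 beta by (simp add: \<tau>_def bb)
  qed
  show "(1/2 + beta1 p) * beta_bar p \<le> pl_nu p / 2"
    using tau_le mu(3) unfolding \<tau>_def \<beta>_def by linarith
  have eta_mu: "\<eta> * \<mu> \<le> eps10 p - \<eta> * eps11 p - \<eta>\<^sup>2 * eps12 p"
  proof -
    have "\<eta> * \<mu> \<le> \<eta> * (eps10 p / \<eta> - eps11 p - eps12 p * \<eta>)" using mu(4) eta0 by (intro mult_left_mono) simp_all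
    also have "\<dots> = eps10 p - \<eta> * eps11 p - \<eta>\<^sup>2 * eps12 p" using eta0 by (simp add: power2_eq_square algebra_simps)
    finally show ?thesis .
  qed
  have tau_mu: "3/2 * \<tau> \<le> \<mu>"
  proof -
    have "3/2 * \<tau> \<le> (1/2 + \<beta>) * \<tau>" using beta tau0 by (intro mult_right_mono) simp_all
    then show ?thesis using tau_le by simp
  qed
  have eta_tau: "3/2 * (\<eta> * \<tau>) \<le> \<eta> * \<mu>" using mult_left_mono[OF tau_mu, of \<eta>] eta0 by simp
  have "\<eta> * \<tau> \<le> \<eta> * \<mu>" using eta_tau mult_pos_pos[OF eta0 tau0] by linarith
  then show "eta p * beta_bar p \<le> eps10 p - eta p * eps11 p - (eta p)\<^sup>2 * eps12 p"
    using eta_mu unfolding \<tau>_def \<eta>_def by linarith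
  have "0 \<le> \<eta> * eps11 p" "0 \<le> \<eta>\<^sup>2 * eps12 p" using eta0 e11 e12 r0 by simp_all
  then show "eta p * beta_bar p \<le> 2/3"
    using eta_mu eta_tau e10 unfolding \<tau>_def \<eta>_def by linarith
  show "0 < c1_check p"
  proof -
    have "\<omega> * 1 < \<omega> * (\<beta> * \<delta>)" using beta_lo b5 om0 by (intro mult_strict_left_mono) simp_all
    then have "\<omega> < gamma p * \<delta>" by (simp add: gam mult_ac)
    then show ?thesis using om0 beta l0
      unfolding c1_check_def \<delta>_def[symmetric] \<omega>_def[symmetric] by (simp add: gam)
  qed
  show "0 < c3_check p" unfolding c3_check_def \<eta>_def[symmetric] using eta0 ph by (intro add_pos_pos) simp_all
  have margin: "eps1_tilde p - eps2_tilde p * \<eta> = primal_margin \<delta> \<Lambda> Lf (phi2 p) \<beta> \<omega> \<eta>"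
    unfolding primal_margin_def eps1_tilde_def eps2_tilde_def gam \<delta>_def[symmetric] \<Lambda>_def[symmetric] \<omega>_def[symmetric] Lf_def[symmetric]
    by (simp only: mult.commute[of \<eta>])
  have rz: "eps4 p - eps5 p * \<eta> = dual_margin \<delta> \<Lambda> (phi2 p) \<omega> \<eta>"
    unfolding dual_margin_def eps4_def eps5_def \<delta>_def[symmetric] \<Lambda>_def[symmetric] \<omega>_def[symmetric]
    by (simp only: mult.commute[of \<eta>])
  show "admissible_parameters (lam_min p) (lam_max p) (Lip p) (phi2 p) (beta1 p) (omega p) (eta p) (beta_bar p)"
    unfolding \<delta>_def[symmetric] \<Lambda>_def[symmetric] \<omega>_def[symmetric] Lf_def[symmetric] \<eta>_def[symmetric] \<beta>_def[symmetric] \<tau>_def[symmetric]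
  proof
    show "0 < \<delta>" "\<delta> \<le> \<Lambda>" "0 < Lf" "0 < phi2 p" "phi2 p < 1" "0 < \<eta>" "1 < \<beta>" "0 \<le> \<tau>"
      using l0 Lf0 ph eta0 beta tau0 by simp_all
    show "9/2 < \<beta> * \<delta>" using beta_lo b5 by simp
    show "4 + \<delta> / 3 < \<omega> * \<delta>" by (rule omega_lo)
    show "16 * (1 + \<beta>) * Lf\<^sup>2 \<le> \<omega>\<^sup>2 * \<delta>" by (rule smooth)
    show "5/4 * Lf\<^sup>2 \<le> primal_margin \<delta> \<Lambda> Lf (phi2 p) \<beta> \<omega> \<eta>"
      using m1' unfolding margin by (rule less_imp_le)
    show "(1/2 + \<beta>) * \<tau> \<le> primal_margin \<delta> \<Lambda> Lf (phi2 p) \<beta> \<omega> \<eta>"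
      using order_trans[OF tau_le mu(1)] unfolding margin .
    show "(1/2 + \<beta>) * \<tau> \<le> dual_margin \<delta> \<Lambda> (phi2 p) \<omega> \<eta>"
      using order_trans[OF tau_le mu(2)] unfolding rz .
  qed
qed

theorem theorem3:
  fixes E :: "('n::finite \<times> 'n) set"
    and W L :: "real^'n^'n"
    and R :: "real^'m::finite^'n"
    and lam :: "real^'m"
    and f :: "'n \<Rightarrow> real^'d::finite \<Rightarrow> real"
    and M :: "'w measure"
    and S :: "'n \<Rightarrow> 's measure"
    and Q :: "'r measure"
    and \<xi> :: "'n \<Rightarrow> nat \<Rightarrow> 'w \<Rightarrow> 's"
    and \<zeta> :: "'n \<Rightarrow> nat \<Rightarrow> 'w \<Rightarrow> 'r"
    and g :: "'n \<Rightarrow> real^'d \<Rightarrow> 's \<Rightarrow> real^'d"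
    and C :: "'r \<Rightarrow> real^'d \<Rightarrow> real^'d"
    and x0 :: "real^'d^'n"
    and X :: "nat \<Rightarrow> 'w \<Rightarrow> real^'d^'n"
    and Lf \<sigma> \<nu> \<phi> r \<alpha> \<beta>1 \<beta>2 \<beta>5 \<omega> \<eta> V0 :: real
    and p :: cp_params
  assumes graph: "weighted_graph E W" "connected_graph E"
    and L: "L = laplacian W"
    and decomposition: "laplacian_decomposition L R lam"
    and smooth: "0 < Lf" "\<And>i. L_smooth Lf (f i)"
    and M: "prob_space M"
    and samples: "prob_space.indep_vars M (\<lambda>(i, k). S i) (\<lambda>(i, k). \<xi> i k) (UNIV :: ('n \<times> nat) set)"
    and seeds: "prob_space Q" "fresh_seeds M S Q \<xi> \<zeta>"
    and g_measurable: "\<And>i. (\<lambda>(x, s). g i x s) \<in> borel \<Otimes>\<^sub>M S i \<rightarrow>\<^sub>M borel"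
    and C_measurable: "(\<lambda>(z, x). C z x) \<in> Q \<Otimes>\<^sub>M borel \<rightarrow>\<^sub>M borel"
    and noise: "0 < \<sigma>"
      "\<And>i k x. integrable M (\<lambda>w. (norm (g i x (\<xi> i k w) - gradient (f i) x))\<^sup>2)"
      "\<And>i k x. (\<integral>w. (norm (g i x (\<xi> i k w) - gradient (f i) x))\<^sup>2 \<partial>M) \<le> \<sigma>\<^sup>2"
    and bounded_below: "bdd_below (range (avg_fun f))"
    and PL: "0 < \<nu>"
      "\<And>x. 1/2 * (norm (gradient (avg_fun f) x))\<^sup>2 \<ge> \<nu> * (avg_fun f x - inf_value (avg_fun f))"
    and compressor: "0 < \<phi>" "\<phi> \<le> 1" "0 < r"
      "\<And>x. integrable Q (\<lambda>z. (norm ((1/r) *\<^sub>R C z x - x))\<^sup>2)"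
      "\<And>x. (\<integral>z. (norm ((1/r) *\<^sub>R C z x - x))\<^sup>2 \<partial>Q) \<le> (1 - \<phi>) * (norm x)\<^sup>2"
    and p: "p = \<lparr>lam_min = min_pos_eigenvalue L, lam_max = spectral_radius L, Lip = Lf, pl_nu = \<nu>,
        cmp_phi = \<phi>, cmp_r = r, alpha_x = \<alpha>, beta1 = \<beta>1, beta2 = \<beta>2, beta5 = \<beta>5, omega = \<omega>\<rparr>"
    and parameters: "0 < \<beta>5" "c0 p < \<beta>1" "0 < \<beta>2" "beta3_check p < \<omega>" "\<eta> = \<beta>2 / \<omega>"
      "0 < \<alpha>" "\<alpha> < 1 / r"
    and X: "X = (\<lambda>k w. fst (cpsgd L C g \<alpha> (\<lambda>_. \<eta>) (\<lambda>_. \<beta>1 * \<omega>) (\<lambda>_. \<omega>) x0 \<xi> \<zeta> w k))"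
    and V0: "V0 = lyapunov (P_matrix R lam) \<beta>1 \<omega> f x0 0 0"
  shows "(\<forall>k.
      integrable M (\<lambda>w. (\<Sum>i\<in>UNIV. (norm (X (k + 1) w $ i - mean (X (k + 1) w)))\<^sup>2)
        + real CARD('n) * (avg_fun f (mean (X (k + 1) w)) - inf_value (avg_fun f))) \<and>
      (\<integral>w. (\<Sum>i\<in>UNIV. (norm (X (k + 1) w $ i - mean (X (k + 1) w)))\<^sup>2)
        + real CARD('n) * (avg_fun f (mean (X (k + 1) w)) - inf_value (avg_fun f)) \<partial>M)
      \<le> (1 - \<eta> * beta_bar p) ^ (k + 1) * (V0 / c1_check p)
        + c3_check p * real CARD('n) * \<sigma>\<^sup>2 / (beta_bar p * c1_check p)) \<and>
    0 < \<eta> * beta_bar p \<and> \<eta> * beta_bar p \<le> 2/3 \<and>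
    0 < beta_bar p \<and> 0 < beta3_check p \<and> 0 < c0 p \<and> 0 < c1_check p \<and> 0 < c3_check p \<and> 0 \<le> V0"

proof -
  have sel: "lam_min p = min_pos_eigenvalue L" "lam_max p = spectral_radius L" "Lip p = Lf" "pl_nu p = \<nu>"
    "cmp_phi p = \<phi>" "cmp_r p = r" "alpha_x p = \<alpha>" "beta1 p = \<beta>1" "beta2 p = \<beta>2" "beta5 p = \<beta>5" "omega p = \<omega>"
    by (simp_all add: p)
  have eta: "eta p = \<eta>" by (simp add: eta_def sel parameters(5))
  have gam: "gamma p = \<beta>1 * \<omega>" by (simp add: gamma_def sel)
  have lo: "0 < lam_min p" "lam_min p \<le> lam_max p"
    using min_pos_eigenvalue[OF decomposition] lam_le_spectral_radius[OF decomposition] unfolding sel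
    by (blast intro: order_trans)+
  note cond = cpsgd_step_size_conditions[OF lo _ _ _ _ _ _ _ _ _ _ _, unfolded sel eta,
      OF smooth(1) PL(1) compressor(1,2,3) parameters(6,7,1,2,3,4)]
  have om0: "0 < \<omega>" using cond(7) parameters(4) by simp
  have ph0: "0 < phi2 p" using parameters(6) compressor(1,3) by (simp add: phi2_def sel)
  interpret M: prob_space M by (rule M)
  interpret A: admissible_parameters "min_pos_eigenvalue L" "spectral_radius L" Lf "phi2 p" \<beta>1 \<omega> \<eta> "beta_bar p"
    by (rule cond(1))
  interpret run: cpsgd_run L Lf "phi2 p" \<beta>1 \<omega> \<eta> "beta_bar p" R lam f \<nu> M S Q \<xi> \<zeta> g C x0 \<sigma> \<phi> r \<alpha>
  proof
    show "\<xi> i k \<in> M \<rightarrow>\<^sub>M S i" for i k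
      using samples unfolding M.indep_vars_def by (auto dest!: bspec[of _ _ "(i, k)"])
    show "phi2 p = \<alpha> * r * \<phi>" by (simp add: phi2_def sel)
    have "\<eta> * A.comp_coef * (2 * r\<^sup>2 * (1 - \<phi>) + 2 * (1 - r)\<^sup>2) = \<eta> * eps11 p + \<eta>\<^sup>2 * eps12 p"
    proof -
      have r0: "2 * r\<^sup>2 * (1 - \<phi>) + 2 * (1 - r)\<^sup>2 = r0 p" by (simp add: r0_def sel)
      have "(8 + 7 * phi2 p) * (gamma p)\<^sup>2 * (lam_max p)\<^sup>2 * r0 p / phi2 p
          = (7 + 8 / phi2 p) * (\<beta>1 * \<omega>)\<^sup>2 * (spectral_radius L)\<^sup>2 * r0 p"
        using ph0 by (simp add: gam sel field_simps)
      then show ?thesis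
        unfolding r0 A.comp_coef_def eps11_def eps12_def gam sel by (simp add: algebra_simps power2_eq_square)
    qed
    then show "\<eta> * beta_bar p \<le> phi2 p / 2 + (phi2 p)\<^sup>2 / 2 - \<eta> * A.comp_coef * (2 * r\<^sup>2 * (1 - \<phi>) + 2 * (1 - r)\<^sup>2)"
      using cond(3) unfolding eps10_def by simp
  qed (fact decomposition smooth(2) bounded_below PL(2) cond(2) seeds(2) g_measurable C_measurable noise(2,3)
      compressor parameters(6) cond(11) cond(4))+
  have X_iter: "X = run.iter" by (simp add: X run.iter_def fun_eq_iff)
  have c1: "c1_check p = (\<beta>1 * min_pos_eigenvalue L - 1) / (2 * \<beta>1 * min_pos_eigenvalue L)"
  proof -
    have "c1_check p = (\<omega> * (\<beta>1 * min_pos_eigenvalue L - 1)) / (\<omega> * (2 * \<beta>1 * min_pos_eigenvalue L))"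
      by (simp add: c1_check_def gam sel algebra_simps)
    then show ?thesis using om0 by simp
  qed
  have c3: "c3_check p = A.noise_coef" by (simp add: c3_check_def A.noise_coef_def eta)
  have V0_nonneg: "0 \<le> V0" unfolding V0 by (rule run.lyapunov_nonneg)
  show ?thesis
    using run.convergence[folded X_iter V0 c1 c3] V0_nonneg run.eta_rate(1) cond by blast
qed

end
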